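(* Let $X=\{z\in\mathbb C:|z|<1\}$, $n\ge 2$, and let $\gamma_1,\dots,\gamma_{n-1}$ be holomorphic functions on $X$ such that $\prod_{i=1}^{n-1}\gamma_i^{\,i(n-i)}=\alpha^{\frac{n(n^2-1)}{6}}$ for a holomorphic function $\alpha$ on $X$ which is not identically $0$. Consider the Higgs bundle $(E,\theta)$ with $E=\mathcal O e_1\oplus\cdots\oplus\mathcal O e_n$ and $\theta(e_i)=\gamma_i\,e_{i+1}\,dz$ for $1\le i\le n-1$, $\theta(e_n)=0$. If there exists a diagonal harmonic metric on $(E,\theta)$, then there exists a non-vanishing holomorphic function $f$ on $X$ such that $|\alpha f|^2\in\mathcal A$.
   Context: Harmonic metric: for a Higgs bundle $(E,\bar\partial_E,\theta)$ and a Hermitian metric $h$, let $\nabla_h$ be the Chern connection and $\theta^{*h}$ the adjoint of $\theta$; $h$ is harmonic if $\nabla_h\circ\nabla_h+[\theta,\theta^{*h}]=0$. Diagonal means that $e_1,\dots,e_n$ are pairwise orthogonal. Non-vanishing means without zeros on $X$. $\mathcal A$ is the set of smooth nonnegative functions $f$ on $X$ with $\int_X f(z)(1-|z|^2)\,d\sigma<\infty$, where $d\sigma$ is Lebesgue measure. *)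

theory Defs
  imports "HOL-Analysis.Analysis" "HOL-Complex_Analysis.Complex_Analysis" "Jordan_Normal_Form.Matrix"
begin

no_notation Finite_Cartesian_Product.vec_nth (infixl "$" 90)

abbreviation unit_disc :: "complex set" where
  "unit_disc \<equiv> ball 0 1"

section \<open>Smooth functions and Wirtinger derivatives\<close>

definition deriv_x :: "(complex \<Rightarrow> 'b::real_normed_vector) \<Rightarrow> complex \<Rightarrow> 'b" where
  "deriv_x f z = frechet_derivative f (at z) 1"

definition deriv_y :: "(complex \<Rightarrow> 'b::real_normed_vector) \<Rightarrow> complex \<Rightarrow> 'b" where
  "deriv_y f z = frechet_derivative f (at z) \<i>"

text \<open>Real differentiability; the set \<open>X\<close> is meant to be open.\<close>

primrec Ck_on :: "nat \<Rightarrow> complex set \<Rightarrow> (complex \<Rightarrow> 'b::real_normed_vector) \<Rightarrow> bool" where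
  "Ck_on 0 X f \<longleftrightarrow> continuous_on X f"
| "Ck_on (Suc k) X f \<longleftrightarrow>
     (\<forall>z\<in>X. f differentiable (at z)) \<and> Ck_on k X (deriv_x f) \<and> Ck_on k X (deriv_y f)"

definition smooth_on :: "complex set \<Rightarrow> (complex \<Rightarrow> 'b::real_normed_vector) \<Rightarrow> bool" where
  "smooth_on X f \<longleftrightarrow> (\<forall>k. Ck_on k X f)"

definition wirtinger_z :: "(complex \<Rightarrow> complex) \<Rightarrow> complex \<Rightarrow> complex" where
  "wirtinger_z f z = (deriv_x f z - \<i> * deriv_y f z) / 2"

definition wirtinger_zbar :: "(complex \<Rightarrow> complex) \<Rightarrow> complex \<Rightarrow> complex" where
  "wirtinger_zbar f z = (deriv_x f z + \<i> * deriv_y f z) / 2"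

section \<open>Hermitian metrics on a trivialised bundle\<close>

text \<open>
  The bundle is the direct sum of \<open>n\<close> copies of the structure sheaf over an open set \<open>X\<close> of the
  plane. In the holomorphic frame \<open>e\<^sub>1, \<dots>, e\<^sub>n\<close> a section is a vector-valued function, the
  fibre over every point is \<open>carrier_vec n\<close>, and an endomorphism-valued (1,0)-form
  \<open>\<Theta> dz\<close> is given by its matrix-valued coefficient \<open>\<Theta>\<close>. Vectors are indexed from 0.
\<close>

definition frame :: "nat \<Rightarrow> nat \<Rightarrow> complex vec" where
  "frame n i = unit_vec n (i - 1)"

definition smooth_section :: "nat \<Rightarrow> complex set \<Rightarrow> (complex \<Rightarrow> complex vec) \<Rightarrow> bool" where
  "smooth_section n X s \<longleftrightarrow>
     (\<forall>z\<in>X. s z \<in> carrier_vec n) \<and> (\<forall>i<n. smooth_on X (\<lambda>z. s z $ i))"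

definition smooth_mat :: "nat \<Rightarrow> complex set \<Rightarrow> (complex \<Rightarrow> complex mat) \<Rightarrow> bool" where
  "smooth_mat n X A \<longleftrightarrow>
     (\<forall>z\<in>X. A z \<in> carrier_mat n n) \<and> (\<forall>i<n. \<forall>j<n. smooth_on X (\<lambda>z. A z $$ (i, j)))"

definition hermitian_metric ::
  "nat \<Rightarrow> complex set \<Rightarrow> (complex \<Rightarrow> complex vec \<Rightarrow> complex vec \<Rightarrow> complex) \<Rightarrow> bool" where
  "hermitian_metric n X h \<longleftrightarrow>
     (\<forall>z\<in>X.
        (\<forall>u\<in>carrier_vec n. \<forall>v\<in>carrier_vec n. \<forall>w\<in>carrier_vec n.
           h z (u + v) w = h z u w + h z v w) \<and>
        (\<forall>c. \<forall>u\<in>carrier_vec n. \<forall>v\<in>carrier_vec n. h z (c \<cdot>\<^sub>v u) v = c * h z u v) \<and>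
        (\<forall>u\<in>carrier_vec n. \<forall>v\<in>carrier_vec n. h z v u = cnj (h z u v)) \<and>
        (\<forall>u\<in>carrier_vec n. u \<noteq> 0\<^sub>v n \<longrightarrow> 0 < Re (h z u u))) \<and>
     (\<forall>i\<in>{1..n}. \<forall>j\<in>{1..n}. smooth_on X (\<lambda>z. h z (frame n i) (frame n j)))"

definition diagonal_metric ::
  "nat \<Rightarrow> complex set \<Rightarrow> (complex \<Rightarrow> complex vec \<Rightarrow> complex vec \<Rightarrow> complex) \<Rightarrow> bool" where
  "diagonal_metric n X h \<longleftrightarrow>
     (\<forall>z\<in>X. \<forall>i\<in>{1..n}. \<forall>j\<in>{1..n}. i \<noteq> j \<longrightarrow> h z (frame n i) (frame n j) = 0)"

section \<open>Chern connection and harmonic metrics\<close>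

text \<open>
  A connection is written \<open>\<nabla>s = (\<nabla>\<^sub>z s) dz + (\<nabla>\<^sub>z\<^sub>b\<^sub>a\<^sub>r s) dzbar\<close>. The frame is holomorphic, so the
  holomorphic structure acts componentwise, by \<open>delbar\<close>; a connection whose (0,1)-part is that
  operator is determined by a matrix-valued function \<open>A\<close> through
  \<open>\<nabla> = d + A dz\<close>.
\<close>

definition delbar :: "nat \<Rightarrow> (complex \<Rightarrow> complex vec) \<Rightarrow> complex \<Rightarrow> complex vec" where
  "delbar n s z = vec n (\<lambda>i. wirtinger_zbar (\<lambda>w. s w $ i) z)"

definition nabla_z ::
  "nat \<Rightarrow> (complex \<Rightarrow> complex mat) \<Rightarrow> (complex \<Rightarrow> complex vec) \<Rightarrow> complex \<Rightarrow> complex vec" where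
  "nabla_z n A s z = vec n (\<lambda>i. wirtinger_z (\<lambda>w. s w $ i) z) + A z *\<^sub>v s z"

text \<open>
  Compatibility with the metric is \<open>d h(s,t) = h(\<nabla>s, t) + h(s, \<nabla>t)\<close>. As \<open>h\<close> is
  conjugate-linear in its second argument, \<open>h(s, (\<nabla>\<^sub>z\<^sub>b\<^sub>a\<^sub>r t) dzbar)\<close> contributes to the
  \<open>dz\<close>-part and \<open>h(s, (\<nabla>\<^sub>z t) dz)\<close> to the \<open>dzbar\<close>-part.
\<close>

definition chern_connection ::
  "nat \<Rightarrow> complex set \<Rightarrow> (complex \<Rightarrow> complex vec \<Rightarrow> complex vec \<Rightarrow> complex)
     \<Rightarrow> (complex \<Rightarrow> complex mat) \<Rightarrow> bool" where
  "chern_connection n X h A \<longleftrightarrow>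
     smooth_mat n X A \<and>
     (\<forall>s t. smooth_section n X s \<longrightarrow> smooth_section n X t \<longrightarrow>
        (\<forall>z\<in>X.
           wirtinger_z (\<lambda>w. h w (s w) (t w)) z =
             h z (nabla_z n A s z) (t z) + h z (s z) (delbar n t z) \<and>
           wirtinger_zbar (\<lambda>w. h w (s w) (t w)) z =
             h z (delbar n s z) (t z) + h z (s z) (nabla_z n A t z)))"

text \<open>
  Coefficient of \<open>dz \<and> dzbar\<close> in \<open>\<nabla>(\<nabla>s)\<close>: the term \<open>(\<nabla>\<^sub>z s) dz\<close> contributes
  \<open>(\<nabla>\<^sub>z\<^sub>b\<^sub>a\<^sub>r \<nabla>\<^sub>z s) dzbar \<and> dz\<close>, whence the minus sign.
\<close>

definition curvature ::
  "nat \<Rightarrow> (complex \<Rightarrow> complex mat) \<Rightarrow> (complex \<Rightarrow> complex vec) \<Rightarrow> complex \<Rightarrow> complex vec" where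
  "curvature n A s z = nabla_z n A (delbar n s) z - delbar n (nabla_z n A s) z"

text \<open>
  \<open>\<Theta>' dzbar\<close> is the adjoint of \<open>\<Theta> dz\<close>.
\<close>

definition metric_adjoint ::
  "nat \<Rightarrow> complex set \<Rightarrow> (complex \<Rightarrow> complex vec \<Rightarrow> complex vec \<Rightarrow> complex)
     \<Rightarrow> (complex \<Rightarrow> complex mat) \<Rightarrow> (complex \<Rightarrow> complex mat) \<Rightarrow> bool" where
  "metric_adjoint n X h \<Theta> \<Theta>' \<longleftrightarrow>
     (\<forall>z\<in>X. \<Theta>' z \<in> carrier_mat n n \<and>
        (\<forall>u\<in>carrier_vec n. \<forall>v\<in>carrier_vec n. h z (\<Theta> z *\<^sub>v u) v = h z u (\<Theta>' z *\<^sub>v v)))"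

text \<open>
  The Chern connection \<open>d + A dz\<close> and the adjoint \<open>\<Theta>'\<close> are uniquely determined on \<open>X\<close> by \<open>h\<close>.
  The bracket is the graded one,
  \<open>[\<Theta> dz, \<Theta>' dzbar] = (\<Theta> \<Theta>' - \<Theta>' \<Theta>) dz \<and> dzbar\<close>,
  and the equation compares coefficients of \<open>dz \<and> dzbar\<close>.
\<close>

definition harmonic_metric ::
  "nat \<Rightarrow> complex set \<Rightarrow> (complex \<Rightarrow> complex mat)
     \<Rightarrow> (complex \<Rightarrow> complex vec \<Rightarrow> complex vec \<Rightarrow> complex) \<Rightarrow> bool" where
  "harmonic_metric n X \<Theta> h \<longleftrightarrow>
     hermitian_metric n X h \<and>
     (\<exists>A \<Theta>'. chern_connection n X h A \<and> metric_adjoint n X h \<Theta> \<Theta>' \<and>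
        (\<forall>s. smooth_section n X s \<longrightarrow>
           (\<forall>z\<in>X. curvature n A s z + (\<Theta> z * \<Theta>' z - \<Theta>' z * \<Theta> z) *\<^sub>v s z = 0\<^sub>v n)))"

section \<open>The class \<open>\<A>\<close>\<close>

definition class_A :: "(complex \<Rightarrow> real) set" where
  "class_A = {f. smooth_on unit_disc f \<and> (\<forall>z\<in>unit_disc. 0 \<le> f z) \<and>
     (\<integral>\<^sup>+z\<in>unit_disc. ennreal (f z * (1 - (cmod z)\<^sup>2)) \<partial>lborel) < \<infinity>}"

end

theory Submission
  imports Defs "HOL-Computational_Algebra.Computational_Algebra" "HOL-Homology.Invariance_of_Domain"
begin

text \<open>
  For a diagonal harmonic metric with \<open>h\<^sub>i = |e\<^sub>i|\<^sup>2\<close> and \<open>N = \<Sum> i (n - i)\<close>, the harmonic equation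
  is a Toda system, and it makes \<open>\<phi> = N\<^sup>-\<^sup>1 \<Sum> i (n - i) ln (h\<^bsub>i+1\<^esub> / h\<^sub>i) - ln N\<close> a solution of
  \<open>\<Delta>\<phi> \<ge> 8 |\<alpha>|\<^sup>2 e\<^sup>\<phi>\<close>: the density \<open>|\<alpha>|\<^sup>2 e\<^sup>\<phi>\<close> has curvature at most \<open>-4\<close>. On a disc of radius
  \<open>r < 1\<close> the function \<open>\<alpha>\<close> has finitely many zeros, and by a theorem of Heins there is a finite
  Blaschke product \<open>F\<close> whose critical points are exactly these zeros, so \<open>F' = \<alpha> f\<close> with \<open>f\<close> without
  zeros. By the Ahlfors lemma the hyperbolic density pulled back by \<open>F\<close> dominates \<open>|\<alpha>|\<^sup>2 e\<^sup>\<phi>\<close>, which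
  bounds \<open>1 / f\<close> locally, uniformly in \<open>r\<close>, whereas \<open>|F| \<le> 1\<close> bounds the integral of
  \<open>|\<alpha> f|\<^sup>2 (1 - |z|\<^sup>2)\<close>. Montel's theorem, Hurwitz' theorem and Fatou's lemma give the limit \<open>r \<rightarrow> 1\<close>.
\<close>

text \<open>The weights i (n - i) have constant second difference -2. Summed against them, the Toda
  coupling between neighbours collapses to a positive multiple of the sum of the terms
  |\<gamma>_i|^2 h_(i+1) / h_i, and the product hypothesis identifies the weighted geometric mean of
  these terms with |\<alpha>|^2 times an exponential. Two obstacles shape the rest. Near the unit
  circle \<alpha> may have infinitely many zeros and \<phi> may be unbounded. A smaller disc removes
  both, but then the functions f must converge as its radius grows: \<phi> keeps them from tending
  to 0, the bound on F' = \<alpha> f from tending to infinity. The other obstacle is the existence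
  of F. Its Wronskian determines F, because two solutions of a Liouville equation with equal
  boundary behaviour coincide, by the same maximum principle that proves the Ahlfors lemma;
  invariance of domain turns this injectivity into openness, so no Jacobian is computed. In the
  Ahlfors comparison \<alpha> cancels from F' = \<alpha> f: only e^\<phi> and |f|^2 / (1 - |F|^2)^2
  are compared, and no singular points arise.\<close>

section \<open>Second derivatives and the maximum principle\<close>

text \<open>
  Only derivatives along the two coordinate lines are required, the first ones near the point and
  the second ones at the point itself: the second derivative test needs no more.
\<close>

definition has_laplacian :: "(complex \<Rightarrow> real) \<Rightarrow> real \<Rightarrow> complex \<Rightarrow> bool" where
  "has_laplacian g L z \<longleftrightarrow> (\<exists>gx gy a b. L = a + b \<and>
     (\<forall>\<^sub>F w in nhds z. ((\<lambda>t. g (w + 1 * of_real t)) has_real_derivative gx w) (at 0)) \<and>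
     (\<forall>\<^sub>F w in nhds z. ((\<lambda>t. g (w + \<i> * of_real t)) has_real_derivative gy w) (at 0)) \<and>
     ((\<lambda>t. gx (z + 1 * of_real t)) has_real_derivative a) (at 0) \<and>
     ((\<lambda>t. gy (z + \<i> * of_real t)) has_real_derivative b) (at 0))"

lemma has_laplacian_add:
  assumes "has_laplacian f K z" "has_laplacian g L z"
  shows "has_laplacian (\<lambda>w. f w + g w) (K + L) z"
proof -
  from assms(1) obtain fx fy a b where f: "K = a + b"
     "\<forall>\<^sub>F w in nhds z. ((\<lambda>t. f (w + 1 * of_real t)) has_real_derivative fx w) (at 0)"
     "\<forall>\<^sub>F w in nhds z. ((\<lambda>t. f (w + \<i> * of_real t)) has_real_derivative fy w) (at 0)"
     "((\<lambda>t. fx (z + 1 * of_real t)) has_real_derivative a) (at 0)"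
     "((\<lambda>t. fy (z + \<i> * of_real t)) has_real_derivative b) (at 0)"
    unfolding has_laplacian_def by blast
  from assms(2) obtain gx gy c d where g: "L = c + d"
     "\<forall>\<^sub>F w in nhds z. ((\<lambda>t. g (w + 1 * of_real t)) has_real_derivative gx w) (at 0)"
     "\<forall>\<^sub>F w in nhds z. ((\<lambda>t. g (w + \<i> * of_real t)) has_real_derivative gy w) (at 0)"
     "((\<lambda>t. gx (z + 1 * of_real t)) has_real_derivative c) (at 0)"
     "((\<lambda>t. gy (z + \<i> * of_real t)) has_real_derivative d) (at 0)"
    unfolding has_laplacian_def by blast
  show ?thesis
    unfolding has_laplacian_def
  proof (intro exI conjI)
    show "K + L = (a + c) + (b + d)" using f g by simp
    show "\<forall>\<^sub>F w in nhds z. ((\<lambda>t. f (w + 1 * of_real t) + g (w + 1 * of_real t))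
        has_real_derivative (fx w + gx w)) (at 0)"
      using f(2) g(2) by eventually_elim (rule DERIV_add)
    show "\<forall>\<^sub>F w in nhds z. ((\<lambda>t. f (w + \<i> * of_real t) + g (w + \<i> * of_real t))
        has_real_derivative (fy w + gy w)) (at 0)"
      using f(3) g(3) by eventually_elim (rule DERIV_add)
  qed (intro DERIV_add f g)+
qed

lemma has_laplacian_cmult:
  assumes "has_laplacian f K z"
  shows "has_laplacian (\<lambda>w. c * f w) (c * K) z"
proof -
  from assms obtain fx fy a b where f: "K = a + b"
     "\<forall>\<^sub>F w in nhds z. ((\<lambda>t. f (w + 1 * of_real t)) has_real_derivative fx w) (at 0)"
     "\<forall>\<^sub>F w in nhds z. ((\<lambda>t. f (w + \<i> * of_real t)) has_real_derivative fy w) (at 0)"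
     "((\<lambda>t. fx (z + 1 * of_real t)) has_real_derivative a) (at 0)"
     "((\<lambda>t. fy (z + \<i> * of_real t)) has_real_derivative b) (at 0)"
    unfolding has_laplacian_def by blast
  show ?thesis
    unfolding has_laplacian_def
  proof (intro exI conjI)
    show "c * K = c * a + c * b" using f by (simp add: distrib_left)
    show "\<forall>\<^sub>F w in nhds z. ((\<lambda>t. c * f (w + 1 * of_real t)) has_real_derivative c * fx w) (at 0)"
      using f(2) by eventually_elim (rule DERIV_cmult)
    show "\<forall>\<^sub>F w in nhds z. ((\<lambda>t. c * f (w + \<i> * of_real t)) has_real_derivative c * fy w) (at 0)"
      using f(3) by eventually_elim (rule DERIV_cmult)
  qed (intro DERIV_cmult f)+
qed

lemma has_laplacian_const: "has_laplacian (\<lambda>w. c) 0 z"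
  unfolding has_laplacian_def
  by (rule exI[of _ "\<lambda>_. 0"], rule exI[of _ "\<lambda>_. 0"], rule exI[of _ 0], rule exI[of _ 0]) auto

lemma has_laplacian_sum:
  assumes "finite I" "\<And>i. i \<in> I \<Longrightarrow> has_laplacian (f i) (K i) z"
  shows "has_laplacian (\<lambda>w. \<Sum>i\<in>I. f i w) (\<Sum>i\<in>I. K i) z"
  using assms by (induction I) (auto intro: has_laplacian_const has_laplacian_add)

lemma has_laplacian_diff:
  assumes "has_laplacian f K z" "has_laplacian g L z"
  shows "has_laplacian (\<lambda>w. f w - g w) (K - L) z"
  using has_laplacian_add[OF assms(1) has_laplacian_cmult[OF assms(2), of "-1"]] by simp

lemma tendsto_line: "((\<lambda>t. z + u * of_real t) \<longlongrightarrow> z) (nhds (0::real))" for z :: complex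
proof -
  have "isCont (\<lambda>t::real. z + u * of_real t) 0" by (intro continuous_intros)
  then show ?thesis
    using tendsto_at_iff_tendsto_nhds[of "\<lambda>t::real. z + u * of_real t" 0] unfolding isCont_def by simp
qed

lemma eventually_line:
  assumes "\<forall>\<^sub>F w in nhds (z::complex). P w"
  shows "\<forall>\<^sub>F t in nhds (0::real). P (z + u * of_real t)"
  using tendsto_line[of z u] assms unfolding filterlim_iff by blast

lemma has_laplacian_cong:
  assumes "\<forall>\<^sub>F w in nhds z. f w = g w" "has_laplacian f K z"
  shows "has_laplacian g K z"
proof -
  from assms(2) obtain fx fy a b where f: "K = a + b"
     "\<forall>\<^sub>F w in nhds z. ((\<lambda>t. f (w + 1 * of_real t)) has_real_derivative fx w) (at 0)"
     "\<forall>\<^sub>F w in nhds z. ((\<lambda>t. f (w + \<i> * of_real t)) has_real_derivative fy w) (at 0)"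
     "((\<lambda>t. fx (z + 1 * of_real t)) has_real_derivative a) (at 0)"
     "((\<lambda>t. fy (z + \<i> * of_real t)) has_real_derivative b) (at 0)"
    unfolding has_laplacian_def by blast
  \<comment> \<open>First derivatives are taken at every \<open>w\<close> near \<open>z\<close>, so
    the equality is needed near each such \<open>w\<close>.\<close>
  from assms(1) have ev: "\<forall>\<^sub>F w in nhds z. \<forall>\<^sub>F v in nhds w. f v = g v"
    by (simp add: eventually_eventually)
  have tr: "((\<lambda>t. g (w + u * of_real t)) has_real_derivative d) (at 0)"
    if "((\<lambda>t. f (w + u * of_real t)) has_real_derivative d) (at 0)"
       "\<forall>\<^sub>F v in nhds w. f v = g v" for w u d
    using DERIV_cong_ev[OF refl eventually_line[OF that(2), of u] refl] that(1) by simp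
  show ?thesis
    unfolding has_laplacian_def
  proof (intro exI conjI)
    show "\<forall>\<^sub>F w in nhds z. ((\<lambda>t. g (w + 1 * of_real t)) has_real_derivative fx w) (at 0)"
      using f(2) ev by eventually_elim (rule tr)
    show "\<forall>\<^sub>F w in nhds z. ((\<lambda>t. g (w + \<i> * of_real t)) has_real_derivative fy w) (at 0)"
      using f(3) ev by eventually_elim (rule tr)
  qed (rule f(1) f(4) f(5))+
qed

text \<open>Each of the two derivatives along a line brings out one factor \<open>r\<close>. This
  transports the differential inequality from the disc of radius \<open>r\<close> to the unit
  disc.\<close>

lemma has_laplacian_scale:
  assumes "has_laplacian f K (of_real r * z)" "r > 0"
  shows "has_laplacian (\<lambda>w. f (of_real r * w)) (r\<^sup>2 * K) z"
proof -
  from assms obtain fx fy a b where f: "K = a + b"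
     "\<forall>\<^sub>F w in nhds (of_real r * z). ((\<lambda>t. f (w + 1 * of_real t)) has_real_derivative fx w) (at 0)"
     "\<forall>\<^sub>F w in nhds (of_real r * z). ((\<lambda>t. f (w + \<i> * of_real t)) has_real_derivative fy w) (at 0)"
     "((\<lambda>t. fx (of_real r * z + 1 * of_real t)) has_real_derivative a) (at 0)"
     "((\<lambda>t. fy (of_real r * z + \<i> * of_real t)) has_real_derivative b) (at 0)"
    unfolding has_laplacian_def by blast
  have sc: "((\<lambda>t. h (of_real r * (w + u * of_real t))) has_real_derivative d * r) (at 0)"
    if "((\<lambda>t. h (of_real r * w + u * of_real t)) has_real_derivative d) (at 0)"
    for h :: "complex \<Rightarrow> real" and w u d
  proof -
    have "((\<lambda>t. r * t) has_real_derivative r) (at 0)"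
      by (auto intro!: derivative_eq_intros)
    moreover have "((\<lambda>t. h (of_real r * w + u * of_real t)) has_real_derivative d) (at (r * 0))"
      using that by simp
    ultimately have "((\<lambda>t. h (of_real r * w + u * of_real (r * t))) has_real_derivative d * r) (at 0)"
      using DERIV_chain2[of "\<lambda>t. h (of_real r * w + u * of_real t)" d "\<lambda>t. r * t" 0 r] by simp
    then show ?thesis by (simp add: algebra_simps)
  qed
  have lim: "((\<lambda>w. of_real r * w) \<longlongrightarrow> of_real r * z) (nhds z)"
    by (intro tendsto_intros filterlim_ident)
  have ev: "\<forall>\<^sub>F w in nhds z. P (of_real r * w)" if "\<forall>\<^sub>F w in nhds (of_real r * z). P w" for P
    using that lim unfolding filterlim_iff by blast
  show ?thesis
    unfolding has_laplacian_def
  proof (intro exI conjI)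
    show "r\<^sup>2 * K = (r * (a * r)) + (r * (b * r))" using f by (simp add: algebra_simps power2_eq_square)
    show "\<forall>\<^sub>F w in nhds z. ((\<lambda>t. f (of_real r * (w + 1 * of_real t))) has_real_derivative
          fx (of_real r * w) * r) (at 0)"
      using ev[OF f(2)] by eventually_elim (rule sc)
    show "\<forall>\<^sub>F w in nhds z. ((\<lambda>t. f (of_real r * (w + \<i> * of_real t))) has_real_derivative
          fy (of_real r * w) * r) (at 0)"
      using ev[OF f(3)] by eventually_elim (rule sc)
    show "((\<lambda>t. fx (of_real r * (z + 1 * of_real t)) * r) has_real_derivative r * (a * r)) (at 0)"
      using DERIV_cmult_right[OF sc[OF f(4)], of r] by (simp add: mult_ac)
    show "((\<lambda>t. fy (of_real r * (z + \<i> * of_real t)) * r) has_real_derivative r * (b * r)) (at 0)"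
      using DERIV_cmult_right[OF sc[OF f(5)], of r] by (simp add: mult_ac)
  qed
qed

text \<open>Were \<open>a\<close> positive, \<open>f'\<close>, which vanishes at the maximum, would
  be positive just to the right of 0, and the mean value theorem would make \<open>f\<close> exceed
  \<open>f 0\<close>.\<close>

lemma local_max_second_derivative_le_0:
  fixes f f' :: "real \<Rightarrow> real"
  assumes d: "\<forall>\<^sub>F t in nhds 0. (f has_real_derivative f' t) (at t)"
    and d2: "(f' has_real_derivative a) (at 0)"
    and mx: "\<forall>\<^sub>F t in nhds 0. f t \<le> f 0"
  shows "a \<le> 0"
proof (rule ccontr)
  assume "\<not> a \<le> 0"
  then have "a > 0" by simp
  from d obtain e1 where e1: "e1 > 0" "\<And>t. \<bar>t\<bar> < e1 \<Longrightarrow> (f has_real_derivative f' t) (at t)"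
    unfolding eventually_nhds_metric by (auto simp: dist_real_def)
  from mx obtain e2 where e2: "e2 > 0" "\<And>t. \<bar>t\<bar> < e2 \<Longrightarrow> f t \<le> f 0"
    unfolding eventually_nhds_metric by (auto simp: dist_real_def)
  have f0: "f' 0 = 0"
    using DERIV_local_max[of f "f' 0" 0 e2] e1 e2 by simp
  from DERIV_pos_inc_right[OF d2 \<open>a > 0\<close>] obtain e3 where
    e3: "e3 > 0" "\<And>h. h > 0 \<Longrightarrow> h < e3 \<Longrightarrow> f' h > 0"
    using f0 by auto
  define s where "s = min e1 (min e2 e3) / 2"
  have s: "0 < s" "s < e1" "s < e2" "s < e3" using e1 e2 e3 by (auto simp: s_def)
  obtain c where c: "0 < c" "c < s" "f s - f 0 = (s - 0) * f' c"
    using MVT2[of 0 s f f'] s e1 by (metis abs_of_nonneg le_less_trans)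
  have "f' c > 0" using e3 c s by auto
  then have "f s > f 0" using c s by (metis diff_gt_0_iff_gt diff_zero mult_pos_pos)
  with e2(2)[of s] s show False by auto
qed

lemma has_laplacian_norm_square: "has_laplacian (\<lambda>w. (cmod w)\<^sup>2) 4 z"
  unfolding has_laplacian_def
  by (rule exI[of _ "\<lambda>w. 2 * Re w"], rule exI[of _ "\<lambda>w. 2 * Im w"], rule exI[of _ 2], rule exI[of _ 2])
     (auto simp: cmod_power2 intro!: derivative_eq_intros always_eventually)

lemma local_max_laplacian_le_0:
  assumes "has_laplacian g L z" "\<forall>\<^sub>F w in nhds z. g w \<le> g z"
  shows "L \<le> 0"
proof -
  from assms(1) obtain gx gy a b where g: "L = a + b"
     "\<forall>\<^sub>F w in nhds z. ((\<lambda>t. g (w + 1 * of_real t)) has_real_derivative gx w) (at 0)"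
     "\<forall>\<^sub>F w in nhds z. ((\<lambda>t. g (w + \<i> * of_real t)) has_real_derivative gy w) (at 0)"
     "((\<lambda>t. gx (z + 1 * of_real t)) has_real_derivative a) (at 0)"
     "((\<lambda>t. gy (z + \<i> * of_real t)) has_real_derivative b) (at 0)"
    unfolding has_laplacian_def by blast
  have main: "c \<le> 0"
    if "\<forall>\<^sub>F w in nhds z. ((\<lambda>t. g (w + u * of_real t)) has_real_derivative gu w) (at 0)"
      "((\<lambda>t. gu (z + u * of_real t)) has_real_derivative c) (at 0)" for u gu c
  proof (rule local_max_second_derivative_le_0[OF _ that(2)])
    show "\<forall>\<^sub>F t in nhds 0. ((\<lambda>t. g (z + u * of_real t)) has_real_derivative gu (z + u * of_real t)) (at t)"
      using eventually_line[OF that(1), of u]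
    proof eventually_elim
      case (elim t)
      have "((\<lambda>s. g (z + u * of_real (s + t))) has_real_derivative gu (z + u * of_real t)) (at 0)"
        using elim by (simp add: algebra_simps)
      then show ?case
        using DERIV_shift[of "\<lambda>s. g (z + u * of_real s)" "gu (z + u * of_real t)" 0 t] by simp
    qed
    show "\<forall>\<^sub>F t in nhds 0. g (z + u * of_real t) \<le> g (z + u * of_real 0)"
      using eventually_line[OF assms(2), of u] by simp
  qed
  from main[OF g(2,4)] main[OF g(3,5)] show ?thesis using g(1) by simp
qed

text \<open>A maximum of \<open>g\<close> itself would only give a Laplacian at most 0, which is no
  contradiction; a small multiple of |z|^2 makes the sign strict. The Laplacian is controlled only
  where \<open>g\<close> is positive, because the nonlinear comparisons below yield its sign only
  there.\<close>

lemma maximum_principle: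
  assumes cont: "continuous_on (ball 0 1) g"
    and lap: "\<And>z. z \<in> ball 0 1 \<Longrightarrow> g z > 0 \<Longrightarrow> \<exists>L\<ge>0. has_laplacian g L z"
    and bdry: "\<And>e. e > 0 \<Longrightarrow> \<exists>r<1. \<forall>z\<in>ball 0 1. cmod z > r \<longrightarrow> g z < e"
    and z1: "z1 \<in> ball 0 1"
  shows "g z1 \<le> 0"
proof (rule ccontr)
  assume "\<not> g z1 \<le> 0"
  define m where "m = g z1"
  have m: "m > 0" using \<open>\<not> g z1 \<le> 0\<close> by (simp add: m_def)
  \<comment> \<open>The added term has Laplacian \<open>m\<close> and is at most \<open>m/4\<close>
    on the disc: too small to move the maximum of \<open>G\<close> to a point where \<open>g\<close>
    is not positive, or into the boundary zone where \<open>g\<close> is below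
    \<open>m/4\<close>.\<close>
  define G where "G = (\<lambda>w. g w + m/4 * (cmod w)\<^sup>2)"
  obtain r where r: "r < 1" "\<And>z. z \<in> ball 0 1 \<Longrightarrow> cmod z > r \<Longrightarrow> g z < m/4"
    using bdry[of "m/4"] m by auto
  define \<rho> where "\<rho> = (1 + max r (cmod z1)) / 2"
  have "max r (cmod z1) \<ge> 0" by (simp add: le_max_iff_disj)
  then have \<rho>: "\<rho> < 1" "r < \<rho>" "cmod z1 < \<rho>" "0 < \<rho>" using r z1 by (auto simp: \<rho>_def)
  have "continuous_on (cball 0 \<rho>) G"
    unfolding G_def using \<rho> by (intro continuous_intros continuous_on_subset[OF cont]) auto
  then obtain z0 where z0: "z0 \<in> cball 0 \<rho>" "\<And>z. z \<in> cball 0 \<rho> \<Longrightarrow> G z \<le> G z0"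
    using continuous_attains_sup[of "cball 0 \<rho>" G] \<rho> by auto
  have Gz0: "G z0 \<ge> m"
    using z0(2)[of z1] \<rho> m by (auto simp: G_def m_def intro: order_trans[rotated])
  have z0b: "z0 \<in> ball 0 1" using z0 \<rho> by auto
  have q: "m/4 * (cmod z0)\<^sup>2 \<le> m/4"
    using m z0b by (auto intro!: mult_left_le simp: abs_square_le_1)
  have "cmod z0 < \<rho>"
  proof (rule ccontr)
    assume "\<not> cmod z0 < \<rho>"
    then have "g z0 < m/4" using r(2)[OF z0b] \<rho> by auto
    then have "G z0 < m/4 + m/4" using q by (simp add: G_def)
    then show False using Gz0 m by auto
  qed
  have "g z0 > 0" using Gz0 q m unfolding G_def by linarith
  then obtain L where L: "L \<ge> 0" "has_laplacian g L z0" using lap z0b by blast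
  have "has_laplacian G (L + m/4 * 4) z0"
    unfolding G_def by (intro has_laplacian_add L has_laplacian_cmult has_laplacian_norm_square)
  moreover have "\<forall>\<^sub>F w in nhds z0. G w \<le> G z0"
    using \<open>cmod z0 < \<rho>\<close> z0(2) eventually_nhds_in_open[of "ball 0 \<rho>" z0]
    by (auto elim!: eventually_mono)
  ultimately have "L + m/4*4 \<le> 0" by (rule local_max_laplacian_le_0)
  then show False using L m by simp
qed

section \<open>Line derivatives and Laplacians of logarithms built from holomorphic
  functions\<close>

lemma line_has_vector_derivative:
  "((\<lambda>t. w + u * of_real t) has_vector_derivative u) (at (0::real))" for u w :: complex
  by (auto intro!: derivative_eq_intros simp: has_vector_derivative_def scaleR_conv_of_real mult.commute)

lemma holomorphic_line_derivative:
  assumes "f holomorphic_on S" "open S" "w \<in> S"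
  shows "((\<lambda>t. f (w + u * of_real t)) has_vector_derivative u * deriv f w) (at (0::real))"
proof -
  have "(f has_field_derivative deriv f w) (at (w + u * of_real 0))"
    using holomorphic_derivI[OF assms] by simp
  from field_vector_diff_chain_at[OF line_has_vector_derivative this] show ?thesis by (simp add: o_def)
qed

text \<open>Polarization of |f|^2: the choice \<open>h = f\<close> differentiates |f|^2, and
  \<open>u * deriv f\<close> in the first place differentiates the result once more.\<close>

lemma Re_product_line_derivative:
  assumes "f holomorphic_on S" "h holomorphic_on S" "open S" "w \<in> S"
  shows "((\<lambda>t. Re (f (w + u * of_real t) * cnj (h (w + u * of_real t)))) has_real_derivative
     Re (u * deriv f w * cnj (h w)) + Re (f w * cnj (u * deriv h w))) (at 0)"
proof -
  note f = holomorphic_line_derivative[OF assms(1,3,4), of u]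
  note h = bounded_linear.has_vector_derivative[OF bounded_linear_cnj
      holomorphic_line_derivative[OF assms(2,3,4), of u]]
  from bounded_linear.has_vector_derivative[OF bounded_linear_Re has_vector_derivative_mult[OF f h]]
  show ?thesis by (simp add: has_real_derivative_iff_has_vector_derivative add.commute)
qed

lemma norm_square_line_derivative:
  assumes "f holomorphic_on S" "open S" "w \<in> S"
  shows "((\<lambda>t. (cmod (f (w + u * of_real t)))\<^sup>2) has_real_derivative
     2 * Re (u * deriv f w * cnj (f w))) (at 0)"
proof -
  have h1: "(\<lambda>t. (cmod (f (w + u * of_real t)))\<^sup>2) = (\<lambda>t. Re (f (w + u * of_real t) * cnj (f (w + u * of_real t))))"
    by (simp add: complex_norm_square[symmetric])
  have h2: "2 * Re (u * deriv f w * cnj (f w)) = Re (u * deriv f w * cnj (f w)) + Re (f w * cnj (u * deriv f w))"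
    by (simp add: algebra_simps)
  show ?thesis unfolding h1 h2 by (rule Re_product_line_derivative[OF assms(1,1,2,3)])
qed

lemma ln_line_derivative:
  assumes "(g has_real_derivative d) (at 0)" "g 0 > (0::real)"
  shows "((\<lambda>t. ln (g t)) has_real_derivative d / g 0) (at 0)"
  using assms by (auto intro!: derivative_eq_intros)

text \<open>The derivative in direction \<open>u\<close> is 2 Re (u f'/f), the second one 2 Re (u^2
  (f'/f)'), and the directions 1 and \<i> have opposite u^2.\<close>

lemma has_laplacian_ln_norm_square:
  assumes f: "f holomorphic_on S" "open S" "z \<in> S" "f z \<noteq> 0"
  shows "has_laplacian (\<lambda>w. ln ((cmod (f w))\<^sup>2)) 0 z"
proof -
  define S' where "S' = {w\<in>S. f w \<noteq> 0}"
  have S': "open S'" "z \<in> S'"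
    using f continuous_open_preimage[OF holomorphic_on_imp_continuous_on[OF f(1)] f(2), of "- {0}"]
    by (auto simp: S'_def vimage_def Int_def)
  have f': "f holomorphic_on S'" using f(1) by (auto simp: S'_def elim: holomorphic_on_subset)
  define q where "q = (\<lambda>w. deriv f w / f w)"
  have q: "q holomorphic_on S'"
    unfolding q_def using f' S' by (intro holomorphic_intros holomorphic_deriv) (auto simp: S'_def)
  have D: "((\<lambda>t. ln ((cmod (f (w + u * of_real t)))\<^sup>2)) has_real_derivative 2 * Re (u * q w)) (at 0)"
    if "w \<in> S'" for w u
  proof -
    have nz: "f w \<noteq> 0" using that by (auto simp: S'_def)
    have "((\<lambda>t. ln ((cmod (f (w + u * of_real t)))\<^sup>2)) has_real_derivative
        2 * Re (u * deriv f w * cnj (f w)) / (cmod (f w))\<^sup>2) (at 0)"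
      using ln_line_derivative[OF norm_square_line_derivative[OF f' S'(1) that, of u]] nz by simp
    moreover have "u * q w = u * deriv f w * cnj (f w) / (cmod (f w))\<^sup>2"
      using nz unfolding complex_norm_square by (simp add: q_def)
    ultimately show ?thesis by (simp add: field_simps)
  qed
  have E: "((\<lambda>t. 2 * Re (u * q (z + u * of_real t))) has_real_derivative 2 * Re (u * (u * deriv q z))) (at 0)" for u
  proof -
    have "((\<lambda>t. u * q (z + u * of_real t)) has_vector_derivative u * (u * deriv q z)) (at 0)"
      by (intro has_vector_derivative_mult_right holomorphic_line_derivative[OF q S'])
    from bounded_linear.has_vector_derivative[OF bounded_linear_Re this]
    have "((\<lambda>t. Re (u * q (z + u * of_real t))) has_real_derivative Re (u * (u * deriv q z))) (at 0)"
      by (simp only: has_real_derivative_iff_has_vector_derivative)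
    then show ?thesis by (rule DERIV_cmult)
  qed
  have ev: "\<forall>\<^sub>F w in nhds z. w \<in> S'" using S' by (rule eventually_nhds_in_open)
  show ?thesis
    unfolding has_laplacian_def
  proof (intro exI conjI)
    show "0 = 2 * Re (1 * (1 * deriv q z)) + 2 * Re (\<i> * (\<i> * deriv q z))" by simp
    show "\<forall>\<^sub>F w in nhds z. ((\<lambda>t. ln ((cmod (f (w + 1 * of_real t)))\<^sup>2)) has_real_derivative 2 * Re (1 * q w)) (at 0)"
      using ev by eventually_elim (rule D)
    show "\<forall>\<^sub>F w in nhds z. ((\<lambda>t. ln ((cmod (f (w + \<i> * of_real t)))\<^sup>2)) has_real_derivative 2 * Re (\<i> * q w)) (at 0)"
      using ev by eventually_elim (rule D)
  qed (rule E)+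
qed

text \<open>Over the directions 1 and \<i> the terms with f'' cancel, and the squares of Re (u f'
  cnj f) add up to |f'|^2 |f|^2. Where f' does not vanish, the formula says that the pulled back
  hyperbolic density |f'| / (1 - |f|^2) has curvature -4.\<close>

lemma has_laplacian_ln_one_minus:
  assumes f: "f holomorphic_on S" "open S" "z \<in> S" "cmod (f z) < 1"
  shows "has_laplacian (\<lambda>w. ln (1 - (cmod (f w))\<^sup>2))
     (- 4 * (cmod (deriv f z))\<^sup>2 / (1 - (cmod (f z))\<^sup>2)\<^sup>2) z"
proof -
  have pos: "1 - (cmod w)\<^sup>2 > 0" if "cmod w < 1" for w
    using that by (simp add: abs_square_less_1)
  define S' where "S' = {w\<in>S. f w \<in> ball 0 1}"
  have S': "open S'" "z \<in> S'"
    using f continuous_open_preimage[OF holomorphic_on_imp_continuous_on[OF f(1)] f(2), of "ball 0 1"]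
    by (auto simp: S'_def vimage_def Int_def)
  have f': "f holomorphic_on S'" using f(1) by (auto simp: S'_def elim: holomorphic_on_subset)
  have df: "deriv f holomorphic_on S'" using f' S' by (intro holomorphic_deriv)
  define N where "N = (\<lambda>w. 1 - (cmod (f w))\<^sup>2)"
  define gu where "gu = (\<lambda>u w. - (2 * Re (u * deriv f w * cnj (f w))) / N w)"
  have N: "((\<lambda>t. N (w + u * of_real t)) has_real_derivative - (2 * Re (u * deriv f w * cnj (f w)))) (at 0)"
    if "w \<in> S'" for w u
    unfolding N_def
    using DERIV_diff[OF DERIV_const[of 1] norm_square_line_derivative[OF f' S'(1) that, of u]] by simp
  have Npos: "N w > 0" if "w \<in> S'" for w using pos[of "f w"] that by (simp add: N_def S'_def)
  have D: "((\<lambda>t. ln (N (w + u * of_real t))) has_real_derivative gu u w) (at 0)"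
    if "w \<in> S'" for w u
    using ln_line_derivative[OF N[OF that, of u]] Npos[OF that] by (simp add: gu_def)
  \<comment> \<open>Second derivative in direction \<open>u\<close>, from the quotient rule for
    \<open>gu\<close>; its values at 1 and \<i> add up to the asserted Laplacian.\<close>
  define c where "c = (\<lambda>u. (- 2 * (Re (u * (u * deriv (deriv f) z) * cnj (f z)) + Re (u * deriv f z * cnj (u * deriv f z))) * N z
     - (2 * Re (u * deriv f z * cnj (f z)))\<^sup>2) / (N z * N z))"
  have E: "((\<lambda>t. gu u (z + u * of_real t)) has_real_derivative c u) (at 0)" for u
  proof -
    have h: "(\<lambda>w. u * deriv f w) holomorphic_on S'" by (intro holomorphic_intros df)
    have du: "deriv (\<lambda>w. u * deriv f w) z = u * deriv (deriv f) z"
      using df S' by (intro deriv_cmult) (auto simp: holomorphic_on_open field_differentiable_def)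
    note A = Re_product_line_derivative[OF h f' S', of u, unfolded du]
    have "((\<lambda>t. gu u (z + u * of_real t)) has_real_derivative
       (- (2 * (Re (u * (u * deriv (deriv f) z) * cnj (f z)) + Re (u * deriv f z * cnj (u * deriv f z)))) * N (z + u * of_real 0)
       - - (2 * Re (u * deriv f (z + u * of_real 0) * cnj (f (z + u * of_real 0)))) * - (2 * Re (u * deriv f z * cnj (f z))))
       / (N (z + u * of_real 0) * N (z + u * of_real 0))) (at 0)"
      unfolding gu_def
      by (rule DERIV_divide[OF DERIV_minus[OF DERIV_cmult[OF A]] N[OF S'(2)]]) (use Npos[OF S'(2)] in simp)
    then show ?thesis
      by (simp only: c_def power2_eq_square of_real_0 mult_zero_right add_0_right minus_mult_minus mult_minus_left mult_minus_right minus_minus)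
  qed
  have ev: "\<forall>\<^sub>F w in nhds z. w \<in> S'" using S' by (rule eventually_nhds_in_open)
  have nz: "N z \<noteq> 0" using Npos[OF S'(2)] by simp
  have ReIm: "(Re w)\<^sup>2 + (Re (\<i> * w))\<^sup>2 = (cmod w)\<^sup>2" for w by (simp add: cmod_power2)
  have sq: "Re (w * cnj w) = (cmod w)\<^sup>2" for w by (simp add: complex_norm_square[symmetric])
  define A where "A = Re (deriv (deriv f) z * cnj (f z))"
  have c1: "c 1 = (- 2 * (A + (cmod (deriv f z))\<^sup>2) * N z - 4 * (Re (deriv f z * cnj (f z)))\<^sup>2) / (N z * N z)"
    unfolding c_def A_def sq mult_1 power_mult_distrib by simp
  have c2: "c \<i> = (- 2 * (- A + (cmod (deriv f z))\<^sup>2) * N z - 4 * (Re (\<i> * (deriv f z * cnj (f z))))\<^sup>2) / (N z * N z)"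
    unfolding c_def A_def sq by (simp add: power2_eq_square norm_mult algebra_simps)
  have "c 1 + c \<i> = (- 4 * (cmod (deriv f z))\<^sup>2 * N z
     - 4 * ((Re (deriv f z * cnj (f z)))\<^sup>2 + (Re (\<i> * (deriv f z * cnj (f z))))\<^sup>2)) / (N z * N z)"
    unfolding c1 c2 by (simp add: add_divide_distrib[symmetric] algebra_simps)
  also have "\<dots> = (- 4 * (cmod (deriv f z))\<^sup>2 * N z - 4 * (cmod (deriv f z))\<^sup>2 * (1 - N z)) / (N z * N z)"
    unfolding ReIm by (simp add: norm_mult power_mult_distrib N_def)
  also have "\<dots> = - 4 * (cmod (deriv f z))\<^sup>2 / (N z)\<^sup>2" by (simp add: algebra_simps power2_eq_square)
  finally have sum: "- 4 * (cmod (deriv f z))\<^sup>2 / (1 - (cmod (f z))\<^sup>2)\<^sup>2 = c 1 + c \<i>" by (simp add: N_def)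
  show ?thesis
    unfolding has_laplacian_def
  proof (intro exI conjI)
    show "\<forall>\<^sub>F w in nhds z. ((\<lambda>t. ln (1 - (cmod (f (w + 1 * of_real t)))\<^sup>2)) has_real_derivative gu 1 w) (at 0)"
      using ev by eventually_elim (rule D[unfolded N_def])
    show "\<forall>\<^sub>F w in nhds z. ((\<lambda>t. ln (1 - (cmod (f (w + \<i> * of_real t)))\<^sup>2)) has_real_derivative gu \<i> w) (at 0)"
      using ev by eventually_elim (rule D[unfolded N_def])
  qed (rule sum E)+
qed

section \<open>Finite Blaschke products\<close>

text \<open>Different polynomials agree at finitely many points only, while the circle contains all
  roots of unity of every order.\<close>

lemma poly_eq_on_circle:
  fixes p q :: "complex poly"
  assumes "\<And>z. cmod z = 1 \<Longrightarrow> poly p z = poly q z"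
  shows "p = q"
proof (rule ccontr)
  assume "p \<noteq> q"
  then have "finite {z. poly (p - q) z = 0}" by (intro poly_roots_finite) simp
  moreover have "sphere 0 1 \<subseteq> {z. poly (p - q) z = 0}" using assms by auto
  ultimately have "finite (sphere (0::complex) 1)" by (rule rev_finite_subset)
  moreover define n where "n = Suc (card (sphere (0::complex) 1))"
  have "{z::complex. z ^ n = 1} \<subseteq> sphere 0 1"
    using power_eq_1_iff[where n = n] by (auto simp: n_def)
  ultimately have "card {z::complex. z ^ n = 1} \<le> card (sphere (0::complex) 1)" by (intro card_mono)
  then show False using card_roots_unity_eq[of n] by (simp add: n_def)
qed

definition roots_poly :: "complex list \<Rightarrow> complex poly" where
  "roots_poly as = (\<Prod>a\<leftarrow>as. [:-a, 1:])"

text \<open>The polynomial P^* = z^n cnj (P (1 / cnj z)) for P with roots \<open>as\<close>, in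
  product form, so that the constant term 1 and estimates in the disc can be read off factor by
  factor.\<close>

definition reflected_roots_poly :: "complex list \<Rightarrow> complex poly" where
  "reflected_roots_poly as = (\<Prod>a\<leftarrow>as. [:1, -cnj a:])"

text \<open>
  The Blaschke product with zeros \<open>0, a\<^sub>1, \<dots>, a\<^sub>n\<close> is \<open>z P / P\<^sup>*\<close>, and the numerator of its
  derivative is the Wronskian of \<open>z P\<close> and \<open>P\<^sup>*\<close>.
\<close>

definition wronskian :: "complex poly \<Rightarrow> complex poly \<Rightarrow> complex poly" where
  "wronskian p q = pderiv p * q - p * pderiv q"

abbreviation blaschke_wronskian :: "complex list \<Rightarrow> complex poly" where
  "blaschke_wronskian as \<equiv> wronskian (pCons 0 (roots_poly as)) (reflected_roots_poly as)"

lemma roots_poly_simps [simp]: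
  "roots_poly [] = 1" "roots_poly (a # as) = [:-a, 1:] * roots_poly as"
  "reflected_roots_poly [] = 1" "reflected_roots_poly (a # as) = [:1, -cnj a:] * reflected_roots_poly as"
  by (simp_all add: roots_poly_def reflected_roots_poly_def)

lemma one_minus_cnj_mult_eq:
  assumes "cmod z = 1"
  shows "1 - cnj a * z = z * cnj (z - a)"
proof -
  have "z * cnj z = 1" using assms complex_norm_square[of z] by simp
  then show ?thesis by (simp add: algebra_simps)
qed

lemma reflected_roots_poly_on_circle:
  assumes "cmod z = 1"
  shows "poly (reflected_roots_poly as) z = z ^ length as * cnj (poly (roots_poly as) z)"
proof (induction as)
  case (Cons a as)
  have "poly (reflected_roots_poly (a # as)) z = (1 - cnj a * z) * poly (reflected_roots_poly as) z"
    by (simp add: algebra_simps)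
  then show ?case
    unfolding one_minus_cnj_mult_eq[OF assms] Cons by (simp add: algebra_simps)
qed simp

lemma reflected_roots_poly_nonzero:
  assumes "\<And>a. a \<in> set as \<Longrightarrow> cmod a < 1" "cmod z \<le> 1"
  shows "poly (reflected_roots_poly as) z \<noteq> 0"
  using assms(1)
proof (induction as)
  case (Cons a as)
  have "1 - z * cnj a \<noteq> 0"
  proof
    assume "1 - z * cnj a = 0"
    then have "cmod (z * cnj a) = 1" by simp
    moreover have "cmod (z * cnj a) \<le> cmod a" using assms(2) by (auto simp: norm_mult intro: mult_left_le_one_le)
    ultimately show False using Cons.prems[of a] by simp
  qed
  then show ?case using Cons by simp
qed simp

lemma poly_roots_poly_eq_0_iff: "poly (roots_poly as) z = 0 \<longleftrightarrow> z \<in> set as"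
  by (induction as) auto

text \<open>The defect of a single Blaschke factor contains 1 - |z|^2 as a factor; by induction so
  does the defect of a product, and the quotient extends to the circle.\<close>

lemma norm_blaschke_factor:
  "(cmod (1 - cnj a * z))\<^sup>2 - (cmod (z - a))\<^sup>2 = (1 - (cmod z)\<^sup>2) * (1 - (cmod a)\<^sup>2)"
  unfolding cmod_power2 by (simp add: algebra_simps power2_eq_square)

lemma wronskian_mult:
  "wronskian (L * p) (M * q) = L * M * wronskian p q + wronskian L M * (p * q)"
  by (simp add: wronskian_def pderiv_mult algebra_simps)

text \<open>The Wronskian of the two linear factors is the constant 1 - |a|^2. On the circle the
  resulting recursion is that of the factor \<open>S\<close> below, up to a power of z.\<close>

lemma wronskian_cons:
  "wronskian (pCons 0 ([:-a,1:] * p)) ([:1,-cnj a:] * q) =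
     [:-a,1:] * [:1,-cnj a:] * wronskian (pCons 0 p) q + [:of_real (1 - (cmod a)\<^sup>2):] * (pCons 0 p * q)"
proof -
  have a: "of_real ((cmod a)\<^sup>2) = a * cnj a" by (rule complex_norm_square)
  have "pCons 0 ([:-a,1:] * p) = [:-a,1:] * pCons 0 p" by (simp only: mult_pCons_right[of _ 0]) simp
  moreover have "wronskian [:-a,1:] [:1,-cnj a:] = [:of_real (1 - (cmod a)\<^sup>2):]"
    unfolding wronskian_def of_real_diff a by (simp add: pderiv_pCons)
  ultimately show ?thesis by (simp only: wronskian_mult)
qed

text \<open>
  The factor \<open>S\<close> extends the quotient \<open>(|P\<^sup>*|\<^sup>2 - |z P|\<^sup>2) / (1 - |z|\<^sup>2)\<close> to the closed disc, where its
  boundary values are those of the Wronskian up to \<open>z\<^sup>n\<close>. Hence the hyperbolic densities of two Blaschke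
  products with proportional Wronskians agree at the boundary.
\<close>

lemma blaschke_defect:
  assumes "\<And>a. a \<in> set as \<Longrightarrow> cmod a < 1"
  obtains S :: "complex \<Rightarrow> real" where
    "continuous_on UNIV S"
    "\<And>z. (cmod (poly (reflected_roots_poly as) z))\<^sup>2 - (cmod (z * poly (roots_poly as) z))\<^sup>2 = (1 - (cmod z)\<^sup>2) * S z"
    "\<And>z. cmod z = 1 \<Longrightarrow> poly (blaschke_wronskian as) z = z ^ length as * of_real (S z)"
    "\<And>z. cmod z = 1 \<Longrightarrow> S z \<ge> (cmod (poly (roots_poly as) z))\<^sup>2"
    "\<And>z. cmod z \<le> 1 \<Longrightarrow> S z > 0"
  using assms
proof (induction as arbitrary: thesis)
  case Nil
  show ?case
    by (rule Nil(1)[of "\<lambda>_. 1"]) (simp_all add: wronskian_def norm_mult pderiv_pCons)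
next
  case (Cons a as)
  obtain S0 :: "complex \<Rightarrow> real" where S0: "continuous_on UNIV S0"
    "\<And>z. (cmod (poly (reflected_roots_poly as) z))\<^sup>2 - (cmod (z * poly (roots_poly as) z))\<^sup>2 = (1 - (cmod z)\<^sup>2) * S0 z"
    "\<And>z. cmod z = 1 \<Longrightarrow> poly (blaschke_wronskian as) z = z ^ length as * of_real (S0 z)"
    "\<And>z. cmod z = 1 \<Longrightarrow> S0 z \<ge> (cmod (poly (roots_poly as) z))\<^sup>2"
    "\<And>z. cmod z \<le> 1 \<Longrightarrow> S0 z > 0"
    using Cons by auto
  have a: "cmod a < 1" using Cons by auto
  then have a2: "1 - (cmod a)\<^sup>2 > 0" by (simp add: abs_square_less_1)
  \<comment> \<open>A further zero \<open>a\<close> multiplies |P^*|^2 by |1 - cnj a z|^2 and |z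
    P|^2 by |z - a|^2. These multipliers differ by (1 - |z|^2) (1 - |a|^2), which accounts for the
    second summand.\<close>
  define S where "S = (\<lambda>z. (cmod (1 - cnj a * z))\<^sup>2 * S0 z + (1 - (cmod a)\<^sup>2) * (cmod (z * poly (roots_poly as) z))\<^sup>2)"
  show ?case
  proof (rule Cons.prems(1)[of S])
    show "continuous_on UNIV S"
      unfolding S_def by (intro continuous_intros S0)
  next
    fix z
    have "(cmod (poly (reflected_roots_poly (a#as)) z))\<^sup>2 - (cmod (z * poly (roots_poly (a#as)) z))\<^sup>2
      = (cmod (1 - cnj a * z))\<^sup>2 * (cmod (poly (reflected_roots_poly as) z))\<^sup>2 - (cmod (z - a))\<^sup>2 * (cmod (z * poly (roots_poly as) z))\<^sup>2"
    proof -
      have e: "poly (reflected_roots_poly (a#as)) z = (1 - cnj a * z) * poly (reflected_roots_poly as) z"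
        "z * poly (roots_poly (a#as)) z = (z - a) * (z * poly (roots_poly as) z)"
        by (simp_all add: algebra_simps)
      show ?thesis unfolding e norm_mult[of "_ - _"] power_mult_distrib ..
    qed
    also have "\<dots> = (cmod (1 - cnj a * z))\<^sup>2 * ((cmod (poly (reflected_roots_poly as) z))\<^sup>2 - (cmod (z * poly (roots_poly as) z))\<^sup>2)
       + ((cmod (1 - cnj a * z))\<^sup>2 - (cmod (z - a))\<^sup>2) * (cmod (z * poly (roots_poly as) z))\<^sup>2"
      by (simp add: algebra_simps)
    also have "\<dots> = (1 - (cmod z)\<^sup>2) * S z"
      unfolding S0 norm_blaschke_factor S_def by (simp add: algebra_simps)
    finally show "(cmod (poly (reflected_roots_poly (a#as)) z))\<^sup>2 - (cmod (z * poly (roots_poly (a#as)) z))\<^sup>2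
      = (1 - (cmod z)\<^sup>2) * S z" .
  next
    fix z :: complex assume z: "cmod z = 1"
    note e = one_minus_cnj_mult_eq[OF z, of a]
    have m: "(z - a) * (1 - cnj a * z) = z * of_real ((cmod (1 - cnj a * z))\<^sup>2)"
    proof -
      have "cmod (1 - cnj a * z) = cmod (z - a)" unfolding e by (simp only: norm_mult z complex_mod_cnj mult_1)
      moreover have "(z - a) * (1 - cnj a * z) = z * ((z - a) * cnj (z - a))" unfolding e by (simp only: mult_ac)
      ultimately show ?thesis by (simp only: complex_norm_square)
    qed
    have zp: "poly (pCons 0 (roots_poly as) * reflected_roots_poly as) z =
        z ^ Suc (length as) * of_real ((cmod (z * poly (roots_poly as) z))\<^sup>2)"
      unfolding poly_mult reflected_roots_poly_on_circle[OF z] norm_mult z mult_1 complex_norm_square by simp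
    have "poly (blaschke_wronskian (a # as)) z = (z - a) * (1 - cnj a * z) * poly (blaschke_wronskian as) z
        + of_real (1 - (cmod a)\<^sup>2) * poly (pCons 0 (roots_poly as) * reflected_roots_poly as) z"
      unfolding roots_poly_simps wronskian_cons poly_add poly_mult by (simp add: algebra_simps)
    also have "\<dots> = z ^ length (a#as) * of_real (S z)"
      unfolding m zp S0(3)[OF z] S_def by (simp add: algebra_simps)
    finally show "poly (blaschke_wronskian (a # as)) z = z ^ length (a#as) * of_real (S z)" .
    have "(cmod (poly (roots_poly (a#as)) z))\<^sup>2 = (cmod (1 - cnj a * z))\<^sup>2 * (cmod (poly (roots_poly as) z))\<^sup>2"
    proof -
      have "cmod (1 - cnj a * z) = cmod (z - a)" unfolding e by (simp only: norm_mult z complex_mod_cnj mult_1)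
      moreover have "poly (roots_poly (a#as)) z = (z - a) * poly (roots_poly as) z"
        by (simp add: algebra_simps)
      ultimately show ?thesis by (simp only: norm_mult power_mult_distrib)
    qed
    also have "\<dots> \<le> (cmod (1 - cnj a * z))\<^sup>2 * S0 z" by (intro mult_left_mono S0 z) simp
    also have "\<dots> \<le> S z" using a2 by (simp add: S_def)
    finally show "S z \<ge> (cmod (poly (roots_poly (a#as)) z))\<^sup>2" .
  next
    fix z :: complex assume z: "cmod z \<le> 1"
    have "1 - cnj a * z \<noteq> 0" using reflected_roots_poly_nonzero[of "[a]" z] a z by (simp add: mult.commute)
    then have "(cmod (1 - cnj a * z))\<^sup>2 * S0 z > 0" using S0(5)[OF z] by simp
    then show "S z > 0" unfolding S_def using a2 by (simp add: add_pos_nonneg)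
  qed
qed

lemma degree_roots_poly: "degree (roots_poly as) = length as" "lead_coeff (roots_poly as) = 1"
proof -
  have "degree (roots_poly as) = length as \<and> lead_coeff (roots_poly as) = 1"
  proof (induction as)
    case (Cons a as)
    then have "roots_poly as \<noteq> 0" by auto
    with Cons have "degree (roots_poly (a # as)) = Suc (length as)"
      by (simp add: degree_mult_eq del: mult_pCons_left)
    moreover have "lead_coeff (roots_poly (a # as)) = 1"
      unfolding roots_poly_simps lead_coeff_mult conjunct2[OF Cons] by simp
    ultimately show ?case by simp
  qed simp
  then show "degree (roots_poly as) = length as" "lead_coeff (roots_poly as) = 1" by auto
qed

lemma degree_reflected_roots_poly: "degree (reflected_roots_poly as) \<le> length as"
proof (induction as)
  case (Cons a as)
  have "degree ([:1, -cnj a:] * reflected_roots_poly as) \<le> degree [:1, -cnj a:] + degree (reflected_roots_poly as)"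
    by (rule degree_mult_le)
  also have "\<dots> \<le> Suc (length as)" using Cons by simp
  finally show ?case by (simp del: mult_pCons_left)
qed simp

lemma ex_roots_poly:
  assumes "lead_coeff p = 1"
  obtains as where "p = roots_poly as" "length as = degree p" "\<And>z. poly p z = 0 \<longleftrightarrow> z \<in> set as"
proof -
  have "p \<noteq> 0" using assms by auto
  from alg_closed_imp_factorization[OF this] obtain A where
    A: "size A = degree p" "p = Polynomial.smult (lead_coeff p) (\<Prod>x\<in>#A. [:-x, 1:])" by blast
  obtain as where as: "mset as = A" using ex_mset by blast
  have p: "p = roots_poly as"
    using A assms by (simp add: roots_poly_def as[symmetric] prod_mset_prod_list flip: mset_map)
  then show ?thesis
    using A as that[of as] poly_roots_poly_eq_0_iff[of as] by auto
qed

text \<open>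
  Both sides are polynomials in \<open>x = Re z\<close> and \<open>y = Im z\<close>, so they agree for complex \<open>x\<close> and \<open>y\<close>;
  then \<open>x + \<i> y\<close> and \<open>x - \<i> y\<close> are independent, and the second one is set to \<open>0\<close>.
\<close>

lemma polarized_norm_identity:
  fixes A B P Q :: "complex poly"
  assumes eq: "\<And>z. cmod z < 1 \<Longrightarrow>
      (cmod (poly A z))\<^sup>2 - (cmod (z * poly P z))\<^sup>2 = (cmod (poly B z))\<^sup>2 - (cmod (z * poly Q z))\<^sup>2"
    and 1: "poly A 0 = 1" "poly B 0 = 1"
  shows "A = B"
proof -
  define H where "H = (\<lambda>x y. poly A (x + \<i> * y) * poly (map_poly cnj A) (x - \<i> * y)
    - (x + \<i> * y) * poly P (x + \<i> * y) * ((x - \<i> * y) * poly (map_poly cnj P) (x - \<i> * y))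
    - (poly B (x + \<i> * y) * poly (map_poly cnj B) (x - \<i> * y)
    - (x + \<i> * y) * poly Q (x + \<i> * y) * ((x - \<i> * y) * poly (map_poly cnj Q) (x - \<i> * y))))"
  \<comment> \<open>For real x and y between 0 and 1/2 the point x + \<i> y lies in the unit disc,
    where the hypothesis applies. Infinitely many values suffice to extend a polynomial identity,
    one variable at a time.\<close>
  define I :: "complex set" where "I = of_real ` {0<..<1/2}"
  have "infinite I" unfolding I_def by (subst finite_image_iff) (auto simp: inj_on_def)
  have zero: "poly p x = 0" if "\<And>x. x \<in> I \<Longrightarrow> poly p x = 0" for p x
  proof (rule ccontr)
    assume "poly p x \<noteq> 0"
    then have "finite {x. poly p x = 0}" by (intro poly_roots_finite) auto
    moreover have "I \<subseteq> {x. poly p x = 0}" using that by auto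
    ultimately show False using \<open>infinite I\<close> finite_subset by blast
  qed
  have H0: "H x y = 0" if xy: "x \<in> I" "y \<in> I" for x y
  proof -
    obtain a where a: "x = of_real a" "a \<in> {0<..<1/2}" using xy(1) unfolding I_def by blast
    obtain b where b: "y = of_real b" "b \<in> {0<..<1/2}" using xy(2) unfolding I_def by blast
    note ab = a b
    define z where "z = x + \<i> * y"
    have "cmod z \<le> cmod x + cmod (\<i> * y)" unfolding z_def by (rule norm_triangle_ineq)
    also have "\<dots> < 1" using ab by (simp add: norm_mult)
    finally have z: "cmod z < 1" .
    have cz: "x - \<i> * y = cnj z" by (simp add: z_def ab)
    have n: "poly p z * poly (map_poly cnj p) (cnj z) = of_real ((cmod (poly p z))\<^sup>2)"
      "z * poly p z * (cnj z * poly (map_poly cnj p) (cnj z)) = of_real ((cmod (z * poly p z))\<^sup>2)" for p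
      unfolding complex_norm_square by simp_all
    have "H x y = of_real ((cmod (poly A z))\<^sup>2 - (cmod (z * poly P z))\<^sup>2
        - ((cmod (poly B z))\<^sup>2 - (cmod (z * poly Q z))\<^sup>2))"
      unfolding H_def z_def[symmetric] cz n by simp
    then show ?thesis using eq[OF z] by simp
  qed
  have H1: "H x y = 0" if "y \<in> I" for x y
  proof -
    define p where "p = pcompose A [:\<i> * y, 1:] * pcompose (map_poly cnj A) [:- \<i> * y, 1:]
    - [:\<i> * y, 1:] * pcompose P [:\<i> * y, 1:] * ([:- \<i> * y, 1:] * pcompose (map_poly cnj P) [:- \<i> * y, 1:])
    - (pcompose B [:\<i> * y, 1:] * pcompose (map_poly cnj B) [:- \<i> * y, 1:]
    - [:\<i> * y, 1:] * pcompose Q [:\<i> * y, 1:] * ([:- \<i> * y, 1:] * pcompose (map_poly cnj Q) [:- \<i> * y, 1:]))"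
    have p: "poly p x = H x y" for x
      unfolding p_def H_def by (simp only: poly_diff poly_mult poly_pcompose poly_pCons poly_0) (simp add: add.commute)
    have "poly p x = 0" by (rule zero) (use H0 that in \<open>simp add: p\<close>)
    then show ?thesis by (simp add: p)
  qed
  have H2: "H x y = 0" for x y
  proof -
    define p where "p = pcompose A [:x, \<i>:] * pcompose (map_poly cnj A) [:x, - \<i>:]
    - [:x, \<i>:] * pcompose P [:x, \<i>:] * ([:x, - \<i>:] * pcompose (map_poly cnj P) [:x, - \<i>:])
    - (pcompose B [:x, \<i>:] * pcompose (map_poly cnj B) [:x, - \<i>:]
    - [:x, \<i>:] * pcompose Q [:x, \<i>:] * ([:x, - \<i>:] * pcompose (map_poly cnj Q) [:x, - \<i>:]))"
    have p: "poly p y = H x y" for y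
      unfolding p_def H_def by (simp only: poly_diff poly_mult poly_pcompose poly_pCons poly_0) (simp add: mult.commute)
    have "poly p y = 0" by (rule zero) (use H1 in \<open>simp add: p\<close>)
    then show ?thesis by (simp add: p)
  qed
  show ?thesis
  proof (rule poly_ext)
    fix z
    \<comment> \<open>Here x + \<i> y = z and x - \<i> y = 0: the terms with \<open>P\<close> and
      \<open>Q\<close> vanish, and the conjugated factors reduce to the constant terms 1.\<close>
    have "H (z/2) (- \<i> * z / 2) = 0" by (rule H2)
    then show "poly A z = poly B z" unfolding H_def using 1 by simp
  qed
qed

section \<open>Uniqueness of a Blaschke product with given Wronskian\<close>

lemma boundary_condition_from_continuity:
  fixes g :: "complex \<Rightarrow> real"
  assumes "continuous_on (cball 0 1) g" "\<And>z. cmod z = 1 \<Longrightarrow> g z \<le> 0" "e > 0"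
  shows "\<exists>r<1. \<forall>z\<in>ball 0 1. cmod z > r \<longrightarrow> g z < e"
proof -
  have "uniformly_continuous_on (cball 0 1) g"
    using assms(1) by (intro compact_uniformly_continuous) auto
  then obtain d where d: "d > 0"
    "\<And>z w. z \<in> cball 0 1 \<Longrightarrow> w \<in> cball 0 1 \<Longrightarrow> dist w z < d \<Longrightarrow> dist (g w) (g z) < e"
    using assms(3) unfolding uniformly_continuous_on_def by meson
  show ?thesis
  proof (intro exI conjI ballI impI)
    show "max (1 - d) 0 < 1" using d by simp
    fix z :: complex assume z: "z \<in> ball 0 1" "max (1 - d) 0 < cmod z"
    \<comment> \<open>\<open>sgn z\<close> is the radial projection of \<open>z\<close> to the
      circle, where \<open>g\<close> is at most 0.\<close>
    have "dist z (sgn z) = 1 - cmod z"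
    proof -
      have "z - sgn z = sgn z * of_real (cmod z - 1)"
        using z by (auto simp: complex_sgn_def scaleR_conv_of_real algebra_simps)
      then have "cmod (z - sgn z) = cmod (sgn z) * \<bar>cmod z - 1\<bar>" by (simp only: norm_mult norm_of_real)
      then show ?thesis using z by (auto simp: dist_norm norm_sgn)
    qed
    then have "dist z (sgn z) < d" using z by simp
    then have "dist (g z) (g (sgn z)) < e" using d(2)[of "sgn z" z] z by (auto simp: norm_sgn)
    moreover have "g (sgn z) \<le> 0" using assms(2)[of "sgn z"] z by (auto simp: norm_sgn)
    ultimately show "g z < e" by (simp add: dist_real_def)
  qed
qed

lemma deriv_blaschke:
  assumes "poly q z \<noteq> 0"
  shows "((\<lambda>w. w * poly p w / poly q w) has_field_derivative poly (wronskian (pCons 0 p) q) z / (poly q z)\<^sup>2) (at z)"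
proof -
  have "((\<lambda>w. poly (pCons 0 p) w / poly q w) has_field_derivative
     (poly (pderiv (pCons 0 p)) z * poly q z - poly (pCons 0 p) z * poly (pderiv q) z) / (poly q z * poly q z)) (at z)"
    by (intro DERIV_divide poly_DERIV assms)
  then show ?thesis by (simp add: wronskian_def power2_eq_square mult.assoc)
qed

lemma blaschke_defect_pos:
  assumes "\<And>a. a \<in> set as \<Longrightarrow> cmod a < 1" "cmod z < 1"
  shows "(cmod (poly (reflected_roots_poly as) z))\<^sup>2 - (cmod (z * poly (roots_poly as) z))\<^sup>2 > 0"
proof -
  obtain S :: "complex \<Rightarrow> real" where S:
    "\<And>z. (cmod (poly (reflected_roots_poly as) z))\<^sup>2 - (cmod (z * poly (roots_poly as) z))\<^sup>2 = (1 - (cmod z)\<^sup>2) * S z"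
    "\<And>z. cmod z \<le> 1 \<Longrightarrow> S z > 0"
    using blaschke_defect[OF assms(1)] by metis
  have "1 - (cmod z)\<^sup>2 > 0" using assms(2) by (simp add: abs_square_less_1)
  then show ?thesis unfolding S(1) using S(2)[of z] assms(2) by simp
qed

lemma norm_blaschke_less_1:
  assumes "\<And>a. a \<in> set as \<Longrightarrow> cmod a < 1" "cmod z < 1"
  shows "cmod (z * poly (roots_poly as) z / poly (reflected_roots_poly as) z) < 1"
proof -
  have nz: "poly (reflected_roots_poly as) z \<noteq> 0" using reflected_roots_poly_nonzero[of as z] assms by simp
  have "(cmod (z * poly (roots_poly as) z))\<^sup>2 < (cmod (poly (reflected_roots_poly as) z))\<^sup>2"
    using blaschke_defect_pos[OF assms] by simp
  then have "cmod (z * poly (roots_poly as) z) < cmod (poly (reflected_roots_poly as) z)"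
    by (rule power2_less_imp_less) simp
  then show ?thesis using nz by (simp add: norm_divide)
qed

text \<open>With F = z P / P^* the defect is (1 - |F|^2) |P^*|^2, and ln |P^*|^2 is harmonic because
  P^* has no zeros in the disc. In this form the Liouville equation has no singularity at the
  critical points of F.\<close>

lemma has_laplacian_ln_blaschke_defect:
  assumes as: "\<And>a. a \<in> set as \<Longrightarrow> cmod a < 1" and z: "cmod z < 1"
  shows "has_laplacian (\<lambda>w. ln ((cmod (poly (reflected_roots_poly as) w))\<^sup>2 - (cmod (w * poly (roots_poly as) w))\<^sup>2))
     (- 4 * (cmod (poly (blaschke_wronskian as) z))\<^sup>2 /
      ((cmod (poly (reflected_roots_poly as) z))\<^sup>2 - (cmod (z * poly (roots_poly as) z))\<^sup>2)\<^sup>2) z"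
proof -
  define R where "R = poly (reflected_roots_poly as)"
  define F where "F = (\<lambda>w. w * poly (roots_poly as) w / R w)"
  define Y where "Y = (\<lambda>w. (cmod (R w))\<^sup>2 - (cmod (w * poly (roots_poly as) w))\<^sup>2)"
  have Rnz: "R w \<noteq> 0" if "w \<in> ball 0 1" for w
    using reflected_roots_poly_nonzero[of as w] as that by (simp add: R_def)
  have R: "R holomorphic_on ball 0 1" unfolding R_def by (intro holomorphic_intros)
  have F: "F holomorphic_on ball 0 1" unfolding F_def
    by (intro holomorphic_intros R) (use Rnz in auto)
  have F1: "cmod (F w) < 1" if "w \<in> ball 0 1" for w
    unfolding F_def R_def using norm_blaschke_less_1[OF as] that by simp
  have zb: "z \<in> ball 0 1" using z by simp
  have dF: "deriv F z = poly (blaschke_wronskian as) z / (R z)\<^sup>2"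
    unfolding F_def R_def by (intro DERIV_imp_deriv deriv_blaschke) (use Rnz[OF zb] in \<open>simp add: R_def\<close>)
  have Y: "1 - (cmod (F w))\<^sup>2 = Y w / (cmod (R w))\<^sup>2" if "w \<in> ball 0 1" for w
    using Rnz[OF that] by (simp add: F_def Y_def norm_divide power_divide diff_divide_distrib)
  have Ypos: "Y w > 0" if "w \<in> ball 0 1" for w
    unfolding Y_def R_def using blaschke_defect_pos[OF as] that by simp
  have lap: "has_laplacian (\<lambda>w. ln (1 - (cmod (F w))\<^sup>2) + ln ((cmod (R w))\<^sup>2))
      (- 4 * (cmod (deriv F z))\<^sup>2 / (1 - (cmod (F z))\<^sup>2)\<^sup>2 + 0) z"
    by (intro has_laplacian_add has_laplacian_ln_one_minus[OF F] has_laplacian_ln_norm_square[OF R]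
      open_ball zb F1 Rnz)
  have "- 4 * (cmod (deriv F z))\<^sup>2 / (1 - (cmod (F z))\<^sup>2)\<^sup>2 + 0 = - 4 * (cmod (poly (blaschke_wronskian as) z))\<^sup>2 / (Y z)\<^sup>2"
    unfolding dF Y[OF zb] using Rnz[OF zb] by (simp add: norm_divide norm_power power_divide)
  moreover have "\<forall>\<^sub>F w in nhds z. ln (1 - (cmod (F w))\<^sup>2) + ln ((cmod (R w))\<^sup>2) = ln (Y w)"
    using eventually_nhds_in_open[OF open_ball zb]
  proof eventually_elim
    case (elim w)
    then show ?case unfolding Y[OF elim] using Rnz[OF elim] Ypos[OF elim] by (simp add: ln_div)
  qed
  ultimately show ?thesis
    using has_laplacian_cong[OF _ lap] by (simp add: Y_def R_def)
qed

text \<open>Let Y be the defect and W the Wronskian of a list. Then v = - ln (c Y) has Laplacian 4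
  |c W|^2 e^(2 v). The hypothesis makes this the same equation for both lists, and the logarithms
  differ by a function with boundary value 0, to which the maximum principle applies.\<close>

lemma blaschke_defect_le:
  assumes as: "\<And>a. a \<in> set as \<Longrightarrow> cmod a < 1" and bs: "\<And>a. a \<in> set bs \<Longrightarrow> cmod a < 1"
    and len: "length as = length bs" and cd: "c > 0" "d > 0"
    and W: "\<And>z. of_real c * poly (blaschke_wronskian as) z = of_real d * poly (blaschke_wronskian bs) z"
    and z: "cmod z < 1"
  shows "c * ((cmod (poly (reflected_roots_poly as) z))\<^sup>2 - (cmod (z * poly (roots_poly as) z))\<^sup>2)
       \<le> d * ((cmod (poly (reflected_roots_poly bs) z))\<^sup>2 - (cmod (z * poly (roots_poly bs) z))\<^sup>2)"
proof -
  define Y where "Y = (\<lambda>as z. (cmod (poly (reflected_roots_poly as) z))\<^sup>2 - (cmod (z * poly (roots_poly as) z))\<^sup>2)"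
  obtain S where S: "continuous_on UNIV S" "\<And>z. Y as z = (1 - (cmod z)\<^sup>2) * S z"
    "\<And>z. cmod z = 1 \<Longrightarrow> poly (blaschke_wronskian as) z = z ^ length as * of_real (S z)"
    "\<And>z. cmod z \<le> 1 \<Longrightarrow> S z > 0"
    using blaschke_defect[OF as] unfolding Y_def by metis
  obtain T where T: "continuous_on UNIV T" "\<And>z. Y bs z = (1 - (cmod z)\<^sup>2) * T z"
    "\<And>z. cmod z = 1 \<Longrightarrow> poly (blaschke_wronskian bs) z = z ^ length bs * of_real (T z)"
    "\<And>z. cmod z \<le> 1 \<Longrightarrow> T z > 0"
    using blaschke_defect[OF bs] unfolding Y_def by metis
  \<comment> \<open>In terms of \<open>S\<close> and \<open>T\<close> the function is continuous up
    to the circle, where the defects themselves vanish.\<close>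
  define g where "g = (\<lambda>z. ln (c * S z) - ln (d * T z))"
  have g_cont: "continuous_on (cball 0 1) g"
  proof -
    have "continuous_on (cball 0 1) S" "continuous_on (cball 0 1) T"
      using S(1) T(1) continuous_on_subset by blast+
    moreover have "\<forall>x\<in>cball 0 1. S x \<noteq> 0" "\<forall>x\<in>cball 0 1. T x \<noteq> 0" using S(4) T(4) by force+
    ultimately show ?thesis unfolding g_def
      using cd by (intro continuous_intros) auto
  qed
  have ST: "c * S z = d * T z" if "cmod z = 1" for z
  proof -
    have "z ^ length as * of_real (c * S z) = z ^ length as * of_real (d * T z)"
      using W[of z] unfolding S(3)[OF that] T(3)[OF that] len by (simp add: mult_ac)
    moreover have "z ^ length as \<noteq> 0" using that by auto
    ultimately have "complex_of_real (c * S z) = of_real (d * T z)" by (metis mult_left_cancel)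
    then show ?thesis by (simp only: of_real_eq_iff)
  qed
  have gY: "g w = (ln c + ln (Y as w)) - (ln d + ln (Y bs w))" if "cmod w < 1" for w
  proof -
    have "1 - (cmod w)\<^sup>2 > 0" using that by (simp add: abs_square_less_1)
    then show ?thesis unfolding g_def S T using S(4)[of w] T(4)[of w] that cd by (simp add: ln_mult)
  qed
  have Ypos: "Y as w > 0" "Y bs w > 0" if "cmod w < 1" for w
    unfolding Y_def using blaschke_defect_pos[OF as that] blaschke_defect_pos[OF bs that] by simp_all
  have "g z \<le> 0"
  proof (rule maximum_principle)
    show "continuous_on (ball 0 1) g" by (rule continuous_on_subset[OF g_cont]) auto
    show "\<exists>r<1. \<forall>z\<in>ball 0 1. cmod z > r \<longrightarrow> g z < e" if "e > 0" for e
      by (rule boundary_condition_from_continuity[OF g_cont _ that]) (use ST in \<open>simp add: g_def\<close>)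
    show "z \<in> ball 0 1" using z by simp
    fix z :: complex assume "z \<in> ball 0 1" and gz: "g z > 0"
    then have z: "cmod z < 1" by simp
    define V where "V = cmod (of_real c * poly (blaschke_wronskian as) z)"
    have V: "cmod (poly (blaschke_wronskian as) z) = V / c" "cmod (poly (blaschke_wronskian bs) z) = V / d"
      unfolding V_def using cd W[of z] by (simp_all add: norm_mult, metis W norm_mult norm_of_real abs_of_pos nonzero_mult_div_cancel_left less_irrefl)
    define L where "L = (0 + - 4 * (V / c)\<^sup>2 / (Y as z)\<^sup>2) - (0 + - 4 * (V / d)\<^sup>2 / (Y bs z)\<^sup>2)"
    have lap: "has_laplacian (\<lambda>w. (ln c + ln (Y as w)) - (ln d + ln (Y bs w))) L z"
      unfolding L_def V[symmetric] unfolding Y_def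
      by (intro has_laplacian_diff has_laplacian_add has_laplacian_const has_laplacian_ln_blaschke_defect as bs z)
    have "\<forall>\<^sub>F w in nhds z. (ln c + ln (Y as w)) - (ln d + ln (Y bs w)) = g w"
      using eventually_nhds_in_open[of "ball 0 1" z] z by (auto elim!: eventually_mono simp: gY)
    from has_laplacian_cong[OF this lap] have "has_laplacian g L z" .
    \<comment> \<open>Where \<open>g\<close> is positive the first defect, scaled by
      \<open>c\<close>, is the larger one, so its negative Laplacian term is the smaller in absolute
      value.\<close>
    moreover have "L \<ge> 0"
    proof -
      have "ln (d * Y bs z) < ln (c * Y as z)"
        using gz gY[OF z] cd Ypos[OF z] by (simp add: ln_mult)
      then have "d * Y bs z < c * Y as z" using cd Ypos[OF z] by (subst (asm) ln_less_cancel_iff) auto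
      then have "(V / (c * Y as z))\<^sup>2 \<le> (V / (d * Y bs z))\<^sup>2"
        using cd Ypos[OF z] by (intro power_mono divide_left_mono) (auto simp: V_def)
      then show ?thesis by (simp add: L_def power_divide power_mult_distrib)
    qed
    ultimately show "\<exists>L\<ge>0. has_laplacian g L z" by blast
  qed
  then have "ln (c * Y as z) \<le> ln (d * Y bs z)" using gY[OF z] cd Ypos[OF z] by (simp add: ln_mult)
  then show ?thesis using cd Ypos[OF z] by (subst (asm) ln_le_cancel_iff) (auto simp: Y_def)
qed

lemma reflected_roots_poly_0: "poly (reflected_roots_poly as) 0 = 1"
  by (induction as) auto

text \<open>Comparison in both directions makes the defects proportional. Their value 1 at the
  origin fixes the constants, and polarization recovers P^*, hence P on the circle.\<close>

lemma blaschke_wronskian_inj: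
  assumes as: "\<And>a. a \<in> set as \<Longrightarrow> cmod a < 1" and bs: "\<And>a. a \<in> set bs \<Longrightarrow> cmod a < 1"
    and len: "length as = length bs" and cd: "c > 0" "d > 0"
    and W: "\<And>z. of_real c * poly (blaschke_wronskian as) z = of_real d * poly (blaschke_wronskian bs) z"
  shows "c = d" "roots_poly as = roots_poly bs"
proof -
  have eq: "c * ((cmod (poly (reflected_roots_poly as) z))\<^sup>2 - (cmod (z * poly (roots_poly as) z))\<^sup>2)
       = d * ((cmod (poly (reflected_roots_poly bs) z))\<^sup>2 - (cmod (z * poly (roots_poly bs) z))\<^sup>2)" if "cmod z < 1" for z
    using blaschke_defect_le[OF as bs len cd W that]
      blaschke_defect_le[OF bs as len[symmetric] cd(2,1) W[symmetric] that] by linarith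
  from eq[of 0] show c: "c = d" by (simp add: reflected_roots_poly_0)
  have "reflected_roots_poly as = reflected_roots_poly bs"
    by (rule polarized_norm_identity[of _ "roots_poly as" _ "roots_poly bs"])
       (use eq c cd in \<open>simp_all add: reflected_roots_poly_0\<close>)
  show "roots_poly as = roots_poly bs"
  proof (rule poly_eq_on_circle)
    fix z :: complex assume z: "cmod z = 1"
    have "z ^ length as * cnj (poly (roots_poly as) z) = z ^ length as * cnj (poly (roots_poly bs) z)"
      using reflected_roots_poly_on_circle[OF z] len \<open>reflected_roots_poly as = _\<close> by metis
    then show "poly (roots_poly as) z = poly (roots_poly bs) z" using z by auto
  qed
qed

section \<open>Blaschke products with prescribed critical points\<close>

text \<open>The polynomial P^* once more, now from the coefficients and with formal degree
  \<open>N\<close>: in this form it depends continuously on P without any choice of roots.\<close>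

definition star_poly :: "nat \<Rightarrow> complex poly \<Rightarrow> complex poly" where
  "star_poly N P = (\<Sum>k\<le>N. Polynomial.monom (cnj (poly.coeff P (N - k))) k)"

lemma coeff_star_poly: "poly.coeff (star_poly N P) k = (if k \<le> N then cnj (poly.coeff P (N - k)) else 0)"
  by (auto simp: star_poly_def Polynomial.coeff_sum)

lemma poly_star_poly:
  assumes "degree P \<le> N" "z \<noteq> 0"
  shows "poly (star_poly N P) z = z ^ N * cnj (poly P (1 / cnj z))"
proof -
  have P: "poly P w = (\<Sum>j\<le>N. poly.coeff P j * w ^ j)" for w
    unfolding poly_altdef using assms(1) by (intro sum.mono_neutral_left) (auto simp: coeff_eq_0)
  have "z ^ N * cnj (poly P (1 / cnj z)) = (\<Sum>j\<le>N. cnj (poly.coeff P j) * (z ^ N * (1 / z) ^ j))"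
    unfolding P by (simp add: cnj_sum sum_distrib_left mult_ac)
  also have "\<dots> = (\<Sum>j\<le>N. cnj (poly.coeff P j) * z ^ (N - j))"
    using assms(2) by (intro sum.cong) (auto simp: power_diff power_one_over divide_simps)
  also have "\<dots> = (\<Sum>k\<le>N. cnj (poly.coeff P (N - k)) * z ^ k)"
    by (rule sum.reindex_bij_witness[of _ "\<lambda>k. N - k" "\<lambda>k. N - k"]) auto
  also have "\<dots> = poly (star_poly N P) z"
    by (simp add: star_poly_def poly_sum poly_monom)
  finally show ?thesis by simp
qed

lemma poly_star_poly_on_circle:
  assumes "degree P \<le> N" "cmod z = 1"
  shows "poly (star_poly N P) z = z ^ N * cnj (poly P z)"
proof -
  have "z * cnj z = 1" using assms(2) complex_norm_square[of z] by simp
  then have "1 / cnj z = z" "z \<noteq> 0" by (auto simp: divide_simps)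
  then show ?thesis using poly_star_poly[OF assms(1), of z] by simp
qed

lemma star_poly_roots_poly: "star_poly (length as) (roots_poly as) = reflected_roots_poly as"
  by (rule poly_eq_on_circle)
     (simp add: poly_star_poly_on_circle degree_roots_poly reflected_roots_poly_on_circle)

text \<open>Conjugation followed by multiplication with z^(2 N) fixes z^N times a real number on the
  circle, so \<open>V\<close> is its own reflection of formal degree 2 N.\<close>

lemma self_inversive_coeff:
  assumes "degree V \<le> 2 * N" "\<And>z. cmod z = 1 \<Longrightarrow> \<exists>s::real. poly V z = z ^ N * of_real s" "k \<le> 2 * N"
  shows "poly.coeff V k = cnj (poly.coeff V (2 * N - k))"
proof -
  have "star_poly (2 * N) V = V"
  proof (rule poly_eq_on_circle)
    fix z :: complex assume z: "cmod z = 1"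
    obtain s :: real where s: "poly V z = z ^ N * of_real s" using assms(2)[OF z] by blast
    have "z ^ N * cnj z ^ N = 1"
      using z complex_norm_square[of z] by (simp flip: power_mult_distrib)
    then show "poly (star_poly (2 * N) V) z = poly V z"
    proof -
      have "z ^ (2 * N) * cnj (z ^ N * of_real s) = z ^ N * of_real s * (z ^ N * cnj z ^ N)"
        unfolding mult_2 power_add complex_cnj_mult complex_cnj_power complex_cnj_complex_of_real
        by (simp only: mult_ac)
      then show ?thesis unfolding poly_star_poly_on_circle[OF assms(1) z] s \<open>z ^ N * cnj z ^ N = 1\<close> by simp
    qed
  qed
  then show ?thesis using coeff_star_poly[of "2*N" V k] assms(3) by simp
qed

text \<open>
  A polynomial of degree at most \<open>2 N\<close> that is \<open>z\<^sup>N\<close> times a real function on the circle is determined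
  by these \<open>2 N + 1\<close> real numbers. The parameters of a Blaschke product and a positive constant are
  equally many, which makes invariance of domain applicable.
\<close>

definition half_coords :: "nat \<Rightarrow> complex poly \<Rightarrow> nat \<Rightarrow> real" where
  "half_coords N V i = (if i < 2 * N + 1 then
     if even i then Re (poly.coeff V (i div 2)) else Im (poly.coeff V (i div 2)) else 0)"

text \<open>The upper half of the coefficients is conjugate to the lower half and the middle one is
  real, so the last coordinate, the real part of coefficient \<open>N\<close>, loses
  nothing.\<close>

lemma half_coords_inj:
  assumes V: "degree V \<le> 2 * N" "\<And>z. cmod z = 1 \<Longrightarrow> \<exists>s::real. poly V z = z ^ N * of_real s"
    and W: "degree W \<le> 2 * N" "\<And>z. cmod z = 1 \<Longrightarrow> \<exists>s::real. poly W z = z ^ N * of_real s"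
    and eq: "half_coords N V = half_coords N W"
  shows "V = W"
proof (rule poly_eqI)
  have eq1: "poly.coeff V k = poly.coeff W k" if "k < N" for k
  proof (rule complex_eqI)
    show "Re (poly.coeff V k) = Re (poly.coeff W k)"
      using fun_cong[OF eq, of "2 * k"] that by (simp add: half_coords_def)
    show "Im (poly.coeff V k) = Im (poly.coeff W k)"
      using fun_cong[OF eq, of "2 * k + 1"] that by (simp add: half_coords_def)
  qed
  have eq2: "poly.coeff V N = poly.coeff W N"
  proof (rule complex_eqI)
    show "Re (poly.coeff V N) = Re (poly.coeff W N)"
      using fun_cong[OF eq, of "2 * N"] by (simp add: half_coords_def)
    have "Im (poly.coeff V N) = - Im (poly.coeff V N)"
      using arg_cong[OF self_inversive_coeff[OF V, of N], of Im] by simp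
    moreover have "Im (poly.coeff W N) = - Im (poly.coeff W N)"
      using arg_cong[OF self_inversive_coeff[OF W, of N], of Im] by simp
    ultimately show "Im (poly.coeff V N) = Im (poly.coeff W N)" by simp
  qed
  fix k
  consider "k < N" | "k = N" | "N < k" "k \<le> 2 * N" | "k > 2 * N" by linarith
  then show "poly.coeff V k = poly.coeff W k"
  proof cases
    case 3
    then have "poly.coeff V (2 * N - k) = poly.coeff W (2 * N - k)" by (intro eq1) auto
    then show ?thesis using self_inversive_coeff[OF V 3(2)] self_inversive_coeff[OF W 3(2)] by simp
  next
    case 4
    then show ?thesis using V(1) W(1) by (simp add: coeff_eq_0)
  qed (use eq1 eq2 in auto)
qed

definition complex_coord :: "(nat \<Rightarrow> real) \<Rightarrow> nat \<Rightarrow> complex" where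
  "complex_coord x j = of_real (x (2 * j)) + \<i> * of_real (x (2 * j + 1))"

definition param_poly :: "nat \<Rightarrow> (nat \<Rightarrow> real) \<Rightarrow> complex poly" where
  "param_poly N x = Polynomial.monom 1 N + (\<Sum>j<N. Polynomial.monom (complex_coord x j) j)"

definition param_wronskian :: "nat \<Rightarrow> (nat \<Rightarrow> real) \<Rightarrow> complex poly" where
  "param_wronskian N x = [:of_real (x (2 * N)):] *
     wronskian (pCons 0 (param_poly N x)) (star_poly N (param_poly N x))"

text \<open>Coordinates below 2 N hold the real and imaginary parts of the non-leading coefficients
  of a monic P, coordinate 2 N a positive scaling factor. That P^* has no zeros in the closed disc
  encodes that all roots of P lie in the open disc; stated over a compact set, this is visibly an
  open condition. Sequences with vanishing tail are the points of
  \<open>Euclidean_space\<close>.\<close>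

definition param_domain :: "nat \<Rightarrow> (nat \<Rightarrow> real) set" where
  "param_domain N = {x. (\<forall>i\<ge>2 * N + 1. x i = 0) \<and> x (2 * N) > 0 \<and>
     (\<forall>w\<in>cball 0 1. poly (star_poly N (param_poly N x)) w \<noteq> 0)}"

lemma coeff_param_poly:
  "poly.coeff (param_poly N x) k = (if k = N then 1 else if k < N then complex_coord x k else 0)"
  by (auto simp: param_poly_def Polynomial.coeff_sum)

lemma degree_param_poly: "degree (param_poly N x) = N"
proof (rule antisym)
  show "degree (param_poly N x) \<le> N" by (rule degree_le) (simp add: coeff_param_poly)
  show "N \<le> degree (param_poly N x)" by (rule le_degree) (simp add: coeff_param_poly)
qed

lemma Euclidean_space_eq: "Euclidean_space n = top_of_set {x. \<forall>i\<ge>n. x i = 0}"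
  by (simp add: Euclidean_space_def euclidean_product_topology)

text \<open>A root \<open>a\<close> outside the open disc would reflect to the zero 1 / cnj a of P^*
  in the closed disc.\<close>

lemma param_domain_roots:
  assumes "x \<in> param_domain N"
  obtains as where "param_poly N x = roots_poly as" "length as = N" "\<And>a. a \<in> set as \<Longrightarrow> cmod a < 1"
    "star_poly N (param_poly N x) = reflected_roots_poly as"
proof -
  have "lead_coeff (param_poly N x) = 1" by (simp add: degree_param_poly coeff_param_poly)
  from ex_roots_poly[OF this] obtain as where as: "param_poly N x = roots_poly as"
    "length as = N" "\<And>z. poly (param_poly N x) z = 0 \<longleftrightarrow> z \<in> set as"
    by (metis degree_param_poly)
  have "cmod a < 1" if "a \<in> set as" for a
  proof (rule ccontr)
    assume "\<not> cmod a < 1"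
    then have "cmod a \<ge> 1" by simp
    then have "a \<noteq> 0" "1 / cnj a \<in> cball 0 1" by (auto simp: norm_divide divide_le_eq_1)
    moreover have "poly (star_poly N (param_poly N x)) (1 / cnj a) = 0"
      using poly_star_poly[of "param_poly N x" N "1 / cnj a"] that as(3) \<open>a \<noteq> 0\<close> by (simp add: degree_param_poly)
    ultimately show False using assms by (auto simp: param_domain_def)
  qed
  then show ?thesis using that[OF as(1,2)] star_poly_roots_poly[of as] as by simp
qed

lemma param_domain_wronskian:
  assumes "x \<in> param_domain N"
  obtains as where "param_poly N x = roots_poly as" "length as = N" "\<And>a. a \<in> set as \<Longrightarrow> cmod a < 1"
    "param_wronskian N x = [:of_real (x (2 * N)):] * blaschke_wronskian as"
  using param_domain_roots[OF assms] by (metis param_wronskian_def)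

lemma degree_wronskian:
  assumes "degree p \<le> N" "degree q \<le> N"
  shows "degree (wronskian (pCons 0 p) q) \<le> 2 * N"
proof -
  have p: "degree (pCons 0 p) \<le> Suc N" using assms(1) degree_pCons_le[of 0 p] by linarith
  have "degree (pderiv (pCons 0 p) * q) \<le> 2 * N"
    using degree_mult_le[of "pderiv (pCons 0 p)" q] degree_pderiv[of "pCons 0 p"] p assms(2) by linarith
  moreover have "degree (pCons 0 p * pderiv q) \<le> 2 * N"
  proof (cases "degree q = 0")
    \<comment> \<open>Subtraction on natural numbers is truncated: for constant \<open>q\<close> the
      generic degree estimate fails when \<open>N\<close> is 0.\<close>
    case True
    then have "pderiv q = 0" by (simp add: pderiv_eq_0_iff)
    then show ?thesis by simp
  next
    case False
    then show ?thesis
      using degree_mult_le[of "pCons 0 p" "pderiv q"] degree_pderiv[of q] p assms(2) by linarith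
  qed
  ultimately show ?thesis unfolding wronskian_def by (intro degree_diff_le)
qed

lemma blaschke_wronskian_self_inversive:
  assumes "\<And>a. a \<in> set as \<Longrightarrow> cmod a < 1"
  shows "degree ([:of_real c:] * blaschke_wronskian as) \<le> 2 * length as"
    "cmod z = 1 \<Longrightarrow> \<exists>s::real. poly ([:of_real c:] * blaschke_wronskian as) z = z ^ length as * of_real s"
proof -
  have "degree (blaschke_wronskian as) \<le> 2 * length as"
    by (intro degree_wronskian degree_reflected_roots_poly) (simp add: degree_roots_poly)
  then show "degree ([:of_real c:] * blaschke_wronskian as) \<le> 2 * length as"
    by (simp add: degree_smult_le[THEN order_trans])
  obtain S :: "complex \<Rightarrow> real" where S: "\<And>z. cmod z = 1 \<Longrightarrow> poly (blaschke_wronskian as) z = z ^ length as * of_real (S z)"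
    using blaschke_defect[OF assms] by metis
  show "\<exists>s::real. poly ([:of_real c:] * blaschke_wronskian as) z = z ^ length as * of_real s" if "cmod z = 1"
    by (rule exI[of _ "c * S z"]) (simp add: S[OF that])
qed

lemma param_wronskian_self_inversive:
  assumes "x \<in> param_domain N"
  shows "degree (param_wronskian N x) \<le> 2 * N"
    "cmod z = 1 \<Longrightarrow> \<exists>s::real. poly (param_wronskian N x) z = z ^ N * of_real s"
proof -
  obtain as where "length as = N" "\<And>a. a \<in> set as \<Longrightarrow> cmod a < 1"
    "param_wronskian N x = [:of_real (x (2 * N)):] * blaschke_wronskian as"
    using param_domain_wronskian[OF assms] by metis
  then show "degree (param_wronskian N x) \<le> 2 * N"
    "cmod z = 1 \<Longrightarrow> \<exists>s::real. poly (param_wronskian N x) z = z ^ N * of_real s"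
    using blaschke_wronskian_self_inversive[of as] by metis+
qed

lemma continuous_coeff_param_poly: "continuous_on UNIV (\<lambda>x. poly.coeff (param_poly N x) k)"
proof -
  have "continuous_on UNIV (\<lambda>x. complex_coord x k)"
    unfolding complex_coord_def by (intro continuous_intros continuous_on_product_coordinates)
  then show ?thesis by (cases "k = N"; cases "k < N") (simp_all add: coeff_param_poly)
qed

lemma continuous_coeff_star_param_poly: "continuous_on UNIV (\<lambda>x. poly.coeff (star_poly N (param_poly N x)) k)"
  by (cases "k \<le> N") (simp_all add: coeff_star_poly continuous_coeff_param_poly continuous_on_cnj)

lemma continuous_coeff_param_wronskian: "continuous_on UNIV (\<lambda>x. poly.coeff (param_wronskian N x) k)"
proof -
  have 1: "continuous_on UNIV (\<lambda>x. poly.coeff (pCons 0 (param_poly N x)) j)" for j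
    by (cases j) (simp_all add: continuous_coeff_param_poly)
  have 2: "continuous_on UNIV (\<lambda>x. poly.coeff (pderiv (pCons 0 (param_poly N x))) j)" for j
    unfolding coeff_pderiv by (intro continuous_intros 1)
  have 3: "continuous_on UNIV (\<lambda>x. poly.coeff (pderiv (star_poly N (param_poly N x))) j)" for j
    unfolding coeff_pderiv by (intro continuous_intros continuous_coeff_star_param_poly)
  have "poly.coeff (param_wronskian N x) k = of_real (x (2 * N)) *
    ((\<Sum>i\<le>k. poly.coeff (pderiv (pCons 0 (param_poly N x))) i * poly.coeff (star_poly N (param_poly N x)) (k - i)) -
     (\<Sum>i\<le>k. poly.coeff (pCons 0 (param_poly N x)) i * poly.coeff (pderiv (star_poly N (param_poly N x))) (k - i)))" for x
  proof -
    have "poly.coeff ([:c:] * p) k = c * poly.coeff p k" for c :: complex and p by simp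
    then have "poly.coeff (param_wronskian N x) k = of_real (x (2 * N)) *
       poly.coeff (wronskian (pCons 0 (param_poly N x)) (star_poly N (param_poly N x))) k"
      unfolding param_wronskian_def .
    then show ?thesis unfolding wronskian_def Polynomial.coeff_diff Polynomial.coeff_mult .
  qed
  then show ?thesis
    by (simp only:) (intro continuous_intros continuous_on_product_coordinates 1 2 3 continuous_coeff_star_param_poly)
qed

text \<open>Projection along a compact factor is closed: the zeros belonging to a convergent
  sequence of parameters have a limit point in \<open>K\<close>.\<close>

lemma closed_compact_zero_set:
  fixes f :: "'a::{first_countable_topology,t2_space} \<Rightarrow> 'b::metric_space \<Rightarrow> 'c::real_normed_vector"
  assumes "compact K" "continuous_on UNIV (\<lambda>(x, w). f x w)"
  shows "closed {x. \<exists>w\<in>K. f x w = 0}"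
  unfolding closed_sequential_limits
proof (intro allI impI, elim conjE)
  fix X l assume X: "\<forall>n. X n \<in> {x. \<exists>w\<in>K. f x w = 0}" "X \<longlonglongrightarrow> l"
  then have "\<forall>n. \<exists>w. w \<in> K \<and> f (X n) w = 0" by blast
  then obtain w where w: "\<And>n. w n \<in> K" "\<And>n. f (X n) (w n) = 0" by metis
  obtain v r where v: "v \<in> K" "strict_mono r" "(w \<circ> r) \<longlonglongrightarrow> v"
    using assms(1) w(1) unfolding compact_def by metis
  have "(\<lambda>n. (X (r n), w (r n))) \<longlonglongrightarrow> (l, v)"
    using LIMSEQ_subseq_LIMSEQ[OF X(2) v(2)] v(3) by (intro tendsto_Pair) (simp_all add: o_def)
  moreover have "isCont (\<lambda>(x, w). f x w) (l, v)"
    using assms(2) by (simp add: continuous_on_eq_continuous_at)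
  ultimately have "(\<lambda>n. (\<lambda>(x, w). f x w) (X (r n), w (r n))) \<longlonglongrightarrow> (\<lambda>(x, w). f x w) (l, v)"
    by (rule isCont_tendsto_compose[rotated])
  then have "f l v = 0" using w(2) LIMSEQ_unique[OF _ tendsto_const] by simp
  then show "l \<in> {x. \<exists>w\<in>K. f x w = 0}" using v by blast
qed

lemma openin_param_domain: "openin (Euclidean_space (2 * N + 1)) (param_domain N)"
proof -
  define f where "f = (\<lambda>x w. poly (star_poly N (param_poly N x)) w)"
  have f: "f x w = (\<Sum>k\<le>N. cnj (poly.coeff (param_poly N x) (N - k)) * w ^ k)" for x w
    by (simp add: f_def star_poly_def poly_sum poly_monom)
  have c: "continuous_on UNIV (\<lambda>p::(nat \<Rightarrow> real) \<times> complex. poly.coeff (param_poly N (fst p)) k)" for k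
    by (rule continuous_on_compose2[OF continuous_coeff_param_poly continuous_on_fst[OF continuous_on_id]]) auto
  have "continuous_on UNIV (\<lambda>(x, w). f x w)"
    unfolding f case_prod_unfold by (intro continuous_intros c)
  then have "closed {x. \<exists>w\<in>cball 0 1. f x w = 0}" by (intro closed_compact_zero_set) auto
  then have "open (- {x. \<exists>w\<in>cball 0 1. f x w = 0})" by (rule open_Compl)
  moreover have "open {x::nat\<Rightarrow>real. 0 < x (2 * N)}"
    by (intro open_Collect_less continuous_intros continuous_on_product_coordinates)
  ultimately have "open (- {x. \<exists>w\<in>cball 0 1. f x w = 0} \<inter> {x. 0 < x (2 * N)})" by (rule open_Int)
  moreover have "param_domain N = {x. \<forall>i\<ge>2 * N + 1. x i = 0} \<inter> (- {x. \<exists>w\<in>cball 0 1. f x w = 0} \<inter> {x. 0 < x (2 * N)})"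
    by (auto simp: param_domain_def f_def)
  ultimately show ?thesis unfolding Euclidean_space_eq openin_open by blast
qed

lemma param_wronskian_inj:
  assumes x: "x \<in> param_domain N" and y: "y \<in> param_domain N"
    and eq: "param_wronskian N x = param_wronskian N y"
  shows "x = y"
proof -
  obtain as where as: "param_poly N x = roots_poly as" "length as = N" "\<And>a. a \<in> set as \<Longrightarrow> cmod a < 1"
    "param_wronskian N x = [:of_real (x (2 * N)):] * blaschke_wronskian as"
    using param_domain_wronskian[OF x] by metis
  obtain bs where bs: "param_poly N y = roots_poly bs" "length bs = N" "\<And>a. a \<in> set bs \<Longrightarrow> cmod a < 1"
    "param_wronskian N y = [:of_real (y (2 * N)):] * blaschke_wronskian bs"
    using param_domain_wronskian[OF y] by metis
  have W: "of_real (x (2 * N)) * poly (blaschke_wronskian as) z = of_real (y (2 * N)) * poly (blaschke_wronskian bs) z" for z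
  proof -
    have "poly (param_wronskian N x) z = poly (param_wronskian N y) z" using eq by simp
    then show ?thesis unfolding as bs by simp
  qed
  have pos: "x (2 * N) > 0" "y (2 * N) > 0" using x y by (auto simp: param_domain_def)
  have "length as = length bs" using as bs by simp
  from blaschke_wronskian_inj[OF as(3) bs(3) this pos W]
  have xy: "x (2 * N) = y (2 * N)" "param_poly N x = param_poly N y" using as bs by auto
  show "x = y"
  proof
    fix i
    consider "i \<ge> 2 * N + 1" | "i = 2 * N" | "i < 2 * N" by linarith
    then show "x i = y i"
    proof cases
      case 1
      then show ?thesis using x y by (simp add: param_domain_def)
    next
      case 2
      then show ?thesis using xy by simp
    next
      case 3
      then have "i div 2 < N" by auto
      then have "complex_coord x (i div 2) = complex_coord y (i div 2)"
        using arg_cong[OF xy(2), of "\<lambda>p. poly.coeff p (i div 2)"] by (simp add: coeff_param_poly)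
      then have "x (2 * (i div 2)) = y (2 * (i div 2))" "x (2 * (i div 2) + 1) = y (2 * (i div 2) + 1)"
        by (simp_all add: complex_coord_def complex_eq_iff)
      then show ?thesis by (cases "even i") (auto elim!: evenE oddE)
    qed
  qed
qed

text \<open>Domain and target both have dimension 2 N + 1, so a continuous injective map is open.
  Injectivity rests on the maximum principle through \<open>param_wronskian_inj\<close>.\<close>

lemma openin_wronskian_image:
  "openin (Euclidean_space (2 * N + 1)) ((\<lambda>x. half_coords N (param_wronskian N x)) ` param_domain N)"
proof (rule invariance_of_domain_Euclidean_space[OF openin_param_domain])
  have "continuous_on UNIV (\<lambda>x. half_coords N (param_wronskian N x))"
  proof (rule continuous_on_coordinatewise_then_product)
    fix i
    have "continuous_on UNIV (\<lambda>x. Re (poly.coeff (param_wronskian N x) (i div 2)))"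
         "continuous_on UNIV (\<lambda>x. Im (poly.coeff (param_wronskian N x) (i div 2)))"
      by (intro continuous_intros continuous_coeff_param_wronskian)+
    then show "continuous_on UNIV (\<lambda>x. half_coords N (param_wronskian N x) i)"
      by (cases "even i"; cases "i < 2 * N + 1") (simp_all add: half_coords_def)
  qed
  then show "continuous_map (subtopology (Euclidean_space (2 * N + 1)) (param_domain N))
     (Euclidean_space (2 * N + 1)) (\<lambda>x. half_coords N (param_wronskian N x))"
    unfolding cm_Euclidean_space_iff_continuous_on topspace_Euclidean_space
    by (auto intro: continuous_on_subset simp: half_coords_def)
  show "inj_on (\<lambda>x. half_coords N (param_wronskian N x)) (param_domain N)"
  proof (rule inj_onI)
    fix x y assume x: "x \<in> param_domain N" and y: "y \<in> param_domain N"
      and eq: "half_coords N (param_wronskian N x) = half_coords N (param_wronskian N y)"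
    have "param_wronskian N x = param_wronskian N y"
      by (rule half_coords_inj[OF param_wronskian_self_inversive[OF x] param_wronskian_self_inversive[OF y] eq])
    then show "x = y" by (rule param_wronskian_inj[OF x y])
  qed
qed

section \<open>Estimates that keep the parameters of convergent Wronskians in a compact set\<close>

lemma norm_coeff_roots_poly_le:
  assumes "\<And>a. a \<in> set as \<Longrightarrow> cmod a \<le> 1"
  shows "cmod (poly.coeff (roots_poly as) k) \<le> 2 ^ length as"
  using assms
proof (induction as arbitrary: k)
  case (Cons a as)
  define q where "q = roots_poly as"
  have q: "cmod (poly.coeff q j) \<le> 2 ^ length as" for j using Cons unfolding q_def by auto
  have "poly.coeff ([:-a, 1:] * q) k = poly.coeff (pCons 0 q) k - a * poly.coeff q k" by simp
  also have "cmod \<dots> \<le> cmod (poly.coeff (pCons 0 q) k) + cmod (a * poly.coeff q k)" by (rule norm_triangle_ineq4)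
  also have "\<dots> \<le> 2 ^ length as + 2 ^ length as"
  proof (rule add_mono)
    show "cmod (poly.coeff (pCons 0 q) k) \<le> 2 ^ length as" by (cases k) (auto simp: q)
    have "cmod a * cmod (poly.coeff q k) \<le> 1 * 2 ^ length as"
      by (intro mult_mono q) (use Cons.prems in auto)
    then show "cmod (a * poly.coeff q k) \<le> 2 ^ length as" by (simp add: norm_mult)
  qed
  finally show ?case by (simp add: q_def del: mult_pCons_left)
qed simp

text \<open>On the circle |P| = |P^*|, and P^* is 1 at the origin, so the maximum modulus principle
  for P^* applies. Such a point serves to bound the scaling factor of a Wronskian by its values on
  the circle.\<close>

lemma ex_roots_poly_ge_1:
  "\<exists>z. cmod z = 1 \<and> cmod (poly (roots_poly as) z) \<ge> 1"
proof (rule ccontr)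
  assume "\<not> ?thesis"
  then have lt: "cmod (poly (roots_poly as) z) < 1" if "cmod z = 1" for z using that by force
  have lt': "cmod (poly (reflected_roots_poly as) z) < 1" if "cmod z = 1" for z
    using lt[OF that] reflected_roots_poly_on_circle[OF that, of as] that by (simp add: norm_mult norm_power)
  have "continuous_on (sphere 0 1) (\<lambda>z. cmod (poly (reflected_roots_poly as) z))" by (intro continuous_intros)
  moreover have "sphere (0::complex) 1 \<noteq> {}" by simp
  ultimately obtain z0 where z0: "cmod z0 = 1" "\<And>z. cmod z = 1 \<Longrightarrow>
      cmod (poly (reflected_roots_poly as) z) \<le> cmod (poly (reflected_roots_poly as) z0)"
    using continuous_attains_sup[of "sphere (0::complex) 1" "\<lambda>z. cmod (poly (reflected_roots_poly as) z)"] by auto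
  have "cmod (poly (reflected_roots_poly as) 0) \<le> cmod (poly (reflected_roots_poly as) z0)"
    by (rule maximum_modulus_frontier[of "poly (reflected_roots_poly as)" "cball 0 1"])
       (auto intro!: holomorphic_intros continuous_intros z0)
  then show False using lt'[OF z0(1)] by (simp add: reflected_roots_poly_0)
qed

text \<open>Every factor has modulus at least 1 - |w|, uniformly in the roots; the bound therefore
  survives a limit in which roots approach the circle.\<close>

lemma norm_reflected_roots_poly_ge:
  assumes "\<And>a. a \<in> set as \<Longrightarrow> cmod a < 1" "cmod w < 1"
  shows "cmod (poly (reflected_roots_poly as) w) \<ge> (1 - cmod w) ^ length as"
  using assms(1)
proof (induction as)
  case (Cons a as)
  have "cmod (w * cnj a) \<le> cmod w" using Cons.prems[of a] by (simp add: norm_mult mult_left_le)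
  then have "1 - cmod w \<le> cmod (1 - w * cnj a)" using norm_triangle_ineq2[of 1 "w * cnj a"] by simp
  then have "(1 - cmod w) * (1 - cmod w) ^ length as \<le> cmod (1 - w * cnj a) * cmod (poly (reflected_roots_poly as) w)"
    using Cons assms(2) by (intro mult_mono) auto
  moreover have "poly (reflected_roots_poly (a # as)) w = (1 - w * cnj a) * poly (reflected_roots_poly as) w"
    by (simp add: algebra_simps)
  ultimately show ?case by (simp add: norm_mult del: roots_poly_simps)
qed simp

text \<open>Tychonoff's theorem; it provides convergent subsequences of parameters in the product
  topology.\<close>

lemma compact_real_sequences_bounded: "compact {x::nat \<Rightarrow> real. \<forall>i. x i \<in> {- B..B}}"
proof -
  have "compactin (product_topology (\<lambda>_. euclideanreal) UNIV) (PiE UNIV (\<lambda>_::nat. {- B..B}))"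
    unfolding compactin_PiE by simp
  moreover have "PiE UNIV (\<lambda>_::nat. {- B..B}) = {x. \<forall>i. x i \<in> {- B..B}}" by (auto simp: PiE_UNIV_domain)
  ultimately show ?thesis by (simp add: euclidean_product_topology)
qed

text \<open>Properness of the parameter map. A bound on the Wronskians bounds all parameters, so a
  subsequence converges. The limit could leave the domain only through a vanishing scaling factor or
  a root on the circle, and either would give \<open>V\<close> a zero on the circle.\<close>

lemma param_domain_closed_image:
  assumes X: "\<And>n. X n \<in> param_domain N"
    and lim: "\<And>k. (\<lambda>n. poly.coeff (param_wronskian N (X n)) k) \<longlonglongrightarrow> poly.coeff V k"
    and bnd: "\<And>n z. cmod z = 1 \<Longrightarrow> cmod (poly (param_wronskian N (X n)) z) \<le> M"
    and V: "\<And>z. cmod z = 1 \<Longrightarrow> poly V z \<noteq> 0"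
  shows "\<exists>x\<in>param_domain N. param_wronskian N x = V"
proof -
  \<comment> \<open>At a point of the circle with |P| at least 1, the lower bound for
    \<open>S\<close> makes the modulus of the scaled Wronskian at least the scaling factor.\<close>
  have M1: "X n (2 * N) \<le> M \<and> X n (2 * N) > 0" for n
  proof -
    obtain as where as: "param_poly N (X n) = roots_poly as" "length as = N" "\<And>a. a \<in> set as \<Longrightarrow> cmod a < 1"
      "param_wronskian N (X n) = [:of_real (X n (2 * N)):] * blaschke_wronskian as"
      using param_domain_wronskian[OF X] by metis
    have pos: "X n (2 * N) > 0" using X[of n] by (simp add: param_domain_def)
    obtain S :: "complex \<Rightarrow> real" where S: "\<And>z. cmod z = 1 \<Longrightarrow> poly (blaschke_wronskian as) z = z ^ length as * of_real (S z)"
      "\<And>z. cmod z = 1 \<Longrightarrow> S z \<ge> (cmod (poly (roots_poly as) z))\<^sup>2"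
      using blaschke_defect[OF as(3)] by metis
    obtain z where z: "cmod z = 1" "cmod (poly (roots_poly as) z) \<ge> 1" using ex_roots_poly_ge_1 by blast
    have "1 \<le> (cmod (poly (roots_poly as) z))\<^sup>2" using z(2) by simp
    then have "S z \<ge> 1" using S(2)[OF z(1)] by linarith
    then have "X n (2 * N) \<le> X n (2 * N) * \<bar>S z\<bar>" using pos by simp
    also have "\<dots> = cmod (poly (param_wronskian N (X n)) z)"
      unfolding as(4) using S(1)[OF z(1)] z(1) pos by (simp add: norm_mult norm_power)
    also have "\<dots> \<le> M" by (rule bnd[OF z(1)])
    finally show ?thesis using pos by simp
  qed
  define B where "B = max M (2 ^ N)"
  have "X n i \<in> {-B..B}" for n i
  proof -
    obtain as where as: "param_poly N (X n) = roots_poly as" "length as = N" "\<And>a. a \<in> set as \<Longrightarrow> cmod a < 1"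
      using param_domain_roots[OF X] by metis
    consider "i \<ge> 2 * N + 1" | "i = 2 * N" | "i < 2 * N" by linarith
    then have "\<bar>X n i\<bar> \<le> B"
    proof cases
      case 1
      then show ?thesis using X[of n] by (simp add: param_domain_def B_def le_max_iff_disj)
    next
      case 2
      then show ?thesis using M1[of n] by (simp add: B_def le_max_iff_disj)
    next
      case 3
      then have "i div 2 < N" by auto
      then have "complex_coord (X n) (i div 2) = poly.coeff (roots_poly as) (i div 2)"
        unfolding as(1)[symmetric] by (simp add: coeff_param_poly)
      then have c: "cmod (complex_coord (X n) (i div 2)) \<le> 2 ^ N"
        using norm_coeff_roots_poly_le[of as "i div 2"] as by (simp add: less_imp_le)
      have "\<bar>X n i\<bar> \<le> cmod (complex_coord (X n) (i div 2))"
      proof (cases "even i")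
        case True
        then show ?thesis using abs_Re_le_cmod[of "complex_coord (X n) (i div 2)"] by (simp add: complex_coord_def)
      next
        case False
        then show ?thesis using abs_Im_le_cmod[of "complex_coord (X n) (i div 2)"] by (simp add: complex_coord_def)
      qed
      then show ?thesis using c by (simp add: B_def)
    qed
    then show ?thesis by (simp add: abs_le_iff minus_le_iff)
  qed
  then have "\<forall>n. X n \<in> {x. \<forall>i. x i \<in> {- B..B}}" by blast
  then obtain x r where x: "strict_mono r" "(X \<circ> r) \<longlonglongrightarrow> x"
    using compact_real_sequences_bounded[of B] unfolding compact_def by metis
  have xlim: "(\<lambda>n. f (X (r n))) \<longlonglongrightarrow> f x" if "continuous_on UNIV f" for f :: "(nat \<Rightarrow> real) \<Rightarrow> 'b::topological_space"
  proof -
    have "isCont f x" using that by (simp add: continuous_on_eq_continuous_at)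
    from isCont_tendsto_compose[OF this x(2)] show ?thesis by (simp add: o_def)
  qed
  have eq: "param_wronskian N x = V"
  proof (rule poly_eqI)
    fix k
    show "poly.coeff (param_wronskian N x) k = poly.coeff V k"
      using xlim[OF continuous_coeff_param_wronskian[of N k]]
        LIMSEQ_subseq_LIMSEQ[OF lim[of k] x(1)] LIMSEQ_unique by (simp add: o_def) blast
  qed
  have starlim: "(\<lambda>n. poly (star_poly N (param_poly N (X (r n)))) w) \<longlonglongrightarrow> poly (star_poly N (param_poly N x)) w" for w
  proof (rule xlim)
    have "poly (star_poly N (param_poly N x)) w = (\<Sum>k\<le>N. cnj (poly.coeff (param_poly N x) (N - k)) * w ^ k)" for x
      by (simp add: star_poly_def poly_sum poly_monom)
    then show "continuous_on UNIV (\<lambda>x. poly (star_poly N (param_poly N x)) w)"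
      by (simp only:) (intro continuous_intros continuous_coeff_param_poly)
  qed
  have "x \<in> param_domain N"
    unfolding param_domain_def
  proof (intro CollectI conjI ballI allI impI)
    fix i assume i: "i \<ge> 2 * N + 1"
    have "(\<lambda>n. X (r n) i) \<longlonglongrightarrow> x i" by (rule xlim[OF continuous_on_product_coordinates])
    moreover have "X (r n) i = 0" for n using X[of "r n"] i by (simp add: param_domain_def)
    ultimately show "x i = 0" by (simp add: LIMSEQ_const_iff)
  next
    have "(\<lambda>n. X (r n) (2 * N)) \<longlonglongrightarrow> x (2 * N)" by (rule xlim[OF continuous_on_product_coordinates])
    then have "x (2 * N) \<ge> 0" using M1 by (intro LIMSEQ_le_const) (auto intro: less_imp_le)
    moreover have "x (2 * N) \<noteq> 0"
    proof
      assume "x (2 * N) = 0"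
      then have "V = 0" using eq by (simp add: param_wronskian_def)
      then show False using V[of 1] by simp
    qed
    ultimately show "x (2 * N) > 0" by simp
  next
    fix w :: complex assume w: "w \<in> cball 0 1"
    show "poly (star_poly N (param_poly N x)) w \<noteq> 0"
    proof (cases "cmod w < 1")
      case True
      have "cmod (poly (star_poly N (param_poly N (X (r n)))) w) \<ge> (1 - cmod w) ^ N" for n
      proof -
        obtain as where "length as = N" "\<And>a. a \<in> set as \<Longrightarrow> cmod a < 1"
          "star_poly N (param_poly N (X (r n))) = reflected_roots_poly as"
          using param_domain_roots[OF X] by metis
        then show ?thesis using norm_reflected_roots_poly_ge[of as w] True by simp
      qed
      then have "cmod (poly (star_poly N (param_poly N x)) w) \<ge> (1 - cmod w) ^ N"
        by (intro LIMSEQ_le_const[OF tendsto_norm[OF starlim]]) auto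
      moreover have "(1 - cmod w) ^ N > 0" using True by simp
      ultimately show ?thesis by auto
    next
      case False
      then have w1: "cmod w = 1" using w by simp
      show ?thesis
      proof
        assume 0: "poly (star_poly N (param_poly N x)) w = 0"
        \<comment> \<open>On the circle P and P^* vanish together, and their Wronskian with
          them.\<close>
        then have "poly (param_poly N x) w = 0"
          using poly_star_poly_on_circle[of "param_poly N x" N w] w1 by (auto simp: degree_param_poly)
        then have "poly (param_wronskian N x) w = 0"
          using 0 by (simp add: param_wronskian_def wronskian_def)
        then show False using V[OF w1] eq by simp
      qed
    qed
  qed
  then show ?thesis using eq by blast
qed

text \<open>
  Continuity method along the segment from \<open>z\<^sup>N\<close>, the Wronskian of \<open>z\<^bsup>N+1\<^esup>\<close> up to a constant, to
  \<open>Q Q\<^sup>*\<close> with \<open>Q\<close> the polynomial of the prescribed roots: the reachable parameters form an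
  open and closed set.
\<close>

lemma Blaschke_critical_points:
  assumes as: "\<And>a. a \<in> set as \<Longrightarrow> cmod a < 1"
  obtains bs c where "c > 0" "length bs = length as" "\<And>b. b \<in> set bs \<Longrightarrow> cmod b < 1"
    "[:of_real c:] * blaschke_wronskian bs = roots_poly as * reflected_roots_poly as"
proof -
  define N where "N = length as"
  define V where "V = roots_poly as * reflected_roots_poly as"
  define Vt where "Vt = (\<lambda>t::real. [:of_real (1 - t):] * Polynomial.monom 1 N + [:of_real t:] * V)"
  \<comment> \<open>For t in the unit interval this is a convex combination of 1 and |Q|^2, hence
    positive on the circle: the segment acquires no zero there, as
    \<open>param_domain_closed_image\<close> requires.\<close>
  define s where "s = (\<lambda>t z. (1 - t) + t * (cmod (poly (roots_poly as) z))\<^sup>2)"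
  have Vt_circle: "poly (Vt t) z = z ^ N * of_real (s t z)" if "cmod z = 1" for t z
    unfolding Vt_def V_def s_def poly_add poly_mult reflected_roots_poly_on_circle[OF that] of_real_add of_real_mult complex_norm_square
    by (simp add: poly_monom N_def algebra_simps)
  have roots_nz: "poly (roots_poly as) z \<noteq> 0" if "cmod z = 1" for z
    using as that by (force simp: poly_roots_poly_eq_0_iff)
  have s_pos: "s t z > 0" if "t \<in> {0..1}" "cmod z = 1" for t z
  proof (cases "t = 0")
    case False
    then show ?thesis using that roots_nz[OF that(2)] unfolding s_def by (intro add_nonneg_pos) auto
  qed (simp add: s_def)
  have degV: "degree (Vt t) \<le> 2 * N" for t
  proof -
    have "degree V \<le> 2 * N"
      using degree_mult_le[of "roots_poly as" "reflected_roots_poly as"] degree_reflected_roots_poly[of as]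
      by (simp add: V_def N_def degree_roots_poly)
    then have "degree ([:of_real t:] * V) \<le> 2 * N" by (simp add: degree_smult_le[THEN order_trans])
    moreover have "degree ([:of_real (1 - t):] * Polynomial.monom (1::complex) N) \<le> 2 * N"
      using degree_monom_le[of "1::complex" N] by (simp add: degree_smult_le[THEN order_trans])
    ultimately show ?thesis unfolding Vt_def by (intro degree_add_le)
  qed
  have Vt_self: "\<exists>s::real. poly (Vt t) z = z ^ N * of_real s" if "cmod z = 1" for t z
    using Vt_circle[OF that] by blast
  define T where "T = {t\<in>{0..1}. \<exists>x\<in>param_domain N. param_wronskian N x = Vt t}"
  have coeff_cont: "continuous_on UNIV (\<lambda>t. poly.coeff (Vt t) k)" for k
  proof -
    have "poly.coeff (Vt t) k = of_real (1 - t) * poly.coeff (Polynomial.monom 1 N) k + of_real t * poly.coeff V k" for t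
      by (simp add: Vt_def)
    then show ?thesis by (simp only:) (intro continuous_intros)
  qed
  have open_T: "openin (top_of_set {0..1}) T"
  proof -
    obtain O' where O': "open O'" "(\<lambda>x. half_coords N (param_wronskian N x)) ` param_domain N = {x. \<forall>i\<ge>2 * N + 1. x i = 0} \<inter> O'"
      using openin_wronskian_image[of N] unfolding Euclidean_space_eq openin_open by blast
    have "continuous_on UNIV (\<lambda>t. half_coords N (Vt t))"
    proof (rule continuous_on_coordinatewise_then_product)
      fix i
      have "continuous_on UNIV (\<lambda>t. Re (poly.coeff (Vt t) (i div 2)))"
           "continuous_on UNIV (\<lambda>t. Im (poly.coeff (Vt t) (i div 2)))"
        by (intro continuous_intros coeff_cont)+
      then show "continuous_on UNIV (\<lambda>t. half_coords N (Vt t) i)"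
        by (cases "even i"; cases "i < 2 * N + 1") (simp_all add: half_coords_def)
    qed
    then have "open ((\<lambda>t. half_coords N (Vt t)) -` O')"
      using O'(1) by (intro open_vimage)
    moreover have "T = {0..1} \<inter> (\<lambda>t. half_coords N (Vt t)) -` O'"
    proof (intro equalityI subsetI)
      fix t assume "t \<in> T"
      then obtain x where "t \<in> {0..1}" "x \<in> param_domain N" "param_wronskian N x = Vt t" by (auto simp: T_def)
      moreover from this have "half_coords N (Vt t) \<in> (\<lambda>x. half_coords N (param_wronskian N x)) ` param_domain N"
        by (metis imageI)
      ultimately show "t \<in> {0..1} \<inter> (\<lambda>t. half_coords N (Vt t)) -` O'" using O'(2) by auto
    next
      fix t assume t: "t \<in> {0..1} \<inter> (\<lambda>t. half_coords N (Vt t)) -` O'"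
      then have "half_coords N (Vt t) \<in> {x. \<forall>i\<ge>2 * N + 1. x i = 0} \<inter> O'" by (auto simp: half_coords_def)
      then obtain x where x: "x \<in> param_domain N" "half_coords N (param_wronskian N x) = half_coords N (Vt t)"
        using O'(2) by (metis (no_types, lifting) imageE)
      \<comment> \<open>Equal coordinates mean equal polynomials here, since both sides are z^N
        times a real function on the circle.\<close>
      have "param_wronskian N x = Vt t"
        by (rule half_coords_inj[OF param_wronskian_self_inversive[OF x(1)] degV Vt_self x(2)])
      then show "t \<in> T" using t x by (auto simp: T_def)
    qed
    ultimately show ?thesis unfolding openin_open by blast
  qed
  have closed_T: "closedin (top_of_set {0..1}) T"
  proof -
    have "closed T"
      unfolding closed_sequential_limits
    proof (intro allI impI, elim conjE)
      fix ts t assume ts: "\<forall>n. ts n \<in> T" "ts \<longlonglongrightarrow> t"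
      have t01: "ts n \<in> {0..1}" for n using ts(1) by (auto simp: T_def)
      then have t: "t \<in> {0..1}" using ts(2) closed_sequentially[of "{0..1}" ts t] by auto
      have "\<forall>n. \<exists>x. x \<in> param_domain N \<and> param_wronskian N x = Vt (ts n)" using ts(1) by (auto simp: T_def)
      then obtain X where X: "\<And>n. X n \<in> param_domain N" "\<And>n. param_wronskian N (X n) = Vt (ts n)" by metis
      have "compact ((\<lambda>z. (cmod (poly (roots_poly as) z))\<^sup>2) ` sphere 0 1)"
        by (intro compact_continuous_image continuous_intros) auto
      then obtain M0 where M0: "\<And>z. cmod z = 1 \<Longrightarrow> (cmod (poly (roots_poly as) z))\<^sup>2 \<le> M0"
        using compact_imp_bounded bounded_real by (metis (no_types, lifting) abs_le_D1 image_eqI mem_sphere_0)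
      have "\<exists>x\<in>param_domain N. param_wronskian N x = Vt t"
      proof (rule param_domain_closed_image[OF X(1)])
        show "(\<lambda>n. poly.coeff (param_wronskian N (X n)) k) \<longlonglongrightarrow> poly.coeff (Vt t) k" for k
        proof -
          have "isCont (\<lambda>t. poly.coeff (Vt t) k) t" using coeff_cont[of k] by (simp add: continuous_on_eq_continuous_at)
          from isCont_tendsto_compose[OF this ts(2)] show ?thesis by (simp add: X)
        qed
        show "cmod (poly (param_wronskian N (X n)) z) \<le> 1 + M0" if "cmod z = 1" for n z
        proof -
          have "cmod (poly (param_wronskian N (X n)) z) = s (ts n) z"
            unfolding X Vt_circle[OF that] using s_pos[OF t01 that, of n] that by (simp add: norm_mult norm_power)
          also have "\<dots> \<le> 1 + 1 * M0"
            unfolding s_def using t01[of n] M0[OF that] by (intro add_mono mult_mono) auto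
          finally show ?thesis by simp
        qed
        show "poly (Vt t) z \<noteq> 0" if "cmod z = 1" for z
        proof -
          have "z \<noteq> 0" using that by auto
          then show ?thesis using Vt_circle[OF that, of t] s_pos[OF t that] by simp
        qed
      qed
      then show "t \<in> T" using t by (auto simp: T_def)
    qed
    then show ?thesis by (rule closed_subset[rotated]) (auto simp: T_def)
  qed
  have "0 \<in> T"
  proof -
    \<comment> \<open>The Wronskian of z^(N+1) and 1 is (N + 1) z^N; the last coordinate removes the
      factor N + 1.\<close>
    define x where "x = (\<lambda>i. if i = 2 * N then 1 / real (N + 1) else 0)"
    have cc: "complex_coord x j = 0" if "j < N" for j
      using that by (auto simp: complex_coord_def x_def)
    have pp: "param_poly N x = Polynomial.monom 1 N"
      by (rule poly_eqI) (auto simp: coeff_param_poly cc)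
    have st: "star_poly N (Polynomial.monom 1 N) = 1"
      by (rule poly_eqI) (auto simp: coeff_star_poly)
    have "x \<in> param_domain N" by (auto simp: param_domain_def pp st) (auto simp: x_def)
    moreover have "param_wronskian N x = Vt 0"
    proof -
      have "pCons 0 (Polynomial.monom (1::complex) N) = Polynomial.monom 1 (Suc N)" by (simp add: Polynomial.monom_Suc)
      then have "wronskian (pCons 0 (Polynomial.monom 1 N)) 1 = Polynomial.monom (of_nat (Suc N)) N"
        by (simp add: wronskian_def pderiv_monom)
      moreover have "x (2 * N) = 1 / real (N + 1)" by (simp add: x_def)
      ultimately have "param_wronskian N x = [:of_real (1 / real (N + 1)):] * Polynomial.monom (of_nat (Suc N)) N"
        by (simp only: param_wronskian_def pp st)
      also have "\<dots> = Polynomial.monom 1 N" by (simp add: smult_monom del: of_nat_Suc)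
      finally show ?thesis by (simp add: Vt_def)
    qed
    ultimately show ?thesis by (auto simp: T_def)
  qed
  have "connected {0..1::real}" by simp
  then have "T = {0..1}" using connected_clopen open_T closed_T \<open>0 \<in> T\<close> by blast
  then have "1 \<in> T" by simp
  then obtain x where x: "x \<in> param_domain N" "param_wronskian N x = Vt 1" by (auto simp: T_def)
  obtain bs where bs: "length bs = N" "\<And>a. a \<in> set bs \<Longrightarrow> cmod a < 1"
      "param_wronskian N x = [:of_real (x (2 * N)):] * blaschke_wronskian bs"
    using param_domain_wronskian[OF x(1)] by metis
  have "x (2 * N) > 0" using x(1) by (simp add: param_domain_def)
  moreover have "[:of_real (x (2 * N)):] * blaschke_wronskian bs = roots_poly as * reflected_roots_poly as"
    using bs(3) x(2) by (simp add: Vt_def V_def)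
  ultimately show ?thesis using that bs(1,2) N_def by blast
qed

section \<open>Square integrability of the derivative of a bounded function\<close>

text \<open>Prepares Fubini's theorem along chords in direction \<open>u\<close>. Both orders of the
  coordinates occur, one for each direction that enters the Laplacian.\<close>

lemma lborel_complex_eq_distr:
  assumes "(u, v) \<in> {(1, \<i>), (\<i>, 1)}"
  shows "(lborel :: complex measure) = distr (lborel \<Otimes>\<^sub>M lborel) borel (\<lambda>(a, b). of_real a * v + of_real b * u)"
proof (rule lborel_eqI)
  fix l w :: complex
  assume "\<And>b. b \<in> Basis \<Longrightarrow> l \<bullet> b \<le> w \<bullet> b"
  from this[of 1] this[of \<i>] have le: "Re l \<le> Re w" "Im l \<le> Im w"
    by (auto simp: Basis_complex_def inner_complex_def)
  have m: "(\<lambda>(a, b). of_real a * v + of_real b * u) \<in> borel_measurable (lborel \<Otimes>\<^sub>M lborel)" by measurable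
  have "emeasure (distr (lborel \<Otimes>\<^sub>M lborel) borel (\<lambda>(a, b). of_real a * v + of_real b * u)) (box l w)
     = emeasure (lborel \<Otimes>\<^sub>M lborel) ((\<lambda>(a, b). of_real a * v + of_real b * u) -` box l w \<inter> space (lborel \<Otimes>\<^sub>M lborel))"
    by (rule emeasure_distr[OF m]) auto
  also have "(\<lambda>(a, b). of_real a * v + of_real b * u) -` box l w \<inter> space (lborel \<Otimes>\<^sub>M lborel)
     = (if u = 1 then {Im l<..<Im w} \<times> {Re l<..<Re w} else {Re l<..<Re w} \<times> {Im l<..<Im w})"
    using assms by (auto simp: box_def Basis_complex_def inner_complex_def space_pair_measure complex_eq_iff split: if_splits)
  also have "emeasure (lborel \<Otimes>\<^sub>M lborel) \<dots> = ennreal (Re w - Re l) * ennreal (Im w - Im l)"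
    using le assms by (auto simp: lborel.emeasure_pair_measure_Times mult.commute complex_eq_iff)
  also have "\<dots> = ennreal (prod ((\<bullet>) (w - l)) Basis)"
    using le by (simp add: Basis_complex_def inner_complex_def ennreal_mult[symmetric])
  finally show "emeasure (distr (lborel \<Otimes>\<^sub>M lborel) borel (\<lambda>(a, b). of_real a * v + of_real b * u)) (box l w) =
     ennreal (prod ((\<bullet>) (w - l)) Basis)" .
qed simp

text \<open>
  \<open>K\<close> is the derivative of \<open>\<delta> \<partial>|F|\<^sup>2 - \<partial>\<delta> |F|\<^sup>2\<close> along the line in direction \<open>u\<close>, where
  \<open>\<delta> = 1 - |z|\<^sup>2\<close>, so that its integral over a chord is a boundary term.
\<close>

lemma chord_integral_le:
  assumes F: "F holomorphic_on S" "open S" "cball 0 1 \<subseteq> S" and F1: "\<And>z. z \<in> cball 0 1 \<Longrightarrow> cmod (F z) \<le> 1"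
    and uv: "(u, v) \<in> {(1, \<i>), (\<i>, 1)}"
  defines "K \<equiv> (\<lambda>z. (1 - (cmod z)\<^sup>2) * (2 * (Re (u * (u * deriv (deriv F) z) * cnj (F z)) + (cmod (deriv F z))\<^sup>2)) + 2 * (cmod (F z))\<^sup>2)"
  shows "integrable lborel (\<lambda>z. indicator (cball 0 1) z *\<^sub>R K z)"
    "(\<integral>z. indicator (cball 0 1) z *\<^sub>R K z \<partial>lborel) \<le> 8"
proof -
  have dF: "deriv F holomorphic_on S" and ddF: "deriv (deriv F) holomorphic_on S"
    using F by (auto intro!: holomorphic_deriv)
  have contK: "continuous_on S K"
    unfolding K_def by (intro continuous_intros holomorphic_on_imp_continuous_on F dF ddF)
  show int: "integrable lborel (\<lambda>z. indicator (cball 0 1) z *\<^sub>R K z)"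
    by (rule borel_integrable_compact[OF compact_cball continuous_on_subset[OF contK F(3)]])
  define T where "T = (\<lambda>(a, b). of_real a * v + of_real b * u :: complex)"
  have T_meas: "T \<in> borel_measurable (lborel \<Otimes>\<^sub>M lborel)" unfolding T_def by measurable
  have T_norm: "(cmod (T (a, b)))\<^sup>2 = a\<^sup>2 + b\<^sup>2" for a b
    using uv by (auto simp: T_def cmod_power2)
  have nu: "cmod u = 1" using uv by auto
  define f where "f = (\<lambda>p. indicator (cball 0 1) (T p) *\<^sub>R K (T p))"
  have fmeas: "(\<lambda>z. indicator (cball 0 1) z *\<^sub>R K z) \<in> borel_measurable borel"
    using borel_measurable_integrable[OF int] by simp
  have fint: "integrable (lborel \<Otimes>\<^sub>M lborel) f"
    using int unfolding lborel_complex_eq_distr[OF uv] T_def[symmetric] f_def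
    by (subst (asm) integrable_distr_eq[OF T_meas fmeas])
  have "(\<integral>z. indicator (cball 0 1) z *\<^sub>R K z \<partial>lborel) = (\<integral>p. f p \<partial>(lborel \<Otimes>\<^sub>M lborel))"
    unfolding lborel_complex_eq_distr[OF uv] T_def[symmetric] f_def
    by (rule integral_distr[OF T_meas fmeas])
  also have "\<dots> = (\<integral>a. \<integral>b. f (a, b) \<partial>lborel \<partial>lborel)"
    by (rule lborel_pair.integral_fst'[OF fint, symmetric])
  \<comment> \<open>Chords that meet the disc have position \<open>a\<close> between -1 and 1, and
    each contributes at most 4.\<close>
  also have "\<dots> \<le> (\<integral>a. indicator {-1..1::real} a *\<^sub>R 4 \<partial>lborel)"
  proof (rule Bochner_Integration.integral_mono)
    show "integrable lborel (\<lambda>a. \<integral>b. f (a, b) \<partial>lborel)" by (rule lborel_pair.integrable_fst'[OF fint])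
    show "integrable lborel (\<lambda>a::real. indicator {-1..1} a *\<^sub>R (4::real))"
      by (rule borel_integrable_compact) auto
    fix a :: real
    show "(\<integral>b. f (a, b) \<partial>lborel) \<le> indicator {-1..1} a *\<^sub>R 4"
    proof (cases "\<bar>a\<bar> \<le> 1")
      case False
      have "1 < a\<^sup>2" using False by (simp add: abs_square_le_1 flip: not_le)
      then have "1 < (cmod (T (a, b)))\<^sup>2" for b
        using T_norm[of a b] zero_le_power2[of b] by linarith
      then have "T (a, b) \<notin> cball 0 1" for b
        by (metis abs_norm_cancel abs_square_le_1 mem_cball_0 not_le)
      then show ?thesis by (simp add: f_def)
    next
      case True
      \<comment> \<open>Half the length of the chord at position \<open>a\<close>, which is the
        interval from -s to s in the variable \<open>b\<close>.\<close>
      define s where "s = sqrt (1 - a\<^sup>2)"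
      have s: "s \<ge> 0" "s\<^sup>2 = 1 - a\<^sup>2" "s \<le> 1" using True by (auto simp: s_def abs_square_le_1)
      have T_in: "T (a, b) \<in> cball 0 1 \<longleftrightarrow> b \<in> {-s..s}" for b
      proof -
        have "T (a, b) \<in> cball 0 1 \<longleftrightarrow> b\<^sup>2 \<le> s\<^sup>2"
          using T_norm[of a b] s by (auto simp: abs_square_le_1[of "cmod (T (a, b))", simplified, symmetric])
        also have "\<dots> \<longleftrightarrow> \<bar>b\<bar> \<le> s" using s(1) by (simp add: abs_le_square_iff[symmetric])
        also have "\<dots> \<longleftrightarrow> b \<in> {-s..s}" by auto
        finally show ?thesis .
      qed
      define z where "z = (\<lambda>b::real. of_real a * v + u * of_real b)"
      have z: "T (a, b) = z b" for b by (simp add: z_def T_def mult.commute)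
      define P where "P = (\<lambda>b. (1 - a\<^sup>2 - b\<^sup>2) * (2 * Re (u * deriv F (z b) * cnj (F (z b)))) + 2 * b * (cmod (F (z b)))\<^sup>2)"
      have shift: "(g has_real_derivative d) (at b)" if "((\<lambda>t. g (b + t)) has_real_derivative d) (at 0)" for g d and b :: real
        using that DERIV_shift[of g d 0 b] by (simp add: add.commute)
      have D: "(P has_real_derivative K (z b)) (at b)" and C: "isCont (\<lambda>b. K (z b)) b" if b: "b \<in> {-s..s}" for b
      proof -
        have zS: "z b \<in> S" using T_in[of b] b F(3) z by auto
        have zt: "z (b + t) = z b + u * of_real t" for t by (simp add: z_def algebra_simps)
        have 1: "((\<lambda>b. (cmod (F (z b)))\<^sup>2) has_real_derivative 2 * Re (u * deriv F (z b) * cnj (F (z b)))) (at b)"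
          by (rule shift) (unfold zt, rule norm_square_line_derivative[OF F(1,2) zS])
        have hol: "(\<lambda>z. u * deriv F z) holomorphic_on S" by (intro holomorphic_intros dF)
        have du: "deriv (\<lambda>w. u * deriv F w) (z b) = u * deriv (deriv F) (z b)"
          using dF zS F(2) by (intro deriv_cmult) (auto simp: holomorphic_on_open field_differentiable_def)
        have n: "Re (u * deriv F (z b) * cnj (u * deriv F (z b))) = (cmod (deriv F (z b)))\<^sup>2"
          unfolding complex_norm_square[symmetric] by (simp add: norm_mult nu)
        have 2: "((\<lambda>b. Re (u * deriv F (z b) * cnj (F (z b)))) has_real_derivative
          Re (u * (u * deriv (deriv F) (z b)) * cnj (F (z b))) + (cmod (deriv F (z b)))\<^sup>2) (at b)"
          by (rule shift) (unfold zt, use Re_product_line_derivative[OF hol F(1,2) zS, of u, unfolded du n] in assumption)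
        have 3: "(P has_real_derivative (- 2 * b) * (2 * Re (u * deriv F (z b) * cnj (F (z b)))) +
          (2 * (Re (u * (u * deriv (deriv F) (z b)) * cnj (F (z b))) + (cmod (deriv F (z b)))\<^sup>2)) * (1 - a\<^sup>2 - b\<^sup>2)
           + (2 * (cmod (F (z b)))\<^sup>2 + 2 * Re (u * deriv F (z b) * cnj (F (z b))) * (2 * b))) (at b)"
          unfolding P_def
          by (intro DERIV_add DERIV_mult DERIV_cmult 1 2) (auto intro!: derivative_eq_intros)
        have zn: "(cmod (z b))\<^sup>2 = a\<^sup>2 + b\<^sup>2" using T_norm[of a b] z by simp
        have alg: "(- 2 * b) * (2 * r) + 2 * w * (1 - a\<^sup>2 - b\<^sup>2) + (2 * q + 2 * r * (2 * b))
          = (1 - (a\<^sup>2 + b\<^sup>2)) * (2 * w) + 2 * q" for r w q :: real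
          by (simp add: algebra_simps)
        show "(P has_real_derivative K (z b)) (at b)"
          by (rule DERIV_cong[OF 3]) (simp only: K_def zn alg)
        have "isCont K (z b)" using contK F(2) zS by (simp add: continuous_on_eq_continuous_at)
        moreover have "isCont z b" unfolding z_def by (intro continuous_intros)
        ultimately show "isCont (\<lambda>b. K (z b)) b" by (rule isCont_o2[rotated])
      qed
      have "(\<integral>b. f (a, b) \<partial>lborel) = (\<integral>b. K (z b) * indicator {-s..s} b \<partial>lborel)"
        by (rule Bochner_Integration.integral_cong) (auto simp: f_def z[symmetric] T_in indicator_def simp del: mem_cball_0 mem_cball)
      also have "\<dots> = P s - P (- s)"
        by (rule integral_FTC_Icc_real) (use s D C in auto)
      \<comment> \<open>The weight 1 - a^2 - b^2 vanishes at both ends of the chord, so only the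
        terms 2 b |F|^2 remain and no boundary values of F' enter.\<close>
      also have "\<dots> = 2 * s * ((cmod (F (z s)))\<^sup>2 + (cmod (F (z (-s))))\<^sup>2)"
      proof -
        have "1 - a\<^sup>2 - s\<^sup>2 = 0" "1 - a\<^sup>2 - (- s)\<^sup>2 = 0" using s(2) by simp_all
        then show ?thesis by (simp only: P_def) (simp add: algebra_simps)
      qed
      also have "\<dots> \<le> 2 * 1 * (1 + 1)"
      proof -
        have "z s \<in> cball 0 1" "z (-s) \<in> cball 0 1" using T_in[of s] T_in[of "-s"] s(1) by (auto simp: z)
        then have "(cmod (F (z s)))\<^sup>2 \<le> 1" "(cmod (F (z (-s))))\<^sup>2 \<le> 1"
          using F1 by (auto simp: abs_square_le_1)
        then show ?thesis using s by (intro mult_mono add_mono) auto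
      qed
      finally show ?thesis using True by (simp add: indicator_def abs_le_iff)
    qed
  qed
  also have "\<dots> = 8" by simp
  finally show "(\<integral>z. indicator (cball 0 1) z *\<^sub>R K z \<partial>lborel) \<le> 8" .
qed

text \<open>The two chord estimates amount to Green's formula for |F|^2 and 1 - |z|^2. The terms
  with F'' cancel between the directions 1 and \<i>; what is left is four times the integrand plus 4
  |F|^2, and (8 + 8) / 4 = 4.\<close>

lemma Littlewood_Paley_bound:
  assumes F: "F holomorphic_on S" "open S" "cball 0 1 \<subseteq> S" and F1: "\<And>z. z \<in> cball 0 1 \<Longrightarrow> cmod (F z) \<le> 1"
  shows "(\<integral>\<^sup>+z\<in>ball 0 1. ennreal ((cmod (deriv F z))\<^sup>2 * (1 - (cmod z)\<^sup>2)) \<partial>lborel) \<le> 4"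
proof -
  define K where "K = (\<lambda>u z. (1 - (cmod z)\<^sup>2) * (2 * (Re (u * (u * deriv (deriv F) z) * cnj (F z)) + (cmod (deriv F z))\<^sup>2)) + 2 * (cmod (F z))\<^sup>2)"
  have K1: "integrable lborel (\<lambda>z. indicator (cball 0 1) z *\<^sub>R K 1 z)" "(\<integral>z. indicator (cball 0 1) z *\<^sub>R K 1 z \<partial>lborel) \<le> 8"
    unfolding K_def by (rule chord_integral_le[OF F F1, of 1 \<i>]; simp)+
  have K2: "integrable lborel (\<lambda>z. indicator (cball 0 1) z *\<^sub>R K \<i> z)" "(\<integral>z. indicator (cball 0 1) z *\<^sub>R K \<i> z \<partial>lborel) \<le> 8"
    unfolding K_def by (rule chord_integral_le[OF F F1, of \<i> 1]; simp)+
  define g where "g = (\<lambda>z. (indicator (cball 0 1) z *\<^sub>R K 1 z + indicator (cball 0 1) z *\<^sub>R K \<i> z) / 4)"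
  have g: "g z = indicator (cball 0 1) z * ((cmod (deriv F z))\<^sup>2 * (1 - (cmod z)\<^sup>2) + (cmod (F z))\<^sup>2)" for z
    unfolding g_def K_def by (simp add: field_simps indicator_def)
  have g_ge: "indicator (ball 0 1) z * ((cmod (deriv F z))\<^sup>2 * (1 - (cmod z)\<^sup>2)) \<le> g z" "0 \<le> g z" for z
    unfolding g by (auto simp: indicator_def abs_square_le_1 intro!: mult_nonneg_nonneg add_nonneg_nonneg)
  have gint: "integrable lborel g" unfolding g_def using K1 K2 by auto
  have "(\<integral>\<^sup>+z\<in>ball 0 1. ennreal ((cmod (deriv F z))\<^sup>2 * (1 - (cmod z)\<^sup>2)) \<partial>lborel) \<le> (\<integral>\<^sup>+z. ennreal (g z) \<partial>lborel)"
  proof (rule nn_integral_mono)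
    fix z
    show "ennreal ((cmod (deriv F z))\<^sup>2 * (1 - (cmod z)\<^sup>2)) * indicator (ball 0 1) z \<le> ennreal (g z)"
      using g_ge[of z] by (cases "z \<in> ball 0 1") (auto intro!: ennreal_leI)
  qed
  also have "\<dots> = ennreal (\<integral>z. g z \<partial>lborel)"
    by (rule nn_integral_eq_integral[OF gint]) (use g_ge in auto)
  also have "(\<integral>z. g z \<partial>lborel) \<le> 4"
    unfolding g_def using K1 K2 by simp
  finally show ?thesis by (simp add: ennreal_leI order_trans)
qed

section \<open>A holomorphic factor dominating a subsolution\<close>

text \<open>Holomorphy on a larger disc makes the zeros in the unit disc finite in number, and the
  induction removes one zero at a time with its full multiplicity. Zeros on the unit circle remain
  in \<open>g\<close>.\<close>

lemma holomorphic_factor_roots_poly: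
  assumes "\<alpha> holomorphic_on ball 0 R" "R > 1" "\<exists>z\<in>ball 0 R. \<alpha> z \<noteq> 0"
  obtains as g where "\<And>a. a \<in> set as \<Longrightarrow> cmod a < 1" "g holomorphic_on ball 0 R"
    "\<And>z. z \<in> ball 0 1 \<Longrightarrow> g z \<noteq> 0" "\<And>z. z \<in> ball 0 R \<Longrightarrow> \<alpha> z = poly (roots_poly as) z * g z"
proof -
  have "\<exists>as g. (\<forall>a\<in>set as. cmod a < 1) \<and> g holomorphic_on ball 0 R \<and>
     (\<forall>z\<in>ball 0 1. g z \<noteq> 0) \<and> (\<forall>z\<in>ball 0 R. \<alpha> z = poly (roots_poly as) z * g z)"
    using assms(1,3)
  proof (induction "card {z\<in>ball 0 1. \<alpha> z = 0}" arbitrary: \<alpha> rule: less_induct)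
    case less
    show ?case
    proof (cases "\<exists>a\<in>ball 0 1. \<alpha> a = 0")
      case False
      then show ?thesis using less.prems by (intro exI[of _ "[]"] exI[of _ \<alpha>]) auto
    next
      case True
      then obtain a where a: "a \<in> ball 0 1" "\<alpha> a = 0" by blast
      have aR: "a \<in> ball 0 R" using a assms(2) by auto
      have nc: "\<not> \<alpha> constant_on ball 0 R"
        using less.prems(2) a(2) aR unfolding constant_on_def by metis
      have "finite {z\<in>cball 0 1. \<alpha> z = 0}"
        by (rule holomorphic_compact_finite_zeros[OF less.prems(1)]) (use assms(2) nc in auto)
      then have fin: "finite {z\<in>ball 0 1. \<alpha> z = 0}" by (rule rev_finite_subset) auto
      obtain g0 r n where g0: "0 < n"  "0 < r"  "ball a r \<subseteq> ball 0 R" "g0 holomorphic_on ball a r"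
            "\<And>w. w \<in> ball a r \<Longrightarrow> \<alpha> w = (w - a)^n * g0 w" "\<And>w. w \<in> ball a r \<Longrightarrow> g0 w \<noteq> 0"
        using holomorphic_factor_zero_nonconstant[OF less.prems(1) open_ball connected_ball aR a(2) nc] by metis
      \<comment> \<open>The value at \<open>a\<close> is that of the local cofactor
        \<open>g0\<close>, which makes the quotient holomorphic across \<open>a\<close>.\<close>
      define \<beta> where "\<beta> = (\<lambda>w. if w = a then g0 a else \<alpha> w / (w - a)^n)"
      have \<beta>1: "\<beta> holomorphic_on ball a r"
        by (rule holomorphic_transform[OF g0(4)]) (use g0(5) in \<open>auto simp: \<beta>_def\<close>)
      have "(\<lambda>w. \<alpha> w / (w - a)^n) holomorphic_on ball 0 R - {a}"
        by (intro holomorphic_intros holomorphic_on_subset[OF less.prems(1)]) auto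
      then have \<beta>2: "\<beta> holomorphic_on ball 0 R - {a}"
        by (rule holomorphic_transform) (auto simp: \<beta>_def)
      have "\<beta> holomorphic_on (ball a r \<union> (ball 0 R - {a}))"
        by (intro holomorphic_on_Un \<beta>1 \<beta>2) auto
      moreover have "ball a r \<union> (ball 0 R - {a}) = ball 0 R" using g0(2,3) aR by auto
      ultimately have \<beta>: "\<beta> holomorphic_on ball 0 R" by simp
      have \<alpha>\<beta>: "\<alpha> w = (w - a)^n * \<beta> w" for w
        using a(2) g0(1) by (auto simp: \<beta>_def)
      have ga: "g0 a \<noteq> 0" using g0(2,6) by simp
      have sub: "{z\<in>ball 0 1. \<beta> z = 0} \<subset> {z\<in>ball 0 1. \<alpha> z = 0}"
      proof (rule psubsetI)
        show "{z\<in>ball 0 1. \<beta> z = 0} \<subseteq> {z\<in>ball 0 1. \<alpha> z = 0}" using \<alpha>\<beta> by auto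
        have "\<beta> a \<noteq> 0" using ga by (simp add: \<beta>_def)
        then show "{z\<in>ball 0 1. \<beta> z = 0} \<noteq> {z\<in>ball 0 1. \<alpha> z = 0}" using a by blast
      qed
      have "\<exists>z\<in>ball 0 R. \<beta> z \<noteq> 0" using aR ga by (auto simp: \<beta>_def)
      from less.hyps[OF psubset_card_mono[OF fin sub] \<beta> this]
      obtain as g where as: "\<forall>a\<in>set as. cmod a < 1" "g holomorphic_on ball 0 R"
         "\<forall>z\<in>ball 0 1. g z \<noteq> 0" "\<forall>z\<in>ball 0 R. \<beta> z = poly (roots_poly as) z * g z" by blast
      have rp: "poly (roots_poly (replicate n a @ as)) z = (z - a)^n * poly (roots_poly as) z" for z
        by (simp add: roots_poly_def)
      show ?thesis
        by (rule exI[of _ "replicate n a @ as"], rule exI[of _ g]) (use as a \<alpha>\<beta> in \<open>auto simp: rp\<close>)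
    qed
  qed
  then show ?thesis using that by metis
qed

lemma norm_roots_poly_le:
  assumes "\<And>a. a \<in> set as \<Longrightarrow> cmod a < 1" "cmod z \<le> 1"
  shows "cmod (poly (roots_poly as) z) \<le> cmod (poly (reflected_roots_poly as) z)"
  using assms(1)
proof (induction as)
  case (Cons a as)
  have "(1 - (cmod z)\<^sup>2) * (1 - (cmod a)\<^sup>2) \<ge> 0"
    using Cons.prems[of a] assms(2) by (intro mult_nonneg_nonneg) (auto simp: abs_square_le_1)
  then have "(cmod (z - a))\<^sup>2 \<le> (cmod (1 - cnj a * z))\<^sup>2" using norm_blaschke_factor[of a z] by linarith
  then have "cmod (z - a) \<le> cmod (1 - cnj a * z)" by (rule power2_le_imp_le) simp
  then have "cmod (z - a) * cmod (poly (roots_poly as) z) \<le> cmod (1 - cnj a * z) * cmod (poly (reflected_roots_poly as) z)"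
    using Cons by (intro mult_mono) auto
  moreover have "poly (roots_poly (a # as)) z = (z - a) * poly (roots_poly as) z"
    "poly (reflected_roots_poly (a # as)) z = (1 - cnj a * z) * poly (reflected_roots_poly as) z"
    by (simp_all add: algebra_simps)
  ultimately show ?case by (simp add: norm_mult del: roots_poly_simps)
qed simp

text \<open>The logarithm of |f|^2 / (1 - |F|^2)^2 has Laplacian exactly 8 |\<alpha>|^2 times its
  exponential and tends to infinity at the circle, where |F| tends to 1; so it dominates
  \<open>\<phi>\<close>. The zero of \<open>F\<close> at the origin gives |F| <= |z|, which turns
  this into an explicit lower bound for |f|.\<close>

lemma prescribed_critical_points_dominating:
  assumes \<alpha>: "\<alpha> holomorphic_on ball 0 R" "R > 1" "\<exists>z\<in>ball 0 R. \<alpha> z \<noteq> 0"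
    and \<phi>: "continuous_on (cball 0 1) \<phi>"
    and lap: "\<And>z. z \<in> ball 0 1 \<Longrightarrow> \<exists>L\<ge>8 * (cmod (\<alpha> z))\<^sup>2 * exp (\<phi> z). has_laplacian \<phi> L z"
  obtains f where "f holomorphic_on ball 0 1" "\<And>z. z \<in> ball 0 1 \<Longrightarrow> f z \<noteq> 0"
    "\<And>z. z \<in> ball 0 1 \<Longrightarrow> cmod (f z) \<ge> exp (\<phi> z / 2) * (1 - (cmod z)\<^sup>2)"
    "\<And>z. z \<in> ball 0 1 \<Longrightarrow> cmod (\<alpha> z * f z) * (1 - cmod z) \<le> 1"
    "(\<integral>\<^sup>+z\<in>ball 0 1. ennreal ((cmod (\<alpha> z * f z))\<^sup>2 * (1 - (cmod z)\<^sup>2)) \<partial>lborel) \<le> 4"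
proof -
  obtain as g where as: "\<And>a. a \<in> set as \<Longrightarrow> cmod a < 1" and g: "g holomorphic_on ball 0 R"
    "\<And>z. z \<in> ball 0 1 \<Longrightarrow> g z \<noteq> 0" "\<And>z. z \<in> ball 0 R \<Longrightarrow> \<alpha> z = poly (roots_poly as) z * g z"
    using holomorphic_factor_roots_poly[OF \<alpha>] by metis
  obtain bs c where bs: "c > 0" "\<And>b. b \<in> set bs \<Longrightarrow> cmod b < 1"
    "[:of_real c:] * blaschke_wronskian bs = roots_poly as * reflected_roots_poly as"
    using Blaschke_critical_points[OF as] by metis
  define q where "q = poly (reflected_roots_poly bs)"
  define F where "F = (\<lambda>z. z * poly (roots_poly bs) z / q z)"
  \<comment> \<open>Obtained by solving F' = \<alpha> f: F' is the Wronskian of \<open>bs\<close>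
    over q^2, c times that Wronskian is P P^*, and \<alpha> = P g, where P has the roots
    \<open>as\<close>.\<close>
  define f where "f = (\<lambda>z. poly (reflected_roots_poly as) z / (of_real c * g z * (q z)\<^sup>2))"
  have qnz: "q z \<noteq> 0" if "cmod z \<le> 1" for z
    unfolding q_def using reflected_roots_poly_nonzero[OF bs(2) that] .
  define S where "S = {z. q z \<noteq> 0}"
  have S: "open S" "cball 0 1 \<subseteq> S"
  proof -
    have "closed {z. q z = 0}" unfolding q_def by (intro closed_Collect_eq continuous_intros)
    then have "open (- {z. q z = 0})" by (rule open_Compl)
    then show "open S" by (simp add: S_def Compl_eq)
    show "cball 0 1 \<subseteq> S" using qnz by (auto simp: S_def)
  qed
  have F: "F holomorphic_on S" unfolding F_def q_def
    by (intro holomorphic_intros) (auto simp: S_def q_def)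
  have F_le: "cmod (F z) \<le> cmod z" if "cmod z \<le> 1" for z
  proof -
    have "cmod (poly (roots_poly bs) z) / cmod (q z) \<le> 1"
      using norm_roots_poly_le[OF bs(2) that] qnz[OF that] by (simp add: q_def divide_le_eq_1)
    then have "cmod z * (cmod (poly (roots_poly bs) z) / cmod (q z)) \<le> cmod z * 1" by (intro mult_left_mono) auto
    then show ?thesis by (simp add: F_def norm_mult norm_divide)
  qed
  have F_sphere: "cmod (F z) = 1" if "cmod z = 1" for z
  proof -
    have "cmod (q z) = cmod (poly (roots_poly bs) z)"
      unfolding q_def reflected_roots_poly_on_circle[OF that] by (simp add: norm_mult norm_power that)
    then have "cmod (F z) = cmod (q z) / cmod (q z)"
      by (simp only: F_def norm_mult norm_divide that mult_1)
    then show ?thesis using qnz[of z] that by simp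
  qed
  have dF: "deriv F z = \<alpha> z * f z" if "z \<in> ball 0 1" for z
  proof -
    have "deriv F z = poly (blaschke_wronskian bs) z / (q z)\<^sup>2"
      unfolding F_def q_def by (intro DERIV_imp_deriv deriv_blaschke) (use qnz[of z] that in \<open>simp add: q_def\<close>)
    moreover have "of_real c * poly (blaschke_wronskian bs) z = poly (roots_poly as) z * poly (reflected_roots_poly as) z"
      using arg_cong[OF bs(3), of "\<lambda>p. poly p z"] by simp
    then have "poly (blaschke_wronskian bs) z = poly (roots_poly as) z * poly (reflected_roots_poly as) z / of_real c"
      using bs(1) by (simp add: field_simps)
    ultimately show ?thesis
      using that \<alpha>(2) g(2)[OF that] bs(1) qnz[of z] by (simp add: f_def g(3))
  qed
  have f: "f holomorphic_on ball 0 1"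
    unfolding f_def q_def
    by (intro holomorphic_intros holomorphic_on_subset[OF g(1)])
       (use \<alpha>(2) bs(1) g(2) qnz in \<open>auto simp: q_def\<close>)
  have fnz: "f z \<noteq> 0" if "z \<in> ball 0 1" for z
    using reflected_roots_poly_nonzero[OF as, where z = z] g(2)[OF that] qnz[of z] bs(1) that by (simp add: f_def)
  have cball_R: "cball 0 1 \<subseteq> ball (0::complex) R" using \<alpha>(2) by auto
  \<comment> \<open>Only a lower bound is to be had: \<open>g\<close> may vanish on the unit circle,
    and |f| is unbounded near such a point. The numerator of f has no zeros in the closed disc, and
    the denominator is bounded.\<close>
  obtain m where m: "m > 0" "\<And>z. z \<in> ball 0 1 \<Longrightarrow> cmod (f z) \<ge> m"
  proof -
    have "continuous_on (cball 0 1) (\<lambda>z. cmod (poly (reflected_roots_poly as) z))" by (intro continuous_intros)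
    then obtain z1 where z1: "z1 \<in> cball 0 1" "\<And>z. z \<in> cball 0 1 \<Longrightarrow>
       cmod (poly (reflected_roots_poly as) z1) \<le> cmod (poly (reflected_roots_poly as) z)"
      using continuous_attains_inf[of "cball (0::complex) 1" "\<lambda>z. cmod (poly (reflected_roots_poly as) z)"] by auto
    define m1 where "m1 = cmod (poly (reflected_roots_poly as) z1)"
    have m1: "m1 > 0" using reflected_roots_poly_nonzero[OF as, where z = z1] z1(1) by (simp add: m1_def)
    have "continuous_on (cball 0 1) (\<lambda>z. cmod (of_real c * g z * (q z)\<^sup>2))"
      unfolding q_def using continuous_on_subset[OF holomorphic_on_imp_continuous_on[OF g(1)] cball_R]
      by (intro continuous_intros)
    then obtain z2 where z2: "z2 \<in> cball 0 1" "\<And>z. z \<in> cball 0 1 \<Longrightarrow>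
       cmod (of_real c * g z * (q z)\<^sup>2) \<le> cmod (of_real c * g z2 * (q z2)\<^sup>2)"
      using continuous_attains_sup[of "cball (0::complex) 1" "\<lambda>z. cmod (of_real c * g z * (q z)\<^sup>2)"] by auto
    define M2 where "M2 = cmod (of_real c * g z2 * (q z2)\<^sup>2)"
    have M2: "M2 > 0"
    proof -
      have "0 < cmod (of_real c * g 0 * (q 0)\<^sup>2)" using bs(1) g(2)[of 0] qnz[of 0] by simp
      also have "\<dots> \<le> M2" using z2(2)[of 0] by (simp add: M2_def)
      finally show ?thesis .
    qed
    show ?thesis
    proof (rule that[of "m1 / M2"])
      show "m1 / M2 > 0" using m1 M2 by simp
      fix z :: complex assume z: "z \<in> ball 0 1"
      have "0 < cmod (of_real c * g z * (q z)\<^sup>2)" using bs(1) g(2)[OF z] qnz[of z] z by simp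
      then show "m1 / M2 \<le> cmod (f z)"
        unfolding f_def norm_divide using z1(2)[of z] z2(2)[of z] z m1
        by (intro frac_le) (auto simp: m1_def M2_def)
    qed
  qed
  obtain M where M: "\<And>z. z \<in> cball 0 1 \<Longrightarrow> \<phi> z \<le> M"
    using continuous_attains_sup[of "cball (0::complex) 1" \<phi>] \<phi> by (metis cball_eq_empty compact_cball not_one_less_zero)
  define N where "N = (\<lambda>z. 1 - (cmod (F z))\<^sup>2)"
  have N_pos: "N z > 0" and N_ge: "N z \<ge> 1 - (cmod z)\<^sup>2" if "z \<in> ball 0 1" for z
  proof -
    have "(cmod (F z))\<^sup>2 \<le> (cmod z)\<^sup>2" using F_le[of z] that by (intro power_mono) auto
    then show "N z \<ge> 1 - (cmod z)\<^sup>2" by (simp add: N_def)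
    moreover have "1 - (cmod z)\<^sup>2 > 0" using that by (simp add: abs_square_less_1)
    ultimately show "N z > 0" by simp
  qed
  \<comment> \<open>Logarithm of e^\<phi> divided by |f|^2 / (1 - |F|^2)^2. Since \<alpha> has
    cancelled, nothing singular happens at its zeros.\<close>
  define d where "d = (\<lambda>z. (\<phi> z - ln ((cmod (f z))\<^sup>2)) + 2 * ln (N z))"
  have FD: "F holomorphic_on ball 0 1" using F S(2) by (meson ball_subset_cball holomorphic_on_subset order_trans)
  have d_le: "d z \<le> 0" if "z \<in> ball 0 1" for z
  proof (rule maximum_principle[OF _ _ _ that])
    have "continuous_on (ball 0 1) \<phi>" using \<phi> by (rule continuous_on_subset) auto
    moreover have "continuous_on (ball 0 1) f" "continuous_on (ball 0 1) F"
      using f FD by (auto intro: holomorphic_on_imp_continuous_on)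
    moreover have "\<forall>z\<in>ball 0 1. N z \<noteq> 0" using N_pos by force
    ultimately show "continuous_on (ball 0 1) d"
      unfolding d_def N_def using fnz by (intro continuous_intros) (auto simp: N_def)
  next
    fix z :: complex assume z: "z \<in> ball 0 1" and dz: "d z > 0"
    obtain L where L: "L \<ge> 8 * (cmod (\<alpha> z))\<^sup>2 * exp (\<phi> z)" "has_laplacian \<phi> L z" using lap[OF z] by blast
    have F1: "cmod (F z) < 1" using F_le[of z] z by auto
    have "has_laplacian d ((L - 0) + 2 * (- 4 * (cmod (deriv F z))\<^sup>2 / (1 - (cmod (F z))\<^sup>2)\<^sup>2)) z"
      unfolding d_def N_def
      by (intro has_laplacian_add has_laplacian_diff has_laplacian_cmult L(2)
           has_laplacian_ln_norm_square[OF f open_ball z fnz[OF z]] has_laplacian_ln_one_minus[OF FD open_ball z F1])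
    moreover have "(L - 0) + 2 * (- 4 * (cmod (deriv F z))\<^sup>2 / (1 - (cmod (F z))\<^sup>2)\<^sup>2) \<ge> 0"
    proof -
      have "ln ((cmod (f z))\<^sup>2 / (N z)\<^sup>2) = ln ((cmod (f z))\<^sup>2) - 2 * ln (N z)"
        using N_pos[OF z] fnz[OF z] by (simp add: ln_div ln_realpow)
      also have "\<dots> < \<phi> z" using dz by (simp add: d_def)
      finally have "exp (ln ((cmod (f z))\<^sup>2 / (N z)\<^sup>2)) < exp (\<phi> z)" by simp
      then have "(cmod (f z))\<^sup>2 / (N z)\<^sup>2 < exp (\<phi> z)" using N_pos[OF z] fnz[OF z] by (subst (asm) exp_ln) auto
      then have "8 * (cmod (\<alpha> z))\<^sup>2 * ((cmod (f z))\<^sup>2 / (N z)\<^sup>2) \<le> 8 * (cmod (\<alpha> z))\<^sup>2 * exp (\<phi> z)"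
        by (intro mult_left_mono) auto
      then show ?thesis using L(1) unfolding dF[OF z] by (simp add: N_def norm_mult power_mult_distrib)
    qed
    ultimately show "\<exists>L\<ge>0. has_laplacian d L z" by blast
  next
    fix e :: real assume e: "e > 0"
    \<comment> \<open>Chosen so that N < \<epsilon> forces 2 ln N below - (M - ln m^2), which
      outweighs the upper bound M - ln m^2 of the other terms of \<open>d\<close>.\<close>
    define \<epsilon> where "\<epsilon> = exp (- (M - ln (m\<^sup>2)) / 2)"
    have "continuous_on (cball 0 1) N"
      unfolding N_def by (intro continuous_intros continuous_on_subset[OF holomorphic_on_imp_continuous_on[OF F] S(2)])
    from boundary_condition_from_continuity[OF this, of \<epsilon>]
    obtain r where r: "r < 1" "\<And>z. z \<in> ball 0 1 \<Longrightarrow> cmod z > r \<Longrightarrow> N z < \<epsilon>"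
      using F_sphere by (auto simp: N_def \<epsilon>_def)
    have "d z < e" if "z \<in> ball 0 1" "cmod z > r" for z
    proof -
      have "ln (N z) < ln \<epsilon>" using r(2)[OF that] N_pos[OF that(1)] by (subst ln_less_cancel_iff) (auto simp: \<epsilon>_def)
      then have "2 * ln (N z) < - (M - ln (m\<^sup>2))" by (simp add: \<epsilon>_def)
      moreover have "m\<^sup>2 \<le> (cmod (f z))\<^sup>2" using m(2)[OF that(1)] m(1) by (intro power_mono) auto
      then have "ln (m\<^sup>2) \<le> ln ((cmod (f z))\<^sup>2)" using m(1) by (subst ln_le_cancel_iff) (auto intro: less_le_trans)
      moreover have "\<phi> z \<le> M" using M that by auto
      ultimately show ?thesis using e unfolding d_def by linarith
    qed
    then show "\<exists>r<1. \<forall>z\<in>ball 0 1. r < cmod z \<longrightarrow> d z < e" using r(1) by blast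
  qed
  show ?thesis
  proof (rule that[OF f fnz])
    fix z :: complex assume z: "z \<in> ball 0 1"
    have "\<phi> z / 2 \<le> ln (cmod (f z) / N z)"
      using d_le[OF z] N_pos[OF z] fnz[OF z] by (simp add: d_def ln_div ln_realpow)
    then have "exp (\<phi> z / 2) \<le> exp (ln (cmod (f z) / N z))" by simp
    then have "exp (\<phi> z / 2) \<le> cmod (f z) / N z" using N_pos[OF z] fnz[OF z] by simp
    then have "exp (\<phi> z / 2) * N z \<le> cmod (f z)" using N_pos[OF z] by (simp add: field_simps)
    moreover have "exp (\<phi> z / 2) * (1 - (cmod z)\<^sup>2) \<le> exp (\<phi> z / 2) * N z"
      using N_ge[OF z] by (intro mult_left_mono) auto
    ultimately show "exp (\<phi> z / 2) * (1 - (cmod z)\<^sup>2) \<le> cmod (f z)" by linarith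
  next
    fix z :: complex assume z: "z \<in> ball 0 1"
    \<comment> \<open>Radius of the largest disc about \<open>z\<close> in the unit disc; Cauchy's
      estimate on it uses |F| <= 1.\<close>
    define \<rho> where "\<rho> = 1 - cmod z"
    have \<rho>: "\<rho> > 0" using z by (simp add: \<rho>_def)
    have sub: "cball z \<rho> \<subseteq> cball 0 1"
    proof
      fix w assume "w \<in> cball z \<rho>"
      then show "w \<in> cball 0 1" using norm_triangle_ineq2[of w z] by (simp add: \<rho>_def dist_norm norm_minus_commute)
    qed
    have "cmod ((deriv ^^ 1) F z) \<le> fact 1 * 1 / \<rho> ^ 1"
    proof (rule Cauchy_inequality[OF _ _ \<rho>])
      show "F holomorphic_on ball z \<rho>"
        using F sub S(2) by (meson ball_subset_cball holomorphic_on_subset order_trans)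
      show "continuous_on (cball z \<rho>) F"
        using holomorphic_on_imp_continuous_on[OF F] sub S(2) by (meson continuous_on_subset order_trans)
      show "cmod (F x) \<le> 1" if "cmod (z - x) = \<rho>" for x
      proof -
        have "x \<in> cball 0 1" using sub that by (auto simp: dist_norm)
        then show ?thesis using F_le[of x] by simp
      qed
    qed
    then show "cmod (\<alpha> z * f z) * (1 - cmod z) \<le> 1"
      using \<rho> dF[OF z] by (simp add: \<rho>_def[symmetric] field_simps)
  next
    have "(\<integral>\<^sup>+z\<in>ball 0 1. ennreal ((cmod (\<alpha> z * f z))\<^sup>2 * (1 - (cmod z)\<^sup>2)) \<partial>lborel)
      = (\<integral>\<^sup>+z\<in>ball 0 1. ennreal ((cmod (deriv F z))\<^sup>2 * (1 - (cmod z)\<^sup>2)) \<partial>lborel)"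
      by (intro nn_integral_cong) (auto simp: dF indicator_def)
    also have "\<dots> \<le> 4"
      by (rule Littlewood_Paley_bound[OF F S]) (use F_le in \<open>force intro: order_trans\<close>)
    finally show "(\<integral>\<^sup>+z\<in>ball 0 1. ennreal ((cmod (\<alpha> z * f z))\<^sup>2 * (1 - (cmod z)\<^sup>2)) \<partial>lborel) \<le> 4" .
  qed
qed

text \<open>None of the bounds obtained for a radius below 1 involves the number of zeros or the
  boundary behaviour of \<open>\<phi>\<close>, which lets the radius tend to 1. The lower bound on
  |f| is a local upper bound on |1 / f|, so the compactness theorem is applied to the
  reciprocals.\<close>

lemma ex_nonvanishing_square_integrable:
  assumes \<alpha>: "\<alpha> holomorphic_on ball 0 1" "\<exists>z\<in>ball 0 1. \<alpha> z \<noteq> 0"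
    and \<phi>: "continuous_on (ball 0 1) \<phi>"
    and lap: "\<And>z. z \<in> ball 0 1 \<Longrightarrow> \<exists>L\<ge>8 * (cmod (\<alpha> z))\<^sup>2 * exp (\<phi> z). has_laplacian \<phi> L z"
  shows "\<exists>f. f holomorphic_on ball 0 1 \<and> (\<forall>z\<in>ball 0 1. f z \<noteq> 0) \<and>
    (\<integral>\<^sup>+z\<in>ball 0 1. ennreal ((cmod (\<alpha> z * f z))\<^sup>2 * (1 - (cmod z)\<^sup>2)) \<partial>lborel) \<le> 4"
proof -
  define r where "r = (\<lambda>k. 1 - 1 / (real k + 2))"
  have r: "1/2 \<le> r k" "r k < 1" "0 < r k" for k by (auto simp: r_def field_simps)
  have r_lim: "r \<longlonglongrightarrow> 1"
  proof -
    have "(\<lambda>k. 1 / (real k + 2)) \<longlonglongrightarrow> 0" by real_asymp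
    from tendsto_diff[OF tendsto_const[of 1] this] show ?thesis by (simp add: r_def)
  qed
  have rz: "of_real (r k) * z \<in> ball 0 1" if "cmod z \<le> 1" for k and z :: complex
  proof -
    have "r k * cmod z \<le> r k" using that r[of k] by (intro mult_left_le) auto
    moreover have "cmod (of_real (r k) * z) = r k * cmod z" using r[of k] by (simp add: norm_mult)
    ultimately have "cmod (of_real (r k) * z) < 1" using r[of k] by linarith
    then show ?thesis by simp
  qed
  define Q where "Q = (\<lambda>k f. f holomorphic_on ball 0 1 \<and> (\<forall>z\<in>ball 0 1. f z \<noteq> 0) \<and>
    (\<forall>z\<in>ball 0 1. cmod (f z) \<ge> exp ((\<phi> (of_real (r k) * z) + 2 * ln (r k)) / 2) * (1 - (cmod z)\<^sup>2)) \<and>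
    (\<forall>z\<in>ball 0 1. cmod (\<alpha> (of_real (r k) * z) * f z) * (1 - cmod z) \<le> 1) \<and>
    (\<integral>\<^sup>+z\<in>ball 0 1. ennreal ((cmod (\<alpha> (of_real (r k) * z) * f z))\<^sup>2 * (1 - (cmod z)\<^sup>2)) \<partial>lborel) \<le> 4)"
  have Q: "\<exists>f. Q k f" for k
  proof -
    \<comment> \<open>The summand 2 ln r compensates the factor r^2 that scaling brings to the
      Laplacian.\<close>
    define \<psi> where "\<psi> = (\<lambda>z. \<phi> (of_real (r k) * z) + 2 * ln (r k))"
    define \<beta> where "\<beta> = (\<lambda>z. \<alpha> (of_real (r k) * z))"
    have im: "(\<lambda>z. of_real (r k) * z) ` ball 0 (1 / r k) \<subseteq> ball (0::complex) 1"
      using r[of k] by (auto simp: norm_mult field_simps)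
    have 1: "\<beta> holomorphic_on ball 0 (1 / r k)"
      unfolding \<beta>_def
      by (rule holomorphic_on_compose_gen[OF _ \<alpha>(1), unfolded o_def, of "\<lambda>z. of_real (r k) * z"])
         (use im in \<open>auto intro!: holomorphic_intros\<close>)
    have 2: "1 / r k > 1" using r[of k] by simp
    have 3: "\<exists>z\<in>ball 0 (1 / r k). \<beta> z \<noteq> 0"
    proof -
      obtain z where z: "z \<in> ball 0 1" "\<alpha> z \<noteq> 0" using \<alpha>(2) by blast
      have "z / of_real (r k) \<in> ball 0 (1 / r k)" using z(1) r[of k] by (simp add: norm_divide divide_strict_right_mono)
      moreover have "\<beta> (z / of_real (r k)) \<noteq> 0" using z(2) r(3)[of k] by (simp add: \<beta>_def)
      ultimately show ?thesis by blast
    qed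
    have 4: "continuous_on (cball 0 1) \<psi>"
      unfolding \<psi>_def by (intro continuous_intros continuous_on_compose2[OF \<phi>]) (use rz in auto)
    have 5: "\<exists>L\<ge>8 * (cmod (\<beta> z))\<^sup>2 * exp (\<psi> z). has_laplacian \<psi> L z" if "z \<in> ball 0 1" for z
    proof -
      have "of_real (r k) * z \<in> ball 0 1" using that by (intro rz) auto
      from lap[OF this] obtain L where L: "L \<ge> 8 * (cmod (\<alpha> (of_real (r k) * z)))\<^sup>2 * exp (\<phi> (of_real (r k) * z))"
         "has_laplacian \<phi> L (of_real (r k) * z)" by blast
      have "has_laplacian \<psi> ((r k)\<^sup>2 * L + 0) z"
        unfolding \<psi>_def by (intro has_laplacian_add has_laplacian_const has_laplacian_scale L(2) r)
      moreover have "exp (\<psi> z) = (r k)\<^sup>2 * exp (\<phi> (of_real (r k) * z))"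
        using r(3)[of k] by (simp add: \<psi>_def exp_add exp_double)
      then have "8 * (cmod (\<beta> z))\<^sup>2 * exp (\<psi> z) \<le> (r k)\<^sup>2 * L + 0"
        using mult_left_mono[OF L(1), of "(r k)\<^sup>2"] by (simp add: \<beta>_def mult_ac)
      ultimately show ?thesis by blast
    qed
    show ?thesis
    proof (rule prescribed_critical_points_dominating[OF 1 2 3 4 5])
      fix g assume g: "g holomorphic_on ball 0 1" "\<And>z. z \<in> ball 0 1 \<Longrightarrow> g z \<noteq> 0"
        "\<And>z. z \<in> ball 0 1 \<Longrightarrow> cmod (g z) \<ge> exp (\<psi> z / 2) * (1 - (cmod z)\<^sup>2)"
        "\<And>z. z \<in> ball 0 1 \<Longrightarrow> cmod (\<beta> z * g z) * (1 - cmod z) \<le> 1"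
        "(\<integral>\<^sup>+z\<in>ball 0 1. ennreal ((cmod (\<beta> z * g z))\<^sup>2 * (1 - (cmod z)\<^sup>2)) \<partial>lborel) \<le> 4"
      show ?thesis unfolding Q_def
        by (intro exI[of _ g] conjI ballI g[unfolded \<psi>_def \<beta>_def])
    qed
  qed
  then obtain f where fQ: "\<And>k. Q k (f k)" by metis
  have f: "\<And>k. f k holomorphic_on ball 0 1" "\<And>k z. z \<in> ball 0 1 \<Longrightarrow> f k z \<noteq> 0"
    "\<And>k z. z \<in> ball 0 1 \<Longrightarrow> cmod (f k z) \<ge> exp ((\<phi> (of_real (r k) * z) + 2 * ln (r k)) / 2) * (1 - (cmod z)\<^sup>2)"
    "\<And>k z. z \<in> ball 0 1 \<Longrightarrow> cmod (\<alpha> (of_real (r k) * z) * f k z) * (1 - cmod z) \<le> 1"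
    "\<And>k. (\<integral>\<^sup>+z\<in>ball 0 1. ennreal ((cmod (\<alpha> (of_real (r k) * z) * f k z))\<^sup>2 * (1 - (cmod z)\<^sup>2)) \<partial>lborel) \<le> 4"
    using fQ unfolding Q_def by blast+
  define e where "e = (\<lambda>k z. 1 / f k z)"
  have e_hol: "e k holomorphic_on ball 0 1" for k
    unfolding e_def by (intro holomorphic_intros f)
  have e_bound: "\<exists>B. \<forall>h\<in>range e. \<forall>z\<in>K. cmod (h z) \<le> B" if K: "compact K" "K \<subseteq> ball 0 1" for K
  proof -
    obtain \<rho> where \<rho>: "0 < \<rho>" "\<rho> < 1" "K \<subseteq> cball 0 \<rho>"
    proof (cases "K = {}")
      case True
      then show ?thesis using that[of "1/2"] by auto
    next
      case False
      then obtain w where w: "w \<in> K" "\<And>z. z \<in> K \<Longrightarrow> cmod z \<le> cmod w"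
        using continuous_attains_sup[OF K(1) False, of cmod] by (auto intro: continuous_intros)
      have "cmod w < 1" using w K by auto
      then show ?thesis using w(2) by (intro that[of "max (1/2) (cmod w)"]) (auto simp: le_max_iff_disj)
    qed
    have "continuous_on (cball 0 \<rho>) \<phi>" using \<rho> by (intro continuous_on_subset[OF \<phi>]) auto
    then obtain w where w: "\<And>z. z \<in> cball 0 \<rho> \<Longrightarrow> \<phi> w \<le> \<phi> z"
      using continuous_attains_inf[of "cball (0::complex) \<rho>" \<phi>] \<rho> by (metis cball_eq_empty compact_cball not_less_iff_gr_or_eq)
    \<comment> \<open>The factor 1/2 is a lower bound for every \<open>r k\<close>, and
      \<open>\<phi> w\<close> is the minimum of \<open>\<phi>\<close> on the disc of radius \<rho>;
      so \<open>c\<close> does not depend on \<open>k\<close>.\<close>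
    define c where "c = exp (\<phi> w / 2) * (1/2) * (1 - \<rho>\<^sup>2)"
    have c: "c > 0" using \<rho> by (simp add: c_def abs_square_less_1)
    have "cmod (e k z) \<le> 1 / c" if z: "z \<in> K" for k z
    proof -
      have zb: "z \<in> ball 0 1" using z K by auto
      have z\<rho>: "cmod z \<le> \<rho>" using z \<rho> by auto
      have "r k * cmod z \<le> cmod z" using r[of k] by (intro mult_left_le_one_le) auto
      then have "of_real (r k) * z \<in> cball 0 \<rho>" using z\<rho> r[of k] by (simp add: norm_mult)
      then have "\<phi> w \<le> \<phi> (of_real (r k) * z)" by (rule w)
      then have "exp (\<phi> w / 2) * (1/2) \<le> exp (\<phi> (of_real (r k) * z) / 2) * r k"
        using r[of k] by (intro mult_mono) auto
      also have "\<dots> = exp ((\<phi> (of_real (r k) * z) + 2 * ln (r k)) / 2)"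
        using r[of k] by (simp add: add_divide_distrib exp_add)
      finally have "c \<le> exp ((\<phi> (of_real (r k) * z) + 2 * ln (r k)) / 2) * (1 - (cmod z)\<^sup>2)"
        unfolding c_def using z\<rho> \<rho> by (intro mult_mono) (auto intro: power_mono simp: abs_square_le_1)
      also have "\<dots> \<le> cmod (f k z)" by (rule f(3)[OF zb])
      finally show ?thesis using c by (simp add: e_def norm_divide frac_le)
    qed
    then show ?thesis by (intro exI[of _ "1/c"]) auto
  qed
  obtain E s where E: "E holomorphic_on ball 0 1" "strict_mono (s :: nat \<Rightarrow> nat)"
      "\<And>z. z \<in> ball 0 1 \<Longrightarrow> (\<lambda>n. e (s n) z) \<longlonglongrightarrow> E z"
      "\<And>K. compact K \<Longrightarrow> K \<subseteq> ball 0 1 \<Longrightarrow> uniform_limit K (e \<circ> s) E sequentially"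
    by (rule Montel[OF open_ball, of "range e" 0 1 e]) (use e_hol e_bound in auto)
  have rs_lim: "(\<lambda>n. r (s n)) \<longlonglongrightarrow> 1" using LIMSEQ_subseq_LIMSEQ[OF r_lim E(2)] by (simp add: o_def)
  have \<alpha>_lim: "(\<lambda>n. \<alpha> (of_real (r (s n)) * z)) \<longlonglongrightarrow> \<alpha> z" if "z \<in> ball 0 1" for z
  proof -
    have "(\<lambda>n. of_real (r (s n)) * z) \<longlonglongrightarrow> of_real 1 * z" by (intro tendsto_intros rs_lim)
    moreover have "isCont \<alpha> z"
      using holomorphic_on_imp_continuous_on[OF \<alpha>(1)] that by (simp add: continuous_on_eq_continuous_at)
    ultimately show ?thesis using isCont_tendsto_compose[of z \<alpha>] by simp
  qed
  \<comment> \<open>Hurwitz' theorem concerns nonconstant limits; the limit 0 has to be excluded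
    separately. At a point where \<alpha> does not vanish, the bound |\<alpha> f| (1 - |z|) <= 1
    keeps |1 / f| away from 0.\<close>
  have E_nz: "E z \<noteq> 0" if z: "z \<in> ball 0 1" for z
  proof (cases "E constant_on ball 0 1")
    case True
    obtain z0 where z0: "z0 \<in> ball 0 1" "\<alpha> z0 \<noteq> 0" using \<alpha>(2) by blast
    have "cmod (\<alpha> (of_real (r (s n)) * z0)) * (1 - cmod z0) \<le> cmod (e (s n) z0)" for n
      using f(4)[OF z0(1), of "s n"] f(2)[OF z0(1), of "s n"] by (simp add: e_def norm_mult norm_divide field_simps)
    then have "cmod (\<alpha> z0) * (1 - cmod z0) \<le> cmod (E z0)"
      by (intro LIMSEQ_le[OF tendsto_mult[OF tendsto_norm[OF \<alpha>_lim[OF z0(1)]] tendsto_const] tendsto_norm[OF E(3)[OF z0(1)]]]) auto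
    moreover have "cmod (\<alpha> z0) * (1 - cmod z0) > 0" using z0 by auto
    ultimately have "E z0 \<noteq> 0" by auto
    then show ?thesis using True z z0 by (auto simp: constant_on_def)
  next
    case False
    show ?thesis
      by (rule Hurwitz_no_zeros[OF open_ball connected_ball _ E(1) E(4) False _ z])
         (use e_hol f(2) in \<open>auto simp: e_def\<close>)
  qed
  define g where "g = (\<lambda>z. 1 / E z)"
  have g: "g holomorphic_on ball 0 1" unfolding g_def by (intro holomorphic_intros E E_nz)
  have f_lim: "(\<lambda>n. f (s n) z) \<longlonglongrightarrow> g z" if "z \<in> ball 0 1" for z
    using tendsto_divide[OF tendsto_const[of 1] E(3)[OF that] E_nz[OF that]] by (simp add: g_def e_def)
  define u where "u = (\<lambda>n z. ennreal ((cmod (\<alpha> (of_real (r (s n)) * z) * f (s n) z))\<^sup>2 * (1 - (cmod z)\<^sup>2)) * indicator (ball 0 1) z)"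
  have u_meas: "u n \<in> borel_measurable lborel" for n
  proof -
    have "continuous_on (ball 0 1) (\<lambda>z. \<alpha> (of_real (r (s n)) * z))"
      by (rule continuous_on_compose2[OF holomorphic_on_imp_continuous_on[OF \<alpha>(1)]])
         (use rz in \<open>auto intro!: continuous_intros\<close>)
    then have "continuous_on (ball 0 1) (\<lambda>z. (cmod (\<alpha> (of_real (r (s n)) * z) * f (s n) z))\<^sup>2 * (1 - (cmod z)\<^sup>2))"
      using holomorphic_on_imp_continuous_on[OF f(1)[of "s n"]] by (intro continuous_intros)
    then have "(\<lambda>z. indicator (ball 0 1) z *\<^sub>R ((cmod (\<alpha> (of_real (r (s n)) * z) * f (s n) z))\<^sup>2 * (1 - (cmod z)\<^sup>2))) \<in> borel_measurable borel"
      by (intro borel_measurable_continuous_on_indicator) auto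
    then have "(\<lambda>z. ennreal (indicator (ball 0 1) z *\<^sub>R ((cmod (\<alpha> (of_real (r (s n)) * z) * f (s n) z))\<^sup>2 * (1 - (cmod z)\<^sup>2)))) \<in> borel_measurable lborel"
      by simp
    also have "(\<lambda>z. ennreal (indicator (ball 0 1) z *\<^sub>R ((cmod (\<alpha> (of_real (r (s n)) * z) * f (s n) z))\<^sup>2 * (1 - (cmod z)\<^sup>2)))) = u n"
      by (auto simp: u_def indicator_def)
    finally show ?thesis .
  qed
  have "(\<integral>\<^sup>+z\<in>ball 0 1. ennreal ((cmod (\<alpha> z * g z))\<^sup>2 * (1 - (cmod z)\<^sup>2)) \<partial>lborel)
     = (\<integral>\<^sup>+z. liminf (\<lambda>n. u n z) \<partial>lborel)"
  proof (rule nn_integral_cong)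
    fix z :: complex
    show "ennreal ((cmod (\<alpha> z * g z))\<^sup>2 * (1 - (cmod z)\<^sup>2)) * indicator (ball 0 1) z = liminf (\<lambda>n. u n z)"
    proof (cases "z \<in> ball 0 1")
      case True
      have "(\<lambda>n. ennreal ((cmod (\<alpha> (of_real (r (s n)) * z) * f (s n) z))\<^sup>2 * (1 - (cmod z)\<^sup>2)))
         \<longlonglongrightarrow> ennreal ((cmod (\<alpha> z * g z))\<^sup>2 * (1 - (cmod z)\<^sup>2))"
        by (intro tendsto_ennrealI tendsto_mult tendsto_power tendsto_norm \<alpha>_lim f_lim tendsto_const True)
      from lim_imp_Liminf[OF _ this] show ?thesis using True by (simp add: u_def)
    next
      case False
      then show ?thesis by (simp add: u_def Liminf_const)
    qed
  qed
  also have "\<dots> \<le> liminf (\<lambda>n. \<integral>\<^sup>+z. u n z \<partial>lborel)" by (rule nn_integral_liminf[OF u_meas])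
  also have "\<dots> \<le> liminf (\<lambda>n::nat. 4)" by (intro Liminf_mono always_eventually allI) (use f(5) in \<open>simp add: u_def\<close>)
  also have "\<dots> = 4" by (simp add: Liminf_const)
  finally show ?thesis using g E_nz by (intro exI[of _ g]) (auto simp: g_def)
qed

section \<open>Smoothness in the sense of Wirtinger derivatives\<close>

text \<open>Derivatives at a point of an open set depend on nearby values only. The formulas for
  \<open>deriv_x\<close> and \<open>deriv_y\<close> found below hold on \<open>S\<close> and not
  beyond, so they are substituted through this lemma.\<close>

lemma Ck_on_cong:
  assumes "open S" "\<And>z. z \<in> S \<Longrightarrow> f z = g z"
  shows "Ck_on k S f \<longleftrightarrow> Ck_on k S g"
proof -
  have imp: "Ck_on k S g" if "Ck_on k S f" "\<And>z. z \<in> S \<Longrightarrow> f z = g z" for f g :: "complex \<Rightarrow> 'b::real_normed_vector"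
    using that
  proof (induction k arbitrary: f g)
    case 0
    then show ?case by (metis Ck_on.simps(1) continuous_on_cong)
  next
    case (Suc k)
    have d: "(g has_derivative frechet_derivative f (at z)) (at z)" if "z \<in> S" for z
    proof -
      have "(f has_derivative frechet_derivative f (at z)) (at z)"
        using Suc.prems(1) that by (simp add: frechet_derivative_works[symmetric])
      then show ?thesis
        by (rule has_derivative_transform_within_open[OF _ assms(1) that]) (use Suc.prems in auto)
    qed
    have e: "frechet_derivative g (at z) = frechet_derivative f (at z)" if "z \<in> S" for z
      using frechet_derivative_at[OF d[OF that]] by simp
    have "Ck_on k S (deriv_x g)"
      by (rule Suc.IH[of "deriv_x f"]) (use Suc.prems(1) in simp, simp add: deriv_x_def e)
    moreover have "Ck_on k S (deriv_y g)"
      by (rule Suc.IH[of "deriv_y f"]) (use Suc.prems(1) in simp, simp add: deriv_y_def e)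
    ultimately show ?case using d by (auto simp: differentiable_def)
  qed
  show ?thesis using imp[of f g] imp[of g f] assms(2) by auto
qed

lemma Ck_on_add:
  assumes "open S" "Ck_on k S f" "Ck_on k S g"
  shows "Ck_on k S (\<lambda>z. f z + g z)"
  using assms(2,3)
proof (induction k arbitrary: f g)
  case (Suc k)
  have p: "frechet_derivative (\<lambda>z. f z + g z) (at z) = (\<lambda>v. frechet_derivative f (at z) v + frechet_derivative g (at z) v)"
    if "z \<in> S" for z
    using Suc.prems that
    by (intro frechet_derivative_at[symmetric] has_derivative_add) (auto simp: frechet_derivative_works[symmetric])
  have "Ck_on k S (\<lambda>z. deriv_x f z + deriv_x g z)" "Ck_on k S (\<lambda>z. deriv_y f z + deriv_y g z)"
    using Suc by auto
  then have "Ck_on k S (deriv_x (\<lambda>z. f z + g z))" "Ck_on k S (deriv_y (\<lambda>z. f z + g z))"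
    by (simp_all add: Ck_on_cong[OF assms(1), of "deriv_x (\<lambda>z. f z + g z)" "\<lambda>z. deriv_x f z + deriv_x g z"]
        Ck_on_cong[OF assms(1), of "deriv_y (\<lambda>z. f z + g z)" "\<lambda>z. deriv_y f z + deriv_y g z"] deriv_x_def deriv_y_def p)
  then show ?case using Suc.prems by auto
qed (auto intro: continuous_on_add)

text \<open>Up to sums, the functions Re (G cnj H) with holomorphic G and H are closed under both
  partial derivatives, whereas the functions |G|^2 are not; hence the polarized form for the
  induction.\<close>

lemma Ck_on_Re_product:
  assumes "open S" "G holomorphic_on S" "H holomorphic_on S"
  shows "Ck_on k S (\<lambda>z. Re (G z * cnj (H z)))"
  using assms(2,3)
proof (induction k arbitrary: G H)
  case 0
  then show ?case by (auto intro!: continuous_intros holomorphic_on_imp_continuous_on)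
next
  case (Suc k)
  have d: "((\<lambda>z. Re (G z * cnj (H z))) has_derivative
     (\<lambda>v. Re (v * deriv G z * cnj (H z)) + Re (G z * cnj (v * deriv H z)))) (at z)" if "z \<in> S" for z
  proof -
    have G: "(G has_derivative (\<lambda>v. deriv G z * v)) (at z)" and H: "(H has_derivative (\<lambda>v. deriv H z * v)) (at z)"
      using holomorphic_derivI[OF Suc.prems(1) assms(1) that] holomorphic_derivI[OF Suc.prems(2) assms(1) that]
      by (auto simp: has_field_derivative_def)
    note Hc = bounded_linear.has_derivative[OF bounded_linear_cnj H]
    note bounded_linear.has_derivative[OF bounded_linear_Re has_derivative_mult[OF G Hc]]
    then show ?thesis by (rule has_derivative_eq_rhs) (simp add: fun_eq_iff algebra_simps)
  qed
  have fd: "frechet_derivative (\<lambda>z. Re (G z * cnj (H z))) (at z) =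
     (\<lambda>v. Re (v * deriv G z * cnj (H z)) + Re (G z * cnj (v * deriv H z)))" if "z \<in> S" for z
    using frechet_derivative_at[OF d[OF that]] by simp
  have hol: "deriv G holomorphic_on S" "deriv H holomorphic_on S"
    using Suc.prems assms(1) by (auto intro: holomorphic_deriv)
  have main: "Ck_on k S (\<lambda>z. Re ((v * deriv G z) * cnj (H z)) + Re (G z * cnj (v * deriv H z)))" for v
    by (intro Ck_on_add[OF assms(1)] Suc.IH holomorphic_intros hol Suc.prems)
  have x: "deriv_x (\<lambda>z. Re (G z * cnj (H z))) z = Re ((1 * deriv G z) * cnj (H z)) + Re (G z * cnj (1 * deriv H z))"
    and y: "deriv_y (\<lambda>z. Re (G z * cnj (H z))) z = Re ((\<i> * deriv G z) * cnj (H z)) + Re (G z * cnj (\<i> * deriv H z))"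
    if "z \<in> S" for z
    unfolding deriv_x_def deriv_y_def fd[OF that] by (rule refl)+
  have "Ck_on k S (deriv_x (\<lambda>z. Re (G z * cnj (H z))))"
    by (rule Ck_on_cong[OF assms(1) x, THEN iffD2, OF _ main])
  moreover have "Ck_on k S (deriv_y (\<lambda>z. Re (G z * cnj (H z))))"
    by (rule Ck_on_cong[OF assms(1) y, THEN iffD2, OF _ main])
  ultimately show ?case using d by (auto simp: differentiable_def)
qed

lemma smooth_on_norm_square:
  assumes "open S" "G holomorphic_on S"
  shows "smooth_on S (\<lambda>z. (cmod (G z))\<^sup>2)"
proof -
  have "(\<lambda>z. (cmod (G z))\<^sup>2) = (\<lambda>z. Re (G z * cnj (G z)))"
    by (simp add: complex_norm_square[symmetric])
  then show ?thesis using Ck_on_Re_product[OF assms assms(2)] by (simp add: smooth_on_def)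
qed

lemma deriv_xy_const [simp]: "deriv_x (\<lambda>z. c) = (\<lambda>z. 0)" "deriv_y (\<lambda>z. c) = (\<lambda>z. 0)"
  by (simp_all add: deriv_x_def deriv_y_def fun_eq_iff)

lemma smooth_on_const: "smooth_on S (\<lambda>z. c)"
proof -
  have "Ck_on k S (\<lambda>z. c)" for k by (induction k arbitrary: c) auto
  then show ?thesis by (simp add: smooth_on_def)
qed

lemma wirtinger_const [simp]: "wirtinger_z (\<lambda>w. c) z = 0" "wirtinger_zbar (\<lambda>w. c) z = 0"
  by (simp_all add: wirtinger_z_def wirtinger_zbar_def)

lemma smooth_on_differentiable: "smooth_on S f \<Longrightarrow> z \<in> S \<Longrightarrow> f differentiable (at z)"
  unfolding smooth_on_def by (drule spec[of _ 1]) simp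

lemma wirtinger_zbar_cong:
  assumes "open S" "z \<in> S" "\<And>w. w \<in> S \<Longrightarrow> f w = g w" "f differentiable (at z)"
  shows "wirtinger_zbar g z = wirtinger_zbar f z"
proof -
  have "(f has_derivative frechet_derivative f (at z)) (at z)"
    using assms(4) by (simp add: frechet_derivative_works[symmetric])
  then have "(g has_derivative frechet_derivative f (at z)) (at z)"
    by (rule has_derivative_transform_within_open[OF _ assms(1,2)]) (use assms(3) in auto)
  from frechet_derivative_at[OF this] show ?thesis
    by (simp add: wirtinger_zbar_def deriv_x_def deriv_y_def)
qed

lemma differentiable_line_derivative:
  fixes f :: "complex \<Rightarrow> 'b::real_normed_vector"
  assumes "f differentiable (at w)"
  shows "((\<lambda>t. f (w + u * of_real t)) has_vector_derivative frechet_derivative f (at w) u) (at (0::real))"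
proof -
  have f: "(f has_derivative frechet_derivative f (at w)) (at (w + u * of_real 0))"
    using assms by (simp add: frechet_derivative_works[symmetric])
  from has_derivative_compose[OF line_has_vector_derivative[of w u, unfolded has_vector_derivative_def] f]
  have "((\<lambda>t. f (w + u * of_real t)) has_derivative (\<lambda>t. frechet_derivative f (at w) (t *\<^sub>R u))) (at 0)" .
  then show ?thesis
    unfolding has_vector_derivative_def linear_cmul[OF linear_frechet_derivative[OF assms]] .
qed

text \<open>For real positive H the equation says that B is the Wirtinger derivative of ln H, so the
  partial derivatives of ln H are 2 Re B and - 2 Im B. Differentiated in the directions 1 and \<i>,
  these add up to 4 Re of \<open>wirtinger_zbar B\<close>.\<close>

lemma has_laplacian_ln_of_wirtinger:
  fixes H B :: "complex \<Rightarrow> complex"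
  assumes X: "open X" "z \<in> X"
    and H: "\<And>w. w \<in> X \<Longrightarrow> H differentiable (at w)" "\<And>w. w \<in> X \<Longrightarrow> Im (H w) = 0" "\<And>w. w \<in> X \<Longrightarrow> Re (H w) > 0"
    and B: "B differentiable (at z)" "\<And>w. w \<in> X \<Longrightarrow> wirtinger_z H w = B w * H w"
  shows "has_laplacian (\<lambda>w. ln (Re (H w))) (4 * Re (wirtinger_zbar B z)) z"
proof -
  have evX: "\<forall>\<^sub>F v in nhds w. v \<in> X" if "w \<in> X" for w using eventually_nhds_in_open[OF X(1) that] .
  have dr: "((\<lambda>t. Re (f (w + u * of_real t))) has_real_derivative Re (frechet_derivative f (at w) u)) (at 0)"
    and di: "((\<lambda>t. Im (f (w + u * of_real t))) has_real_derivative Im (frechet_derivative f (at w) u)) (at 0)"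
    if "f differentiable (at w)" for f :: "complex \<Rightarrow> complex" and w u
    using bounded_linear.has_vector_derivative[OF bounded_linear_Re differentiable_line_derivative[OF that]]
      bounded_linear.has_vector_derivative[OF bounded_linear_Im differentiable_line_derivative[OF that]]
    by (simp_all add: has_real_derivative_iff_has_vector_derivative)
  \<comment> \<open>The partial derivatives of H are real because H is; this lets the real and
    imaginary parts of the equation for B be separated.\<close>
  have Im0: "Im (frechet_derivative H (at w) u) = 0" if w: "w \<in> X" for w u
  proof -
    have "\<forall>\<^sub>F t in nhds 0. Im (H (w + u * of_real t)) = 0"
      using eventually_line[OF evX[OF w], of u] by eventually_elim (rule H)
    then have "((\<lambda>t. 0::real) has_real_derivative Im (frechet_derivative H (at w) u)) (at 0)"
      using di[OF H(1)[OF w], of u] by (rule DERIV_cong_ev[OF refl _ refl, THEN iffD1])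
    from DERIV_unique[OF this DERIV_const] show ?thesis .
  qed
  have BH: "Re (frechet_derivative H (at w) 1) = 2 * Re (B w) * Re (H w)"
    "Re (frechet_derivative H (at w) \<i>) = - 2 * Im (B w) * Re (H w)" if w: "w \<in> X" for w
  proof -
    have "frechet_derivative H (at w) 1 - \<i> * frechet_derivative H (at w) \<i> = 2 * (B w * H w)"
      using B(2)[OF w] by (simp add: wirtinger_z_def deriv_x_def deriv_y_def field_simps)
    then show "Re (frechet_derivative H (at w) 1) = 2 * Re (B w) * Re (H w)"
      "Re (frechet_derivative H (at w) \<i>) = - 2 * Im (B w) * Re (H w)"
      using Im0[OF w, of 1] Im0[OF w, of \<i>] H(2)[OF w] by (auto simp: complex_eq_iff)
  qed
  have D: "((\<lambda>t. ln (Re (H (w + u * of_real t)))) has_real_derivative Re (frechet_derivative H (at w) u) / Re (H w)) (at 0)"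
    if "w \<in> X" for w u
    using ln_line_derivative[OF dr[OF H(1)[OF that], of u]] H(3)[OF that] by simp
  show ?thesis
    unfolding has_laplacian_def
  proof (intro exI conjI)
    show "4 * Re (wirtinger_zbar B z) = 2 * Re (frechet_derivative B (at z) 1) + - 2 * Im (frechet_derivative B (at z) \<i>)"
      by (simp add: wirtinger_zbar_def deriv_x_def deriv_y_def)
    show "\<forall>\<^sub>F w in nhds z. ((\<lambda>t. ln (Re (H (w + 1 * of_real t)))) has_real_derivative 2 * Re (B w)) (at 0)"
      using evX[OF X(2)]
    proof eventually_elim
      case (elim w)
      show ?case using D[OF elim, of 1] H(3)[OF elim] by (simp add: BH[OF elim])
    qed
    show "\<forall>\<^sub>F w in nhds z. ((\<lambda>t. ln (Re (H (w + \<i> * of_real t)))) has_real_derivative - 2 * Im (B w)) (at 0)"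
      using evX[OF X(2)]
    proof eventually_elim
      case (elim w)
      show ?case using D[OF elim, of \<i>] H(3)[OF elim] by (simp add: BH[OF elim])
    qed
  qed (intro DERIV_cmult dr di B)+
qed

section \<open>Components with respect to an orthogonal frame\<close>

lemma hermitian_zero:
  assumes "hermitian_metric n X h" "z \<in> X" "v \<in> carrier_vec n"
  shows "h z (0\<^sub>v n) v = 0" "h z v (0\<^sub>v n) = 0"
proof -
  have "h z (0 \<cdot>\<^sub>v 0\<^sub>v n) v = 0 * h z (0\<^sub>v n) v"
    using assms unfolding hermitian_metric_def by (meson zero_carrier_vec)
  moreover have "0 \<cdot>\<^sub>v 0\<^sub>v n = (0\<^sub>v n :: complex Matrix.vec)" by auto
  ultimately show 1: "h z (0\<^sub>v n) v = 0" by simp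
  have "h z v (0\<^sub>v n) = cnj (h z (0\<^sub>v n) v)"
    using assms unfolding hermitian_metric_def by (meson zero_carrier_vec)
  then show "h z v (0\<^sub>v n) = 0" using 1 by simp
qed

lemma frame_carrier [simp]: "frame n i \<in> carrier_vec n"
  by (simp add: frame_def)

text \<open>Additivity is stated for two vectors, so the components of \<open>v\<close> are added
  one at a time, by induction over truncations of \<open>v\<close>; orthogonality keeps only one of
  them.\<close>

lemma diagonal_metric_component:
  assumes h: "hermitian_metric n X h" and d: "diagonal_metric n X h" and z: "z \<in> X"
    and i: "i \<in> {1..n}" and v: "v \<in> carrier_vec n"
  shows "h z v (frame n i) = vec_index v (i - 1) * h z (frame n i) (frame n i)"
proof -
  have add: "h z (u + w) (frame n i) = h z u (frame n i) + h z w (frame n i)"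
    if "u \<in> carrier_vec n" "w \<in> carrier_vec n" for u w
    using h z that unfolding hermitian_metric_def by (meson frame_carrier)
  have mult: "h z (c \<cdot>\<^sub>v u) (frame n i) = c * h z u (frame n i)" if "u \<in> carrier_vec n" for c u
    using h z that unfolding hermitian_metric_def by (meson frame_carrier)
  have "h z (Matrix.vec n (\<lambda>k. if k < m then vec_index v k else 0)) (frame n i)
      = (if i - 1 < m then vec_index v (i - 1) * h z (frame n i) (frame n i) else 0)" if "m \<le> n" for m
    using that
  proof (induction m)
    case 0
    have "Matrix.vec n (\<lambda>k. if k < 0 then vec_index v k else 0) = 0\<^sub>v n" by auto
    then show ?case using hermitian_zero[OF h z, of "frame n i"] by simp
  next
    case (Suc m)
    have e: "Matrix.vec n (\<lambda>k. if k < Suc m then vec_index v k else 0) =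
        Matrix.vec n (\<lambda>k. if k < m then vec_index v k else 0) + vec_index v m \<cdot>\<^sub>v frame n (Suc m)"
      by (rule eq_vecI) (auto simp: frame_def less_Suc_eq unit_vec_def)
    have "h z (frame n (Suc m)) (frame n i) = 0" if "i - 1 \<noteq> m"
      using d z i that Suc.prems unfolding diagonal_metric_def by auto
    moreover have "Suc m = i" if "i - 1 = m" using that i by auto
    ultimately show ?case
      unfolding e using Suc by (subst add) (auto simp: mult)
  qed
  from this[of n] have "h z (Matrix.vec n (\<lambda>k. if k < n then vec_index v k else 0)) (frame n i) =
     vec_index v (i - 1) * h z (frame n i) (frame n i)" using i by auto
  moreover have "Matrix.vec n (\<lambda>k. if k < n then vec_index v k else 0) = v" using v by auto
  ultimately show ?thesis by simp
qed

lemma mult_mat_frame: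
  assumes "M \<in> carrier_mat n n" "i \<in> {1..n}" "j < n"
  shows "vec_index (M *\<^sub>v frame n i) j = M $$ (j, i - 1)"
  using assms by (auto simp: frame_def)

section \<open>The harmonic metric equation\<close>

text \<open>Summation by parts with the weights w_i = i (n - i): the numbers 2 j - n - 1 are the
  differences w_(j-1) - w_j, and the boundary term vanishes for m = n - 1.\<close>

lemma sum_second_difference:
  fixes d :: "nat \<Rightarrow> real"
  assumes "m \<le> n"
  shows "(\<Sum>i=1..m. real i * real (n - i) * (d (Suc i) - d i)) =
     (\<Sum>j=1..Suc m. (2 * real j - real n - 1) * d j) + (real m + 1) * (real n - real m - 1) * d (Suc m)"
  using assms
proof (induction m)
  case 0
  then show ?case by (simp add: algebra_simps)
next
  case (Suc m)
  then show ?case by (simp add: of_nat_diff algebra_simps)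
qed

text \<open>The second summation by parts. The coefficients now grow by the constant 2, which turns
  the weighted sum of the Toda terms into a multiple of the plain sum.\<close>

lemma sum_by_parts_linear:
  fixes w :: "nat \<Rightarrow> real"
  shows "(\<Sum>j=1..Suc m. (2 * real j - real n - 1) * (w (j - 1) - w j)) =
     2 * (\<Sum>j=1..Suc m. w j) - (2 * real m - real n + 3) * w (Suc m) + (1 - real n) * w 0"
  by (induction m) (simp_all add: algebra_simps)

lemma sum_weights:
  fixes n :: nat
  assumes "n \<ge> 1"
  shows "(\<Sum>i=1..n-1. i * (n - i)) = n * (n\<^sup>2 - 1) div 6"
proof -
  \<comment> \<open>The upper limit is kept independent of \<open>n\<close> for the induction, and
    integers avoid truncated subtraction.\<close>
  have "6 * (\<Sum>i=1..m. int i * (int n - int i)) = int m * (int m + 1) * (3 * int n - 2 * int m - 1)" for m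
    by (induction m) (simp_all add: algebra_simps)
  from this[of "n - 1"] have "6 * (\<Sum>i=1..n-1. int i * (int n - int i)) = int n * ((int n)\<^sup>2 - 1)"
    using assms by (simp add: of_nat_diff algebra_simps power2_eq_square)
  moreover have "int (\<Sum>i=1..n-1. i * (n - i)) = (\<Sum>i=1..n-1. int i * (int n - int i))"
    unfolding of_nat_sum by (intro sum.cong) (auto simp: of_nat_diff)
  moreover have "int (n\<^sup>2 - 1) = (int n)\<^sup>2 - 1" using assms by (simp add: of_nat_diff)
  ultimately have "int (6 * (\<Sum>i=1..n-1. i * (n - i))) = int (n * (n\<^sup>2 - 1))" by simp
  then have "6 * (\<Sum>i=1..n-1. i * (n - i)) = n * (n\<^sup>2 - 1)" by (simp only: of_nat_eq_iff)
  then show ?thesis by simp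
qed

lemma frame_index: "i \<in> {1..n} \<Longrightarrow> k < n \<Longrightarrow> vec_index (frame n i) k = (if k = i - 1 then 1 else 0)"
  by (auto simp: frame_def)

text \<open>The constant section e_i is holomorphic, so its curvature is - delbar (A e_i), and the
  i-th component of the harmonic equation reads delbar A_ii = \<omega>_(i-1) - \<omega>_i. Metric
  compatibility makes A_ii the Wirtinger derivative of ln H_i. The value 0 of
  \<open>\<omega>\<close> at the indices 0 and n covers both ends of the chain.\<close>

lemma diagonal_harmonic_metric_equation:
  fixes X :: "complex set"
  assumes X: "open X" and harm: "harmonic_metric n X \<Theta> h" and diag: "diagonal_metric n X h"
    and \<Theta>: "\<And>z. z \<in> X \<Longrightarrow> \<Theta> z \<in> carrier_mat n n"
    and \<Theta>e: "\<And>z i. z \<in> X \<Longrightarrow> i \<in> {1..n-1} \<Longrightarrow> \<Theta> z *\<^sub>v frame n i = \<gamma> i z \<cdot>\<^sub>v frame n (i + 1)"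
    and \<Theta>n: "\<And>z. z \<in> X \<Longrightarrow> \<Theta> z *\<^sub>v frame n n = 0\<^sub>v n"
    and z: "z \<in> X" and i: "i \<in> {1..n}"
  defines "H \<equiv> (\<lambda>i w. h w (frame n i) (frame n i))"
  defines "\<omega> \<equiv> (\<lambda>i z. if 1 \<le> i \<and> i < n then (cmod (\<gamma> i z))\<^sup>2 * (Re (H (Suc i) z) / Re (H i z)) else 0)"
  shows "has_laplacian (\<lambda>w. ln (Re (H i w))) (4 * (\<omega> (i - 1) z - \<omega> i z)) z"
proof -
  have herm: "hermitian_metric n X h" using harm by (simp add: harmonic_metric_def)
  obtain A \<Theta>' where chern: "chern_connection n X h A" and adj: "metric_adjoint n X h \<Theta> \<Theta>'"
    and curv: "\<And>s z. smooth_section n X s \<Longrightarrow> z \<in> X \<Longrightarrow>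
       curvature n A s z + (\<Theta> z * \<Theta>' z - \<Theta>' z * \<Theta> z) *\<^sub>v s z = 0\<^sub>v n"
    using harm unfolding harmonic_metric_def by blast
  have i1: "i - 1 < n" using i by auto
  have Acar: "A w \<in> carrier_mat n n" if "w \<in> X" for w
    using chern that by (auto simp: chern_connection_def smooth_mat_def)
  have Adiff: "(\<lambda>z. A z $$ (j, k)) differentiable (at w)" if "w \<in> X" "j < n" "k < n" for w j k
    using chern that by (auto simp: chern_connection_def smooth_mat_def intro!: smooth_on_differentiable)
  have cnj_sym: "h w v u = cnj (h w u v)" if "w \<in> X" "u \<in> carrier_vec n" "v \<in> carrier_vec n" for w u v
    using herm that unfolding hermitian_metric_def by meson
  have Hpos: "Re (H j w) > 0" if "w \<in> X" "j \<in> {1..n}" for w j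
  proof -
    have "j - 1 < n" using that by auto
    then have "vec_index (frame n j) (j - 1) \<noteq> vec_index (0\<^sub>v n) (j - 1)"
      using frame_index[OF that(2)] by simp
    then have "frame n j \<noteq> 0\<^sub>v n" by metis
    then show ?thesis using herm that unfolding hermitian_metric_def H_def by (meson frame_carrier)
  qed
  have HIm: "Im (H j w) = 0" if "w \<in> X" for w j
    using arg_cong[OF cnj_sym[OF that frame_carrier frame_carrier, of j j], of Im] by (simp add: H_def)
  have Hdiff: "H j differentiable (at w)" if "w \<in> X" "j \<in> {1..n}" for w j
    using herm that unfolding hermitian_metric_def H_def by (intro smooth_on_differentiable[of X]) auto
  have comp: "h w v (frame n j) = vec_index v (j - 1) * H j w"
    if "w \<in> X" "v \<in> carrier_vec n" "j \<in> {1..n}" for w v j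
    unfolding H_def by (rule diagonal_metric_component[OF herm diag that(1,3,2)])
  have comp_mult: "h w (M *\<^sub>v frame n k) (frame n j) = M $$ (j - 1, k - 1) * H j w"
    if "w \<in> X" "M \<in> carrier_mat n n" "j \<in> {1..n}" "k \<in> {1..n}" for w M j k
  proof -
    have "j - 1 < n" using that by auto
    from comp[OF that(1) mult_mat_vec_carrier[OF that(2) frame_carrier] that(3), of k]
    show ?thesis unfolding mult_mat_frame[OF that(2,4) \<open>j - 1 < n\<close>] .
  qed
  have sec: "smooth_section n X (\<lambda>_. frame n j)" for j
    by (auto simp: smooth_section_def smooth_on_const)
  have delbar0: "delbar n (\<lambda>_. frame n j) = (\<lambda>w. 0\<^sub>v n)" for j
    by (auto simp: delbar_def fun_eq_iff)
  have nabla: "nabla_z n A (\<lambda>_. frame n j) w = A w *\<^sub>v frame n j" if "w \<in> X" for w j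
  proof -
    have "A w *\<^sub>v frame n j \<in> carrier_vec n" using Acar[OF that] by (intro mult_mat_vec_carrier) auto
    moreover have "Matrix.vec n (\<lambda>i. 0::complex) = 0\<^sub>v n" by auto
    ultimately show ?thesis by (simp add: nabla_z_def)
  qed
  have AH: "wirtinger_z (H i) w = A w $$ (i - 1, i - 1) * H i w" if w: "w \<in> X" for w
  proof -
    have "wirtinger_z (H i) w = h w (nabla_z n A (\<lambda>_. frame n i) w) (frame n i) + h w (frame n i) (delbar n (\<lambda>_. frame n i) w)"
      using chern sec w unfolding chern_connection_def H_def by blast
    also have "\<dots> = h w (A w *\<^sub>v frame n i) (frame n i)"
      by (simp add: nabla[OF w] delbar0 hermitian_zero[OF herm w])
    also have "\<dots> = A w $$ (i - 1, i - 1) * H i w"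
      by (rule comp_mult[OF w Acar[OF w] i i])
    finally show ?thesis .
  qed
  have "has_laplacian (\<lambda>w. ln (Re (H i w))) (4 * Re (wirtinger_zbar (\<lambda>w. A w $$ (i - 1, i - 1)) z)) z"
    by (rule has_laplacian_ln_of_wirtinger[OF X z Hdiff[OF _ i] HIm Hpos[OF _ i] Adiff[OF z i1 i1] AH])
  moreover have "wirtinger_zbar (\<lambda>w. A w $$ (i - 1, i - 1)) z = of_real (\<omega> (i - 1) z - \<omega> i z)"
  proof -
    have T'car: "\<Theta>' z \<in> carrier_mat n n" using adj z by (simp add: metric_adjoint_def)
    have c1: "vec_index (curvature n A (\<lambda>_. frame n i) z) (i - 1) = - wirtinger_zbar (\<lambda>w. A w $$ (i - 1, i - 1)) z"
    proof -
      have "nabla_z n A (\<lambda>w. 0\<^sub>v n) z = 0\<^sub>v n"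
      proof -
        have "A z *\<^sub>v 0\<^sub>v n = 0\<^sub>v n" using Acar[OF z] by (auto simp: mult_mat_vec_def)
        then show ?thesis by (auto simp: nabla_z_def)
      qed
      then have "vec_index (curvature n A (\<lambda>_. frame n i) z) (i - 1) =
         - wirtinger_zbar (\<lambda>w. vec_index (nabla_z n A (\<lambda>_. frame n i) w) (i - 1)) z"
        using i1 by (simp add: curvature_def delbar0) (simp add: delbar_def)
      also have "wirtinger_zbar (\<lambda>w. vec_index (nabla_z n A (\<lambda>_. frame n i) w) (i - 1)) z
         = wirtinger_zbar (\<lambda>w. A w $$ (i - 1, i - 1)) z"
        by (rule wirtinger_zbar_cong[OF X z _ Adiff[OF z i1 i1]]) (simp only: nabla mult_mat_frame[OF Acar i i1])
      finally show ?thesis .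
    qed
    have T: "\<Theta> z $$ (k, j - 1) = (if j < n \<and> k = j then \<gamma> j z else 0)" if "j \<in> {1..n}" "k < n" for j k
    proof (cases "j < n")
      case True
      then have "\<Theta> z *\<^sub>v frame n j = \<gamma> j z \<cdot>\<^sub>v frame n (j + 1)" using \<Theta>e[OF z, of j] that by auto
      moreover have "vec_index (\<gamma> j z \<cdot>\<^sub>v frame n (j + 1)) k = (if k = j then \<gamma> j z else 0)"
        using that True by (simp add: frame_def)
      ultimately show ?thesis using mult_mat_frame[OF \<Theta>[OF z] that] True by (simp only: simp_thms)
    next
      case False
      then have "j = n" using that by auto
      then show ?thesis using mult_mat_frame[OF \<Theta>[OF z] that] \<Theta>n[OF z] that by simp
    qed
    \<comment> \<open>The adjoint goes one step back along the chain; the ratio of the metric comes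
      from h (\<Theta> e_j, e_k) = h (e_j, \<Theta>' e_k), evaluated in the orthogonal
      frame.\<close>
    have T': "\<Theta>' z $$ (j - 1, k - 1) = (if j < n \<and> k = Suc j then cnj (\<gamma> j z) * of_real (Re (H k z) / Re (H j z)) else 0)"
      if j: "j \<in> {1..n}" and k: "k \<in> {1..n}" for j k
    proof -
      have e: "h z (\<Theta> z *\<^sub>v frame n j) (frame n k) = h z (frame n j) (\<Theta>' z *\<^sub>v frame n k)"
        using adj z by (simp add: metric_adjoint_def)
      have "h z (\<Theta> z *\<^sub>v frame n j) (frame n k) = \<Theta> z $$ (k - 1, j - 1) * H k z"
        by (rule comp_mult[OF z \<Theta>[OF z] k j])
      moreover have "h z (frame n j) (\<Theta>' z *\<^sub>v frame n k) = cnj (\<Theta>' z $$ (j - 1, k - 1) * H j z)"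
        unfolding comp_mult[OF z T'car j k, symmetric]
        by (rule cnj_sym[OF z mult_mat_vec_carrier[OF T'car frame_carrier] frame_carrier])
      moreover have real: "H l z = of_real (Re (H l z))" for l using HIm[OF z, of l] by (simp add: complex_eq_iff)
      ultimately have "\<Theta> z $$ (k - 1, j - 1) * of_real (Re (H k z)) = cnj (\<Theta>' z $$ (j - 1, k - 1)) * of_real (Re (H j z))"
        using e by (metis complex_cnj_complex_of_real complex_cnj_mult)
      then have "cnj (\<Theta> z $$ (k - 1, j - 1)) * of_real (Re (H k z)) = \<Theta>' z $$ (j - 1, k - 1) * of_real (Re (H j z))"
        by (metis complex_cnj_cnj complex_cnj_complex_of_real complex_cnj_mult)
      then have "\<Theta>' z $$ (j - 1, k - 1) = cnj (\<Theta> z $$ (k - 1, j - 1)) * of_real (Re (H k z)) / of_real (Re (H j z))"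
        using Hpos[OF z j] by (simp add: field_simps)
      moreover have "k - 1 < n" "k - 1 = j \<longleftrightarrow> k = Suc j" using k by auto
      ultimately show ?thesis using T[OF j, of "k - 1"] by (simp only:) simp
    qed
    have prod1: "(\<Theta> z * \<Theta>' z) $$ (i - 1, i - 1) = of_real (\<omega> (i - 1) z)"
    proof -
      have "(\<Theta> z * \<Theta>' z) $$ (i - 1, i - 1) = (\<Sum>k<n. \<Theta> z $$ (i - 1, k) * \<Theta>' z $$ (k, i - 1))"
        using \<Theta>[OF z] T'car i1 by (simp add: scalar_prod_def lessThan_atLeast0)
      \<comment> \<open>Frame vectors are numbered from 1 and matrix entries from 0, so the one
        contribution, through e_(i-1), sits at k = i - 2. The guard \<open>i \<ge> 2\<close>
        excludes the truncated difference for i = 1.\<close>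
      also have "\<dots> = (\<Sum>k<n. if k = i - 2 \<and> i \<ge> 2 then of_real (\<omega> (i - 1) z) else 0)"
      proof (intro sum.cong refl)
        fix k assume k: "k \<in> {..<n}"
        have eq: "\<Theta> z $$ (i - 1, k) * \<Theta>' z $$ (k, i - 1) = (if Suc k < n \<and> i - 1 = Suc k then \<gamma> (Suc k) z else 0) *
          (if Suc k < n \<and> i = Suc (Suc k) then cnj (\<gamma> (Suc k) z) * of_real (Re (H i z) / Re (H (Suc k) z)) else 0)"
          using T[of "Suc k" "i - 1"] T'[of "Suc k" i] k i i1 by simp
        show "\<Theta> z $$ (i - 1, k) * \<Theta>' z $$ (k, i - 1) = (if k = i - 2 \<and> i \<ge> 2 then of_real (\<omega> (i - 1) z) else 0)"
        proof (cases "i = Suc (Suc k)")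
          case True
          have "\<gamma> (Suc k) z * (cnj (\<gamma> (Suc k) z) * of_real (Re (H i z) / Re (H (Suc k) z)))
            = of_real ((cmod (\<gamma> (Suc k) z))\<^sup>2 * (Re (H i z) / Re (H (Suc k) z)))"
            unfolding of_real_mult complex_norm_square by (simp add: mult.assoc)
          then show ?thesis unfolding eq using True i by (simp add: \<omega>_def)
        next
          case False
          then show ?thesis unfolding eq by auto
        qed
      qed
      also have "\<dots> = of_real (\<omega> (i - 1) z)"
        using i by (cases "i \<ge> 2") (auto simp: \<omega>_def)
      finally show ?thesis .
    qed
    have prod2: "(\<Theta>' z * \<Theta> z) $$ (i - 1, i - 1) = of_real (\<omega> i z)"
    proof -
      have "(\<Theta>' z * \<Theta> z) $$ (i - 1, i - 1) = (\<Sum>k<n. \<Theta>' z $$ (i - 1, k) * \<Theta> z $$ (k, i - 1))"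
        using \<Theta>[OF z] T'car i1 by (simp add: scalar_prod_def lessThan_atLeast0)
      also have "\<dots> = (\<Sum>k<n. if k = i then of_real (\<omega> i z) else 0)"
      proof (intro sum.cong refl)
        fix k assume k: "k \<in> {..<n}"
        have eq: "\<Theta>' z $$ (i - 1, k) * \<Theta> z $$ (k, i - 1) =
          (if i < n \<and> Suc k = Suc i then cnj (\<gamma> i z) * of_real (Re (H (Suc k) z) / Re (H i z)) else 0) *
          (if i < n \<and> k = i then \<gamma> i z else 0)"
          using T[OF i, of k] T'[OF i, of "Suc k"] k by simp
        show "\<Theta>' z $$ (i - 1, k) * \<Theta> z $$ (k, i - 1) = (if k = i then of_real (\<omega> i z) else 0)"
        proof (cases "k = i")
          case True
          have "cnj (\<gamma> i z) * of_real (Re (H (Suc i) z) / Re (H i z)) * \<gamma> i z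
            = of_real ((cmod (\<gamma> i z))\<^sup>2 * (Re (H (Suc i) z) / Re (H i z)))"
            unfolding of_real_mult complex_norm_square by (simp add: mult_ac)
          then show ?thesis unfolding eq using True k i by (simp add: \<omega>_def)
        next
          case False
          then show ?thesis unfolding eq by auto
        qed
      qed
      also have "\<dots> = of_real (\<omega> i z)" by (auto simp: \<omega>_def)
      finally show ?thesis .
    qed
    define M where "M = \<Theta> z * \<Theta>' z - \<Theta>' z * \<Theta> z"
    have M: "M \<in> carrier_mat n n" using \<Theta>[OF z] T'car
      by (auto simp: M_def intro!: minus_carrier_mat mult_carrier_mat[of _ n n])
    have "vec_index (curvature n A (\<lambda>_. frame n i) z + M *\<^sub>v frame n i) (i - 1) = 0"
      using curv[OF sec z, of i] i1 by (simp add: M_def)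
    then have "- wirtinger_zbar (\<lambda>w. A w $$ (i - 1, i - 1)) z + M $$ (i - 1, i - 1) = 0"
      using c1 mult_mat_frame[OF M i i1] M i1 by simp
    moreover have "M $$ (i - 1, i - 1) = of_real (\<omega> (i - 1) z) - of_real (\<omega> i z)"
      using prod1 prod2 \<Theta>[OF z] T'car i1 by (simp add: M_def)
    ultimately show ?thesis by simp
  qed
  ultimately show ?thesis by simp
qed


text \<open>
  A crude substitute for the weighted inequality of arithmetic and geometric means; constants do not
  matter, because they can be absorbed into \<open>\<phi>\<close>.
\<close>

lemma prod_power_le_sum_power:
  fixes w :: "'a \<Rightarrow> real"
  assumes "finite I" "\<And>i. i \<in> I \<Longrightarrow> 0 \<le> w i"
  shows "(\<Prod>i\<in>I. w i ^ c i) \<le> (\<Sum>i\<in>I. w i) ^ (\<Sum>i\<in>I. c i)"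
  unfolding power_sum using assms by (intro prod_mono conjI power_mono member_le_sum) auto

theorem proposition6p10:
  fixes n :: nat
    and \<gamma> :: "nat \<Rightarrow> complex \<Rightarrow> complex"
    and \<alpha> :: "complex \<Rightarrow> complex"
    and \<Theta> :: "complex \<Rightarrow> complex mat"
  assumes "n \<ge> 2"
    and "\<And>i. i \<in> {1..n-1} \<Longrightarrow> \<gamma> i holomorphic_on unit_disc"
    and "\<alpha> holomorphic_on unit_disc"
    and "\<exists>z\<in>unit_disc. \<alpha> z \<noteq> 0"
    and "\<And>z. z \<in> unit_disc \<Longrightarrow>
           (\<Prod>i=1..n-1. \<gamma> i z ^ (i * (n - i))) = \<alpha> z ^ (n * (n\<^sup>2 - 1) div 6)"
    and "\<And>z. z \<in> unit_disc \<Longrightarrow> \<Theta> z \<in> carrier_mat n n"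
    and "\<And>z i. z \<in> unit_disc \<Longrightarrow> i \<in> {1..n-1} \<Longrightarrow>
           \<Theta> z *\<^sub>v frame n i = \<gamma> i z \<cdot>\<^sub>v frame n (i + 1)"
    and "\<And>z. z \<in> unit_disc \<Longrightarrow> \<Theta> z *\<^sub>v frame n n = 0\<^sub>v n"
    and "\<exists>h. harmonic_metric n unit_disc \<Theta> h \<and> diagonal_metric n unit_disc h"
  shows "\<exists>f. f holomorphic_on unit_disc \<and> (\<forall>z\<in>unit_disc. f z \<noteq> 0) \<and>
           (\<lambda>z. (cmod (\<alpha> z * f z))\<^sup>2) \<in> class_A"
proof -
  obtain h where h: "harmonic_metric n unit_disc \<Theta> h" "diagonal_metric n unit_disc h" using assms(9) by blast
  have herm: "hermitian_metric n unit_disc h" using h(1) by (simp add: harmonic_metric_def)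
  define hr where "hr = (\<lambda>i w. Re (h w (frame n i) (frame n i)))"
  define \<omega> where "\<omega> = (\<lambda>i z. if 1 \<le> i \<and> i < n then (cmod (\<gamma> i z))\<^sup>2 * (hr (Suc i) z / hr i z) else 0)"
  define N where "N = n * (n\<^sup>2 - 1) div 6"
  have N: "N = (\<Sum>i=1..n-1. i * (n - i))" using sum_weights[of n] assms(1) by (simp add: N_def)
  have N_pos: "N > 0"
  proof -
    have "1 * (n - 1) \<le> (\<Sum>i=1..n-1. i * (n - i))" using assms(1) by (intro member_le_sum) auto
    then show ?thesis using assms(1) N by linarith
  qed
  have hr_pos: "hr i z > 0" if "z \<in> unit_disc" "i \<in> {1..n}" for z i
  proof -
    have "i - 1 < n" using that by auto
    then have "vec_index (frame n i) (i - 1) \<noteq> vec_index (0\<^sub>v n) (i - 1)"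
      using frame_index[OF that(2)] by simp
    then have "frame n i \<noteq> 0\<^sub>v n" by metis
    then show ?thesis using herm that unfolding hermitian_metric_def hr_def by (meson frame_carrier)
  qed
  have hr_cont: "continuous_on unit_disc (hr i)" if "i \<in> {1..n}" for i
  proof -
    have "smooth_on unit_disc (\<lambda>z. h z (frame n i) (frame n i))"
      using herm that unfolding hermitian_metric_def by blast
    then have "continuous_on unit_disc (\<lambda>z. h z (frame n i) (frame n i))"
      unfolding smooth_on_def by (metis Ck_on.simps(1))
    then show ?thesis unfolding hr_def by (intro continuous_intros)
  qed
  define \<phi>0 where "\<phi>0 = (\<lambda>z. 1 / real N * (\<Sum>i=1..n-1. real (i * (n - i)) * (ln (hr (Suc i) z) - ln (hr i z))))"
  \<comment> \<open>The shift by ln N absorbs the factor 1 / N in the Laplacian of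
    \<open>\<phi>0\<close>.\<close>
  define \<phi> where "\<phi> = (\<lambda>z. \<phi>0 z - ln (real N))"
  have lap: "\<exists>L\<ge>8 * (cmod (\<alpha> z))\<^sup>2 * exp (\<phi> z). has_laplacian \<phi> L z" if z: "z \<in> unit_disc" for z
  proof -
    define d where "d = (\<lambda>i. \<omega> (i - 1) z - \<omega> i z)"
    have ln_lap: "has_laplacian (\<lambda>w. ln (hr i w)) (4 * d i) z" if i: "i \<in> {1..n}" for i
      unfolding hr_def d_def \<omega>_def
      by (rule diagonal_harmonic_metric_equation[OF open_ball h assms(6,7,8) z i])
    define L where "L = 1 / real N * (\<Sum>i=1..n-1. real (i * (n - i)) * (4 * d (Suc i) - 4 * d i)) - 0"
    have "has_laplacian \<phi> L z"
      unfolding \<phi>_def \<phi>0_def L_def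
      by (intro has_laplacian_diff has_laplacian_cmult has_laplacian_sum has_laplacian_const ln_lap) auto
    moreover have L_eq: "L = 8 / real N * (\<Sum>i=1..n-1. \<omega> i z)"
    proof -
      obtain m where m: "n = Suc m" using assms(1) by (cases n) auto
      \<comment> \<open>These end values remove the boundary terms of the second summation by
        parts.\<close>
      have \<omega>_0: "\<omega> 0 z = 0" "\<omega> (Suc m) z = 0" by (simp_all add: \<omega>_def m)
      have "(\<Sum>i=1..n-1. real (i * (n - i)) * (4 * d (Suc i) - 4 * d i))
         = 4 * (\<Sum>i=1..m. real i * real (n - i) * (d (Suc i) - d i))"
      proof -
        have "x * y * (4 * a - 4 * b) = 4 * (x * y * (a - b))" for x y a b :: real
          by (simp add: algebra_simps)
        then show ?thesis by (simp only: sum_distrib_left of_nat_mult m diff_Suc_1)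
      qed
      also have "(\<Sum>i=1..m. real i * real (n - i) * (d (Suc i) - d i)) = (\<Sum>j=1..Suc m. (2 * real j - real n - 1) * d j)"
        using sum_second_difference[of m n d] by (simp add: m)
      also have "\<dots> = 2 * (\<Sum>j=1..Suc m. \<omega> j z)"
        unfolding d_def sum_by_parts_linear[where w = "\<lambda>j. \<omega> j z"]
        by (simp only: \<omega>_0 mult_zero_right diff_0_right add_0_right)
      also have "(\<Sum>j=1..Suc m. \<omega> j z) = (\<Sum>j=1..m. \<omega> j z)" by (simp add: \<omega>_0)
      finally show ?thesis by (simp add: L_def m)
    qed
    moreover have "8 * (cmod (\<alpha> z))\<^sup>2 * exp (\<phi> z) \<le> L"
    proof -
      have \<omega>_nonneg: "0 \<le> \<omega> i z" for i
        using hr_pos[OF z, of i] hr_pos[OF z, of "Suc i"] by (auto simp: \<omega>_def intro!: mult_nonneg_nonneg divide_nonneg_nonneg)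
      \<comment> \<open>The exponents are those of the product hypothesis: the factors
        |\<gamma>_i|^2 combine to |\<alpha>|^(2 N), and the ratios of the metric to exp (N
        \<phi>0).\<close>
      have "((cmod (\<alpha> z))\<^sup>2 * exp (\<phi>0 z)) ^ N = (\<Prod>i=1..n-1. \<omega> i z ^ (i * (n - i)))"
      proof -
        have "(\<Prod>i=1..n-1. \<omega> i z ^ (i * (n - i))) =
          (\<Prod>i=1..n-1. (cmod (\<gamma> i z ^ (i * (n - i))))\<^sup>2 * exp (real (i * (n - i)) * (ln (hr (Suc i) z) - ln (hr i z))))"
        proof (intro prod.cong refl)
          fix i assume i: "i \<in> {1..n-1}"
          then have p: "hr i z > 0" "hr (Suc i) z > 0" "1 \<le> i \<and> i < n" using hr_pos[OF z] by auto
          have "exp (real (i * (n - i)) * (ln (hr (Suc i) z) - ln (hr i z))) = (hr (Suc i) z / hr i z) ^ (i * (n - i))"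
            using p by (simp only: exp_of_nat_mult exp_diff exp_ln)
          moreover have "\<omega> i z = (cmod (\<gamma> i z))\<^sup>2 * (hr (Suc i) z / hr i z)" using p(3) by (simp add: \<omega>_def)
          ultimately show "\<omega> i z ^ (i * (n - i)) =
            (cmod (\<gamma> i z ^ (i * (n - i))))\<^sup>2 * exp (real (i * (n - i)) * (ln (hr (Suc i) z) - ln (hr i z)))"
            by (simp only: power_mult_distrib norm_power power_mult[symmetric] mult.commute[of 2])
        qed
        also have "\<dots> = (cmod (\<Prod>i=1..n-1. \<gamma> i z ^ (i * (n - i))))\<^sup>2 * exp (real N * \<phi>0 z)"
        proof -
          have "real N * \<phi>0 z = (\<Sum>i=1..n-1. real (i * (n - i)) * (ln (hr (Suc i) z) - ln (hr i z)))"
            using N_pos by (simp add: \<phi>0_def)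
          then show ?thesis
            by (simp only: prod.distrib prod_power_distrib[symmetric] prod_norm exp_sum[OF finite_atLeastAtMost])
        qed
        also have "\<dots> = ((cmod (\<alpha> z))\<^sup>2 * exp (\<phi>0 z)) ^ N"
          unfolding assms(5)[OF z] N_def[symmetric] exp_of_nat_mult norm_power power_mult_distrib
          by (simp add: power_mult[symmetric] mult.commute)
        finally show ?thesis by simp
      qed
      also have "\<dots> \<le> (\<Sum>i=1..n-1. \<omega> i z) ^ N"
        unfolding N by (rule prod_power_le_sum_power) (auto simp: \<omega>_nonneg)
      finally have "(cmod (\<alpha> z))\<^sup>2 * exp (\<phi>0 z) \<le> (\<Sum>i=1..n-1. \<omega> i z)"
        using N_pos by (auto simp: power_mono_iff \<omega>_nonneg sum_nonneg)
      then have "8 / real N * ((cmod (\<alpha> z))\<^sup>2 * exp (\<phi>0 z)) \<le> L"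
        unfolding L_eq by (intro mult_left_mono) auto
      moreover have "exp (\<phi> z) = exp (\<phi>0 z) / real N" using N_pos by (simp add: \<phi>_def exp_diff)
      ultimately show ?thesis by (simp add: mult_ac)
    qed
    ultimately show ?thesis by blast
  qed
  have "continuous_on unit_disc \<phi>"
    unfolding \<phi>_def \<phi>0_def
  proof (intro continuous_intros)
    fix i assume i: "i \<in> {1..n-1}"
    then have i': "i \<in> {1..n}" "Suc i \<in> {1..n}" by auto
    show "continuous_on unit_disc (hr i)" "continuous_on unit_disc (hr (Suc i))" using hr_cont i' by auto
    show "\<forall>z\<in>unit_disc. hr i z \<noteq> 0" "\<forall>z\<in>unit_disc. hr (Suc i) z \<noteq> 0" using hr_pos i' by (metis less_irrefl)+
  qed
  from ex_nonvanishing_square_integrable[OF assms(3,4) this lap]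
  obtain f where f: "f holomorphic_on unit_disc" "\<forall>z\<in>unit_disc. f z \<noteq> 0"
    "(\<integral>\<^sup>+z\<in>unit_disc. ennreal ((cmod (\<alpha> z * f z))\<^sup>2 * (1 - (cmod z)\<^sup>2)) \<partial>lborel) \<le> 4" by blast
  have "smooth_on unit_disc (\<lambda>z. (cmod (\<alpha> z * f z))\<^sup>2)"
    by (intro smooth_on_norm_square holomorphic_intros assms(3) f(1)) auto
  moreover have "(\<integral>\<^sup>+z\<in>unit_disc. ennreal ((cmod (\<alpha> z * f z))\<^sup>2 * (1 - (cmod z)\<^sup>2)) \<partial>lborel) < \<infinity>"
    using f(3) by (rule le_less_trans) simp
  ultimately have "(\<lambda>z. (cmod (\<alpha> z * f z))\<^sup>2) \<in> class_A" by (simp add: class_A_def)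
  with f show ?thesis by blast
qed

end
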